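(* For each $N\ge 1$, let $(U^N_t)_{t\ge 0}$ be a Brownian motion on $\mathbb{U}_N$, let $\mathbb{V}^N$ and $\mathbb{W}^N$ be subspaces of $\mathbb{C}^N$, and suppose that the orthogonal projections onto these subspaces converge jointly strongly as $N\to\infty$. Suppose there is a fixed finite set $\boldsymbol{\theta} = \{\theta_1,\ldots,\theta_k\}$ of angles so that all principal angles between $\mathbb{V}^N$ and $\mathbb{W}^N$ are in $\boldsymbol{\theta}$ for all $N$. Then, for any open neighborhood $\mathscr{O}$ of $\boldsymbol{\theta}$, there is a $T>0$ so that, for $0\le t\le T$, it is almost surely true that for all large $N$, all principal angles between $U^N_t(\mathbb{V}^N)$ and $\mathbb{W}^N$ are in $\mathscr{O}$.
   Context: $\mathbb{M}_N$ is the space of $N\times N$ complex matrices, $\mathrm{Tr}$ the usual trace, $\mathrm{tr}=\frac1N\mathrm{Tr}$, $\mathbb{U}_N$ the unitary group in $\mathbb{M}_N$. All random matrices (for all $N$) are defined on a common probability space. Brownian motion on $\mathbb{U}_N$: on $\mathfrak{u}_N=\{X\in\mathbb{M}_N: X^*=-X\}$ use the inner product $\langle X,Y\rangle_N=-N\,\mathrm{Tr}(XY)$; let $(\partial_Xf)(U)=\frac{d}{dt}\big|_{t=0}f(Ue^{tX})$ and $\Delta_{\mathbb{U}_N}=\sum_{X\in\beta_N}\partial_X^2$ for any orthonormal basis $\beta_N$ of $\mathfrak{u}_N$. The Brownian motion is the diffusion on $\mathbb{U}_N$ with generator $\frac12\Delta_{\mathbb{U}_N}$ and $U^N_0=I_N$.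 Equivalently it solves the Itô SDE $dU^N_t=iU^N_t\,dX^N_t-\frac12U^N_t\,dt$, $U_0^N=I_N$, where $X^N_t$ is Hermitian and $[X^N_t]_{jj},\Re[X^N_t]_{jk},\Im[X^N_t]_{jk}$ ($j<k$) are independent Brownian motions, of variance $t/N$ on the diagonal and $t/(2N)$ off the diagonal. Joint strong convergence of the projections: with $P^N,Q^N\in\mathbb{M}_N$ the orthogonal projections onto $\mathbb{V}^N,\mathbb{W}^N$, there are elements $p,q$ of a $W^*$-probability space $(\mathscr{A},\tau)$ (a von Neumann algebra with a faithful normal tracial state) such that for every noncommutative polynomial $F$ in two variables, $\mathrm{tr}\,F(P^N,Q^N)\to\tau(F(p,q))$ and $\|F(P^N,Q^N)\|\to\|F(p,q)\|$ (operator norms) as $N\to\infty$. Principal angles between subspaces $\mathbb{V},\mathbb{W}$ of $\mathbb{C}^N$ are the standard ones: the angles in $[0,\pi/2]$ whose cosines are the $\min(\dim\mathbb{V},\dim\mathbb{W})$ largest singular values of $QP$, where $P,Q$ are the orthogonal projections onto $\mathbb{V},\mathbb{W}$. *)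

theory Defs
  imports
    "HOL-Probability.Probability"
    "HOL-Library.Poly_Mapping"
    "Jordan_Normal_Form.Schur_Decomposition"
    "Jordan_Normal_Form.VS_Connect"
begin

section \<open>Matrices and subspaces of complex N-space\<close>

definition cvec_norm :: "complex Matrix.vec \<Rightarrow> real" where
  "cvec_norm v = L2_set (\<lambda>i. cmod (vec_index v i)) {..<dim_vec v}"

definition opnorm :: "complex mat \<Rightarrow> real" where
  "opnorm A = (SUP v \<in> {v \<in> carrier_vec (dim_col A). cvec_norm v \<le> 1}. cvec_norm (A *\<^sub>v v))"

definition mat_trace :: "complex mat \<Rightarrow> complex" where
  "mat_trace A = (\<Sum>i<dim_row A. A $$ (i, i))"

definition csubspace :: "nat \<Rightarrow> complex Matrix.vec set \<Rightarrow> bool" where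
  "csubspace N V \<longleftrightarrow> VectorSpace.subspace class_ring V (module_vec TYPE(complex) N)"

definition csubspace_dim :: "nat \<Rightarrow> complex Matrix.vec set \<Rightarrow> nat" where
  "csubspace_dim N V = vectorspace.dim class_ring ((module_vec TYPE(complex) N)\<lparr>carrier := V\<rparr>)"

definition orth_proj :: "nat \<Rightarrow> complex Matrix.vec set \<Rightarrow> complex mat" where
  "orth_proj N V = (THE P. P \<in> carrier_mat N N \<and> P * P = P \<and> mat_adjoint P = P \<and>
     (\<lambda>v. P *\<^sub>v v) ` carrier_vec N = V)"

text \<open>Singular values with multiplicity, in decreasing order: the square roots of the eigenvalues of
  \<open>A\<^sup>* A\<close>, which are real and nonnegative.\<close>

definition singular_values :: "complex mat \<Rightarrow> real list" where
  "singular_values A = rev (sorted_list_of_multiset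
     (image_mset (\<lambda>z. sqrt (Re z)) (proots (char_poly (mat_adjoint A * A)))))"

definition principal_angles :: "nat \<Rightarrow> complex Matrix.vec set \<Rightarrow> complex Matrix.vec set \<Rightarrow> real list" where
  "principal_angles N V W =
     map arccos (take (min (csubspace_dim N V) (csubspace_dim N W))
                      (singular_values (orth_proj N W * orth_proj N V)))"


section \<open>Brownian motion on the unitary group\<close>

definition unitary_group :: "nat \<Rightarrow> complex mat set" where
  "unitary_group N = {A \<in> carrier_mat N N. A * mat_adjoint A = 1\<^sub>m N \<and> mat_adjoint A * A = 1\<^sub>m N}"

definition unitary_lie :: "nat \<Rightarrow> complex mat set" where
  "unitary_lie N = {X \<in> carrier_mat N N. mat_adjoint X = - X}"

text \<open>Real-valued on \<^term>\<open>unitary_lie N\<close>, hence the \<^const>\<open>Re\<close>.\<close>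

definition lie_inner :: "nat \<Rightarrow> complex mat \<Rightarrow> complex mat \<Rightarrow> real" where
  "lie_inner N X Y = - real N * Re (mat_trace (X * Y))"

text \<open>The spanning condition is entrywise because \<^typ>\<open>complex mat\<close> is not a type of class
  \<^class>\<open>real_vector\<close>.\<close>

definition lie_onb :: "nat \<Rightarrow> complex mat set \<Rightarrow> bool" where
  "lie_onb N \<beta> \<longleftrightarrow> finite \<beta> \<and> \<beta> \<subseteq> unitary_lie N \<and>
     (\<forall>X\<in>\<beta>. \<forall>Y\<in>\<beta>. lie_inner N X Y = (if X = Y then 1 else 0)) \<and>
     (\<forall>X\<in>unitary_lie N. \<exists>c :: complex mat \<Rightarrow> real. \<forall>i<N. \<forall>j<N.
        X $$ (i, j) = (\<Sum>B\<in>\<beta>. complex_of_real (c B) * B $$ (i, j)))"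

definition mat_exp :: "complex mat \<Rightarrow> complex mat" where
  "mat_exp A = mat (dim_row A) (dim_row A) (\<lambda>(i, j). suminf (\<lambda>n. (A ^\<^sub>m n) $$ (i, j) / fact n))"

abbreviation lie_curve :: "complex mat \<Rightarrow> complex mat \<Rightarrow> real \<Rightarrow> complex mat" where
  "lie_curve A X t \<equiv> A * mat_exp (complex_of_real t \<cdot>\<^sub>m X)"

definition lie_deriv :: "complex mat \<Rightarrow> (complex mat \<Rightarrow> real) \<Rightarrow> complex mat \<Rightarrow> real" where
  "lie_deriv X f A = deriv (\<lambda>t. f (lie_curve A X t)) 0"

text \<open>Any orthonormal basis gives the same operator on \<open>C\<^sup>2\<close> functions.\<close>

definition laplacian :: "nat \<Rightarrow> (complex mat \<Rightarrow> real) \<Rightarrow> complex mat \<Rightarrow> real" where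
  "laplacian N f A = (\<Sum>X\<in>(SOME \<beta>. lie_onb N \<beta>). lie_deriv X (lie_deriv X f) A)"

definition continuous_on_unitary :: "nat \<Rightarrow> (complex mat \<Rightarrow> real) \<Rightarrow> bool" where
  "continuous_on_unitary N f \<longleftrightarrow> (\<forall>A\<in>unitary_group N. \<forall>e>0. \<exists>d>0. \<forall>B\<in>unitary_group N.
     opnorm (B - A) < d \<longrightarrow> \<bar>f B - f A\<bar> < e)"

text \<open>Since the left-invariant vector fields form a smooth global frame of the tangent bundle, the
  \<open>C\<^sup>1\<close> functions on the unitary group are those whose derivatives along these fields exist and
  are continuous, and similarly for \<open>C\<^sup>2\<close>.\<close>

definition C1_unitary :: "nat \<Rightarrow> (complex mat \<Rightarrow> real) \<Rightarrow> bool" where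
  "C1_unitary N f \<longleftrightarrow> continuous_on_unitary N f \<and> (\<forall>X\<in>unitary_lie N.
     (\<forall>A\<in>unitary_group N. (\<lambda>t. f (lie_curve A X t)) field_differentiable (at 0)) \<and>
     continuous_on_unitary N (lie_deriv X f))"

definition C2_unitary :: "nat \<Rightarrow> (complex mat \<Rightarrow> real) \<Rightarrow> bool" where
  "C2_unitary N f \<longleftrightarrow> C1_unitary N f \<and> (\<forall>X\<in>unitary_lie N. C1_unitary N (lie_deriv X f))"

definition natural_filtration ::
    "'w measure \<Rightarrow> nat \<Rightarrow> (real \<Rightarrow> 'w \<Rightarrow> complex mat) \<Rightarrow> real \<Rightarrow> 'w measure" where
  "natural_filtration M N U t = sigma (space M)
     {{\<omega> \<in> space M. U s \<omega> $$ (i, j) \<in> B} | s i j B.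
        0 \<le> s \<and> s \<le> t \<and> i < N \<and> j < N \<and> B \<in> sets borel}"

definition martingale ::
    "'w measure \<Rightarrow> (real \<Rightarrow> 'w measure) \<Rightarrow> (real \<Rightarrow> 'w \<Rightarrow> real) \<Rightarrow> bool" where
  "martingale M F X \<longleftrightarrow>
     (\<forall>t\<ge>0. integrable M (X t) \<and> X t \<in> borel_measurable (F t)) \<and>
     (\<forall>s\<ge>0. \<forall>t\<ge>s. AE \<omega> in M. real_cond_exp M (F s) (X t) \<omega> = X s \<omega>)"

text \<open>The diffusion with generator half the Laplacian, started at the identity: a continuous process
  on the unitary group that solves the martingale problem for this generator.\<close>

definition unitary_brownian_motion ::
    "'w measure \<Rightarrow> nat \<Rightarrow> (real \<Rightarrow> 'w \<Rightarrow> complex mat) \<Rightarrow> bool" where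
  "unitary_brownian_motion M N U \<longleftrightarrow>
     (\<forall>t\<ge>0. \<forall>\<omega>\<in>space M. U t \<omega> \<in> unitary_group N) \<and>
     (\<forall>\<omega>\<in>space M. U 0 \<omega> = 1\<^sub>m N) \<and>
     (\<forall>t\<ge>0. \<forall>i<N. \<forall>j<N. (\<lambda>\<omega>. U t \<omega> $$ (i, j)) \<in> borel_measurable M) \<and>
     (\<forall>\<omega>\<in>space M. \<forall>i<N. \<forall>j<N. continuous_on {0..} (\<lambda>t. U t \<omega> $$ (i, j))) \<and>
     (\<forall>f. C2_unitary N f \<longrightarrow>
        martingale M (natural_filtration M N U)
          (\<lambda>t \<omega>. f (U t \<omega>) - f (U 0 \<omega>) - integral {0..t} (\<lambda>s. 1/2 * laplacian N f (U s \<omega>))))"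


section \<open>Tracial von Neumann algebras\<close>

text \<open>Complex Hilbert spaces. The complex inner product is linear in its first argument; its real
  part is the real inner product, so that the norm is the usual one and the operator norm is that of
  the type \<open>'h \<Rightarrow>\<^sub>L 'h\<close> of real-linear bounded operators.\<close>

class chilbert_space = real_inner + complete_space +
  fixes scaleC :: "complex \<Rightarrow> 'a \<Rightarrow> 'a"
    and cinner :: "'a \<Rightarrow> 'a \<Rightarrow> complex"
  assumes scaleC_add_right: "scaleC a (x + y) = scaleC a x + scaleC a y"
    and scaleC_add_left: "scaleC (a + b) x = scaleC a x + scaleC b x"
    and scaleC_scaleC: "scaleC a (scaleC b x) = scaleC (a * b) x"
    and scaleC_of_real: "scaleC (complex_of_real r) x = scaleR r x"
    and cinner_commute: "cinner x y = cnj (cinner y x)"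
    and cinner_add_left: "cinner (x + y) z = cinner x z + cinner y z"
    and cinner_scaleC_left: "cinner (scaleC a x) y = a * cinner x y"
    and inner_eq_Re_cinner: "inner x y = Re (cinner x y)"

type_synonym 'h op = "'h \<Rightarrow>\<^sub>L 'h"

definition clinear_ops :: "'h::chilbert_space op set" where
  "clinear_ops = {T. \<forall>c x. blinfun_apply T (scaleC c x) = scaleC c (blinfun_apply T x)}"

definition scaleC_op :: "complex \<Rightarrow> 'h::chilbert_space op \<Rightarrow> 'h op" where
  "scaleC_op c T = Blinfun (\<lambda>x. scaleC c (blinfun_apply T x))"

definition adjoint_op :: "'h::chilbert_space op \<Rightarrow> 'h op" where
  "adjoint_op T = (THE S. \<forall>x y. cinner (blinfun_apply T x) y = cinner x (blinfun_apply S y))"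

definition op_le :: "'h::chilbert_space op \<Rightarrow> 'h op \<Rightarrow> bool" where
  "op_le S T \<longleftrightarrow> (\<forall>x. 0 \<le> cinner (blinfun_apply (T - S) x) x)"

definition commutant :: "'h::chilbert_space op set \<Rightarrow> 'h op set" where
  "commutant A = {T \<in> clinear_ops. \<forall>S\<in>A. S o\<^sub>L T = T o\<^sub>L S}"

definition von_neumann_algebra :: "'h::chilbert_space op set \<Rightarrow> bool" where
  "von_neumann_algebra A \<longleftrightarrow> A \<subseteq> clinear_ops \<and> (\<forall>T\<in>A. adjoint_op T \<in> A) \<and>
     commutant (commutant A) = A"

definition tracial_state :: "'h::chilbert_space op set \<Rightarrow> ('h op \<Rightarrow> complex) \<Rightarrow> bool" where
  "tracial_state A \<tau> \<longleftrightarrow>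
     (\<forall>S\<in>A. \<forall>T\<in>A. \<tau> (S + T) = \<tau> S + \<tau> T) \<and>
     (\<forall>c. \<forall>T\<in>A. \<tau> (scaleC_op c T) = c * \<tau> T) \<and>
     (\<forall>T\<in>A. 0 \<le> \<tau> (adjoint_op T o\<^sub>L T)) \<and>
     \<tau> id_blinfun = 1 \<and>
     (\<forall>S\<in>A. \<forall>T\<in>A. \<tau> (S o\<^sub>L T) = \<tau> (T o\<^sub>L S))"

definition faithful_on :: "'h::chilbert_space op set \<Rightarrow> ('h op \<Rightarrow> complex) \<Rightarrow> bool" where
  "faithful_on A \<tau> \<longleftrightarrow> (\<forall>T\<in>A. \<tau> (adjoint_op T o\<^sub>L T) = 0 \<longrightarrow> T = 0)"

text \<open>Normality: suprema of increasing nets of self-adjoint elements are preserved. Increasing nets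
  are represented by upward directed sets.\<close>

definition sa_part :: "'h::chilbert_space op set \<Rightarrow> 'h op set" where
  "sa_part A = {T \<in> A. adjoint_op T = T}"

definition normal_on :: "'h::chilbert_space op set \<Rightarrow> ('h op \<Rightarrow> complex) \<Rightarrow> bool" where
  "normal_on A \<tau> \<longleftrightarrow> (\<forall>D T.
     D \<subseteq> sa_part A \<and> D \<noteq> {} \<and> (\<forall>R\<in>D. \<forall>S\<in>D. \<exists>S'\<in>D. op_le R S' \<and> op_le S S') \<and>
     T \<in> sa_part A \<and> (\<forall>S\<in>D. op_le S T) \<and>
     (\<forall>T'\<in>sa_part A. (\<forall>S\<in>D. op_le S T') \<longrightarrow> op_le T T') \<longrightarrow>
     Re (\<tau> T) = (SUP S\<in>D. Re (\<tau> S)))"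

definition W_star_probability_space ::
    "'h::chilbert_space op set \<Rightarrow> ('h op \<Rightarrow> complex) \<Rightarrow> bool" where
  "W_star_probability_space A \<tau> \<longleftrightarrow>
     von_neumann_algebra A \<and> tracial_state A \<tau> \<and> faithful_on A \<tau> \<and> normal_on A \<tau>"


section \<open>Strong convergence\<close>

text \<open>A noncommutative polynomial is a finitely supported family of coefficients indexed by words;
  in a word, \<^const>\<open>False\<close> stands for the first variable and \<^const>\<open>True\<close> for the second.\<close>

type_synonym ncpoly2 = "bool list \<Rightarrow>\<^sub>0 complex"

definition word_mat :: "nat \<Rightarrow> complex mat \<Rightarrow> complex mat \<Rightarrow> bool list \<Rightarrow> complex mat" where
  "word_mat N P Q w = foldr (\<lambda>b A. (if b then Q else P) * A) w (1\<^sub>m N)"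

definition ncpoly_mat :: "nat \<Rightarrow> ncpoly2 \<Rightarrow> complex mat \<Rightarrow> complex mat \<Rightarrow> complex mat" where
  "ncpoly_mat N F P Q = mat N N (\<lambda>(i, j).
     \<Sum>w\<in>Poly_Mapping.keys F. Poly_Mapping.lookup F w * word_mat N P Q w $$ (i, j))"

definition word_op :: "'h::chilbert_space op \<Rightarrow> 'h op \<Rightarrow> bool list \<Rightarrow> 'h op" where
  "word_op p q w = foldr (\<lambda>b T. (if b then q else p) o\<^sub>L T) w id_blinfun"

definition ncpoly_op :: "ncpoly2 \<Rightarrow> 'h::chilbert_space op \<Rightarrow> 'h op \<Rightarrow> 'h op" where
  "ncpoly_op F p q =
     (\<Sum>w\<in>Poly_Mapping.keys F. scaleC_op (Poly_Mapping.lookup F w) (word_op p q w))"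

definition converge_jointly_strongly ::
    "(nat \<Rightarrow> complex mat) \<Rightarrow> (nat \<Rightarrow> complex mat) \<Rightarrow>
     'h::chilbert_space op set \<Rightarrow> ('h op \<Rightarrow> complex) \<Rightarrow> 'h op \<Rightarrow> 'h op \<Rightarrow> bool" where
  "converge_jointly_strongly P Q A \<tau> p q \<longleftrightarrow>
     W_star_probability_space A \<tau> \<and> p \<in> A \<and> q \<in> A \<and>
     (\<forall>F. (\<lambda>N. mat_trace (ncpoly_mat N F (P N) (Q N)) / of_nat N)
              \<longlonglongrightarrow> \<tau> (ncpoly_op F p q) \<and>
          (\<lambda>N. opnorm (ncpoly_mat N F (P N) (Q N))) \<longlonglongrightarrow> norm (ncpoly_op F p q))"

end

theory Submission
  imports Defs "Jordan_Normal_Form.DL_Rank"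
begin

text \<open>
  For short times the Brownian motion is uniformly close to the identity: for every \<open>\<epsilon> > 0\<close> there is
  a \<open>T > 0\<close> such that for each \<open>t \<le> T\<close>, almost surely \<open>\<parallel>U\<^sup>N\<^sub>t - 1\<parallel> \<le> \<epsilon>\<close> for all large \<open>N\<close>
  (\<open>brownian_motion_near_identity\<close>). The theorem follows, because principal angles depend continuously
  on the subspaces with a modulus of continuity that does not depend on the dimension
  (\<open>principal_angles_near_identity\<close>).

  The probabilistic part is a concentration estimate followed by a union bound over a net. For a fixed
  vector \<open>v\<close>, the function \<open>f A = exp (- \<kappa> N Re \<langle>A v, v\<rangle>)\<close> is inserted into the martingale problem. The
  left-invariant derivatives of \<open>f\<close> are explicit, and Bessel's inequality for an orthonormal basis of
  the Lie algebra bounds half the Laplacian of \<open>f\<close> by \<open>N (\<kappa> r + \<kappa>\<^sup>2 r\<^sup>2) f\<close> with \<open>r = \<parallel>v\<parallel>\<^sup>2\<close>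
  (\<open>laplacian_exp_coeff_le\<close>). Gronwall's lemma bounds the exponential moment
  (\<open>expectation_exp_coeff_le\<close>), and Markov's inequality shows that \<open>U\<^sup>N\<^sub>t\<close> moves \<open>v\<close> by more than a fixed
  amount only with a probability that is exponentially small in \<open>N\<close>, with a rate that becomes
  arbitrarily large as \<open>t\<close> tends to \<open>0\<close>. The unit sphere of complex \<open>N\<close>-space has nets of size
  exponential in \<open>N\<close> (\<open>small_net_exists\<close>), so for small \<open>t\<close> the union bound is summable in \<open>N\<close>.

  For the principal angles, the two subspaces are written as ranges of isometries \<open>J\<close> and \<open>K\<close>. Up to
  the order of the two spaces, the squared cosines of the principal angles are the eigenvalues of the
  small Hermitian matrix \<open>J\<^sup>* K K\<^sup>* J\<close> (\<open>principal_angles_isometries\<close>). Replacing \<open>J\<close> by \<open>U J\<close> changes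
  this matrix by at most \<open>2 \<parallel>U - 1\<parallel>\<close>, and every eigenvalue of a perturbed Hermitian matrix is as close
  to an eigenvalue of the original matrix as the size of the perturbation (\<open>eigenvalue_perturbation\<close>).
\<close>

section \<open>The Hermitian inner product and isometries\<close>

definition cip :: "complex Matrix.vec \<Rightarrow> complex Matrix.vec \<Rightarrow> complex" where
  "cip v w = (\<Sum>i<dim_vec v. vec_index v i * cnj (vec_index w i))"

lemma mat_adjoint_index:
  "i < dim_col A \<Longrightarrow> j < dim_row A \<Longrightarrow> mat_adjoint A $$ (i, j) = cnj (A $$ (j, i))"
  for A :: "complex mat"
  by (simp add: mat_adjoint_def mat_of_rows_def)

lemma mat_adjoint_dims [simp]:
  "dim_row (mat_adjoint A) = dim_col A" "dim_col (mat_adjoint A) = dim_row A"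
  for A :: "complex mat"
  by (simp_all add: mat_adjoint_def)

lemma mat_adjoint_carrier [simp, intro]:
  "A \<in> carrier_mat n m \<Longrightarrow> mat_adjoint A \<in> carrier_mat m n" for A :: "complex mat"
  by (rule carrier_matI) simp_all

lemma mat_adjoint_adjoint [simp]: "mat_adjoint (mat_adjoint A) = A" for A :: "complex mat"
  by (rule eq_matI) (auto simp: mat_adjoint_index)

lemma index_mult_mat_sum:
  "A \<in> carrier_mat n k \<Longrightarrow> B \<in> carrier_mat k m \<Longrightarrow> i < n \<Longrightarrow> j < m \<Longrightarrow>
    (A * B) $$ (i, j) = (\<Sum>l<k. A $$ (i, l) * B $$ (l, j))"
  by (auto simp: scalar_prod_def atLeast0LessThan intro!: sum.cong)

lemma index_mult_vec_sum:
  "A \<in> carrier_mat n k \<Longrightarrow> v \<in> carrier_vec k \<Longrightarrow> i < n \<Longrightarrow>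
    vec_index (A *\<^sub>v v) i = (\<Sum>l<k. A $$ (i, l) * vec_index v l)"
  by (auto simp: scalar_prod_def atLeast0LessThan intro!: sum.cong)

lemma mult_unit_vec_index:
  fixes A :: "complex mat"
  shows "A \<in> carrier_mat n m \<Longrightarrow> i < n \<Longrightarrow> j < m \<Longrightarrow> vec_index (A *\<^sub>v unit_vec m j) i = A $$ (i, j)"
  by (simp add: scalar_prod_right_unit)

lemma mult_mat_vec_closed [simp]: "dim_row A = n \<Longrightarrow> A *\<^sub>v v \<in> carrier_vec n"
  by (rule carrier_vecI) simp

lemma mat_adjoint_mult:
  assumes "A \<in> carrier_mat n k" "B \<in> carrier_mat k m"
  shows "mat_adjoint (A * B) = mat_adjoint B * mat_adjoint (A :: complex mat)"
proof (rule eq_matI)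
  fix i j assume "i < dim_row (mat_adjoint B * mat_adjoint A)" "j < dim_col (mat_adjoint B * mat_adjoint A)"
  then have ij: "i < m" "j < n" using assms by auto
  show "mat_adjoint (A * B) $$ (i, j) = (mat_adjoint B * mat_adjoint A) $$ (i, j)"
    using assms ij
    by (subst mat_adjoint_index; (subst index_mult_mat_sum[OF mat_adjoint_carrier[OF assms(2)] mat_adjoint_carrier[OF assms(1)]]
       index_mult_mat_sum[OF assms])?) (auto simp: index_mult_mat_sum[OF assms] mat_adjoint_index mult.commute simp del: index_mult_mat(1))
qed (use assms in auto)

lemma cip_sum: "v \<in> carrier_vec n \<Longrightarrow> cip v w = (\<Sum>i<n. vec_index v i * cnj (vec_index w i))"
  by (auto simp: cip_def)

lemma cip_commute: "v \<in> carrier_vec n \<Longrightarrow> w \<in> carrier_vec n \<Longrightarrow> cip w v = cnj (cip v w)"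
  by (simp add: cip_sum[of _ n] mult.commute)

lemma cip_add_left: "u \<in> carrier_vec n \<Longrightarrow> v \<in> carrier_vec n \<Longrightarrow> cip (u + v) w = cip u w + cip v w"
  by (simp add: cip_sum[of _ n] algebra_simps sum.distrib)

lemma cip_diff_left: "u \<in> carrier_vec n \<Longrightarrow> v \<in> carrier_vec n \<Longrightarrow> cip (u - v) w = cip u w - cip v w"
  by (simp add: cip_sum[of _ n] algebra_simps sum_subtractf)

lemma cip_smult_left: "v \<in> carrier_vec n \<Longrightarrow> cip (c \<cdot>\<^sub>v v) w = c * cip v w"
  by (simp add: cip_sum[of _ n] algebra_simps sum_distrib_left)

lemma cip_add_right: "v \<in> carrier_vec n \<Longrightarrow> w \<in> carrier_vec n \<Longrightarrow> u \<in> carrier_vec n \<Longrightarrow>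
    cip u (v + w) = cip u v + cip u w"
  by (simp add: cip_sum[of _ n] algebra_simps sum.distrib)

lemma cip_diff_right: "v \<in> carrier_vec n \<Longrightarrow> w \<in> carrier_vec n \<Longrightarrow> u \<in> carrier_vec n \<Longrightarrow>
    cip u (v - w) = cip u v - cip u w"
  by (simp add: cip_sum[of _ n] algebra_simps sum_subtractf)

lemma cip_smult_right: "v \<in> carrier_vec n \<Longrightarrow> w \<in> carrier_vec n \<Longrightarrow> cip v (c \<cdot>\<^sub>v w) = cnj c * cip v w"
  by (simp add: cip_sum[of _ n] algebra_simps sum_distrib_left)

lemma cip_adjoint:
  assumes "A \<in> carrier_mat n m" "v \<in> carrier_vec m" "w \<in> carrier_vec n"
  shows "cip (A *\<^sub>v v) w = cip v (mat_adjoint A *\<^sub>v w)"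
proof -
  have "cip (A *\<^sub>v v) w = (\<Sum>i<n. \<Sum>l<m. A $$ (i, l) * vec_index v l * cnj (vec_index w i))"
    using assms by (simp add: cip_sum[of _ n] index_mult_vec_sum[of A n m] sum_distrib_right del: index_mult_mat_vec)
  also have "\<dots> = (\<Sum>l<m. \<Sum>i<n. A $$ (i, l) * vec_index v l * cnj (vec_index w i))"
    by (rule sum.swap)
  also have "\<dots> = cip v (mat_adjoint A *\<^sub>v w)"
    using assms by (simp add: cip_sum[of _ m] index_mult_vec_sum[of _ m n] sum_distrib_left mat_adjoint_index carrier_matD mult_ac
      del: index_mult_mat_vec)
  finally show ?thesis .
qed

lemma cvec_norm_nonneg [simp]: "0 \<le> cvec_norm v"
  by (simp add: cvec_norm_def L2_set_def sum_nonneg)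

lemma cvec_norm_power2: "v \<in> carrier_vec n \<Longrightarrow> (cvec_norm v)\<^sup>2 = (\<Sum>i<n. (cmod (vec_index v i))\<^sup>2)"
  by (auto simp: cvec_norm_def L2_set_def sum_nonneg)

lemma cip_self: "cip v v = complex_of_real ((cvec_norm v)\<^sup>2)"
  by (simp add: cvec_norm_power2[OF carrier_vecI[OF refl]] cip_def complex_norm_square[symmetric]
    del: of_real_power)

lemma cvec_norm_power2_cip: "(cvec_norm v)\<^sup>2 = Re (cip v v)"
  by (simp add: cip_self)

lemma cvec_norm_eq_0: "v \<in> carrier_vec n \<Longrightarrow> cvec_norm v = 0 \<longleftrightarrow> v = 0\<^sub>v n"
proof -
  assume v: "v \<in> carrier_vec n"
  have "cvec_norm v = 0 \<longleftrightarrow> (\<forall>i<n. vec_index v i = 0)"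
    using v by (auto simp: cvec_norm_def L2_set_def sum_nonneg_eq_0_iff)
  also have "\<dots> \<longleftrightarrow> v = 0\<^sub>v n" using v by auto
  finally show ?thesis .
qed

lemma cvec_norm_zero [simp]: "cvec_norm (0\<^sub>v n) = 0"
  using cvec_norm_eq_0[of "0\<^sub>v n" n] by simp

lemma cvec_norm_pos: "v \<in> carrier_vec n \<Longrightarrow> v \<noteq> 0\<^sub>v n \<Longrightarrow> 0 < cvec_norm v"
  using cvec_norm_eq_0[of v n] cvec_norm_nonneg[of v] by linarith

lemma cvec_norm_unit_vec:
  assumes "i < n"
  shows "cvec_norm (unit_vec n i :: complex Matrix.vec) = 1"
proof -
  have "(cvec_norm (unit_vec n i :: complex Matrix.vec))\<^sup>2 = (\<Sum>j<n. if j = i then 1 else 0)"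
    by (subst cvec_norm_power2[of _ n], simp, intro sum.cong) (auto simp: unit_vec_def assms)
  then have "(cvec_norm (unit_vec n i :: complex Matrix.vec))\<^sup>2 = 1\<^sup>2" using assms by simp
  then show ?thesis by (rule power2_eq_imp_eq) simp_all
qed

lemma cip_bound: "v \<in> carrier_vec n \<Longrightarrow> w \<in> carrier_vec n \<Longrightarrow> cmod (cip v w) \<le> cvec_norm v * cvec_norm w"
proof -
  assume a: "v \<in> carrier_vec n" "w \<in> carrier_vec n"
  have "cmod (cip v w) \<le> (\<Sum>i<n. \<bar>cmod (vec_index v i)\<bar> * \<bar>cmod (vec_index w i)\<bar>)"
    using a by (auto simp: cip_sum[of _ n] norm_mult intro!: order_trans[OF norm_sum])
  also have "\<dots> \<le> cvec_norm v * cvec_norm w"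
    using a L2_set_mult_ineq[of "\<lambda>i. cmod (vec_index v i)" "\<lambda>i. cmod (vec_index w i)" "{..<n}"]
    by (auto simp: cvec_norm_def)
  finally show ?thesis .
qed

lemma cvec_norm_add: "v \<in> carrier_vec n \<Longrightarrow> w \<in> carrier_vec n \<Longrightarrow> cvec_norm (v + w) \<le> cvec_norm v + cvec_norm w"
proof -
  assume a: "v \<in> carrier_vec n" "w \<in> carrier_vec n"
  have "cvec_norm (v + w) \<le> L2_set (\<lambda>i. cmod (vec_index v i) + cmod (vec_index w i)) {..<n}"
    unfolding cvec_norm_def using a by (auto intro!: L2_set_mono norm_triangle_ineq)
  also have "\<dots> \<le> cvec_norm v + cvec_norm w"
    unfolding cvec_norm_def using a L2_set_triangle_ineq[of "\<lambda>i. cmod (vec_index v i)" "\<lambda>i. cmod (vec_index w i)" "{..<n}"] by auto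
  finally show ?thesis .
qed

lemma cvec_norm_smult: "cvec_norm (c \<cdot>\<^sub>v v) = cmod c * cvec_norm v"
  unfolding cvec_norm_def by (auto simp: norm_mult L2_set_right_distrib intro!: L2_set_cong)

lemma cvec_norm_minus_commute: "v \<in> carrier_vec n \<Longrightarrow> w \<in> carrier_vec n \<Longrightarrow> cvec_norm (v - w) = cvec_norm (w - v)"
  unfolding cvec_norm_def by (auto simp: norm_minus_commute intro!: L2_set_cong)

lemma cvec_norm_diff: "v \<in> carrier_vec n \<Longrightarrow> w \<in> carrier_vec n \<Longrightarrow> cvec_norm (v - w) \<le> cvec_norm v + cvec_norm w"
proof -
  assume a: "v \<in> carrier_vec n" "w \<in> carrier_vec n"
  have "v - w = v + (-1) \<cdot>\<^sub>v w" using a by auto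
  then show ?thesis using cvec_norm_add[of v n "(-1) \<cdot>\<^sub>v w"] a by (simp add: cvec_norm_smult)
qed

definition isometry :: "nat \<Rightarrow> nat \<Rightarrow> complex mat \<Rightarrow> bool" where
  "isometry n k J \<longleftrightarrow> J \<in> carrier_mat n k \<and> mat_adjoint J * J = 1\<^sub>m k"

lemma isometry_carrier: "isometry n k J \<Longrightarrow> J \<in> carrier_mat n k" by (simp add: isometry_def)

lemma isometry_adjoint_apply:
  assumes "isometry n k J" "v \<in> carrier_vec k"
  shows "mat_adjoint J *\<^sub>v (J *\<^sub>v v) = v"
proof -
  have J: "J \<in> carrier_mat n k" "mat_adjoint J * J = 1\<^sub>m k" using assms by (auto simp: isometry_def)
  show ?thesis using assoc_mult_mat_vec[of "mat_adjoint J" k n J k v] J assms(2) by simp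
qed

lemma isometry_cip:
  assumes "isometry n k J" "v \<in> carrier_vec k" "w \<in> carrier_vec k"
  shows "cip (J *\<^sub>v v) (J *\<^sub>v w) = cip v w"
  using cip_adjoint[OF isometry_carrier[OF assms(1)], of v "J *\<^sub>v w"] assms isometry_carrier[OF assms(1)]
  by (simp add: isometry_adjoint_apply)

lemma isometry_norm:
  assumes "isometry n k J" "v \<in> carrier_vec k"
  shows "cvec_norm (J *\<^sub>v v) = cvec_norm v"
  using isometry_cip[OF assms assms(2)] by (metis cip_self of_real_eq_iff cvec_norm_nonneg power2_eq_iff_nonneg)

lemma isometry_adjoint_norm:
  assumes "isometry n k J" "v \<in> carrier_vec n"
  shows "cvec_norm (mat_adjoint J *\<^sub>v v) \<le> cvec_norm v"
proof -
  have J: "J \<in> carrier_mat n k" using assms isometry_carrier by auto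
  let ?w = "mat_adjoint J *\<^sub>v v"
  have w: "?w \<in> carrier_vec k" using J by simp
  have "(cvec_norm ?w)\<^sup>2 = Re (cip (J *\<^sub>v ?w) v)"
    using cip_adjoint[OF J w assms(2)] by (simp add: cip_self)
  also have "\<dots> \<le> cvec_norm (J *\<^sub>v ?w) * cvec_norm v"
    using cip_bound[of "J *\<^sub>v ?w" n v] complex_Re_le_cmod[of "cip (J *\<^sub>v ?w) v"] J w assms(2) by auto
  also have "\<dots> = cvec_norm ?w * cvec_norm v" using isometry_norm[OF assms(1) w] by simp
  finally have "cvec_norm ?w * cvec_norm ?w \<le> cvec_norm ?w * cvec_norm v" by (simp add: power2_eq_square)
  then show ?thesis using cvec_norm_nonneg[of ?w] cvec_norm_nonneg[of v]
    by (cases "cvec_norm ?w = 0") auto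
qed

lemma mat_trace_mult_commute:
  assumes "A \<in> carrier_mat n m" "B \<in> carrier_mat m n"
  shows "mat_trace (A * B) = mat_trace (B * A)"
proof -
  have "mat_trace (A * B) = (\<Sum>i<n. \<Sum>l<m. A $$ (i, l) * B $$ (l, i))"
    using assms by (simp add: mat_trace_def index_mult_mat_sum[of A n m] del: index_mult_mat(1))
  also have "\<dots> = (\<Sum>l<m. \<Sum>i<n. A $$ (i, l) * B $$ (l, i))" by (rule sum.swap)
  also have "\<dots> = mat_trace (B * A)"
    using assms by (simp add: mat_trace_def index_mult_mat_sum[of B m n] mult.commute del: index_mult_mat(1))
  finally show ?thesis .
qed

text \<open>The squared Frobenius norm of an isometry is the trace of \<open>J\<^sup>* J\<close>, which is \<open>k\<close>. It is also the
  sum over the \<open>n\<close> rows, each of which has norm at most one because the adjoint is a contraction.\<close>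

lemma isometry_le:
  assumes "isometry n k J" shows "k \<le> n"
proof -
  have J: "J \<in> carrier_mat n k" "mat_adjoint J * J = 1\<^sub>m k" using assms by (auto simp: isometry_def)
  have row: "(\<Sum>l<k. (cmod (J $$ (i, l)))\<^sup>2) \<le> 1" if i: "i < n" for i
  proof -
    let ?w = "mat_adjoint J *\<^sub>v unit_vec n i"
    have w: "vec_index ?w l = cnj (J $$ (i, l))" if "l < k" for l
      using J(1) that i by (simp add: index_mult_vec_sum[of _ k n] mat_adjoint_index carrier_matD unit_vec_def if_distrib cong: if_cong del: index_mult_mat_vec)
    have "(\<Sum>l<k. (cmod (J $$ (i, l)))\<^sup>2) = (cvec_norm ?w)\<^sup>2"
      using J w by (subst cvec_norm_power2[of _ k]) auto
    also have "\<dots> \<le> (cvec_norm (unit_vec n i :: complex Matrix.vec))\<^sup>2"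
      using isometry_adjoint_norm[OF assms] by (simp add: power_mono)
    also have "\<dots> = 1" using i by (simp add: cvec_norm_unit_vec)
    finally show ?thesis .
  qed
  have "complex_of_real (real k) = mat_trace (mat_adjoint J * J)" using J by (simp add: mat_trace_def)
  also have "\<dots> = (\<Sum>l<k. \<Sum>i<n. cnj (J $$ (i, l)) * J $$ (i, l))"
    using J(1) by (simp add: mat_trace_def index_mult_mat_sum[of _ k n] mat_adjoint_index carrier_matD del: index_mult_mat(1))
  also have "\<dots> = complex_of_real (\<Sum>i<n. \<Sum>l<k. (cmod (J $$ (i, l)))\<^sup>2)"
    by (subst sum.swap) (simp add: complex_norm_square mult.commute del: of_real_power)
  finally have "real k = (\<Sum>i<n. \<Sum>l<k. (cmod (J $$ (i, l)))\<^sup>2)" by (simp only: of_real_eq_iff)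
  also have "\<dots> \<le> (\<Sum>i<n. 1)" by (intro sum_mono row) auto
  finally show ?thesis by simp
qed

section \<open>Subspaces as ranges of isometries\<close>

definition mat_range :: "complex mat \<Rightarrow> complex Matrix.vec set" where
  "mat_range J = (\<lambda>v. J *\<^sub>v v) ` carrier_vec (dim_col J)"

definition lin_closed :: "nat \<Rightarrow> complex Matrix.vec set \<Rightarrow> bool" where
  "lin_closed n V \<longleftrightarrow> V \<subseteq> carrier_vec n \<and> 0\<^sub>v n \<in> V \<and> (\<forall>u\<in>V. \<forall>v\<in>V. u + v \<in> V) \<and> (\<forall>c. \<forall>v\<in>V. c \<cdot>\<^sub>v v \<in> V)"

lemma csubspace_imp_lin_closed: "csubspace n V \<Longrightarrow> lin_closed n V"
  unfolding csubspace_def VectorSpace.subspace_def submodule_def lin_closed_def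
  by (auto simp: module_vec_simps)

text \<open>The step by which an orthonormal system is enlarged; the second part determines the new range.\<close>

lemma isometry_append_column:
  assumes J: "isometry n k J" and u: "u \<in> carrier_vec n" "cvec_norm u = 1"
    and orth: "mat_adjoint J *\<^sub>v u = 0\<^sub>v k"
  defines "J' \<equiv> mat n (Suc k) (\<lambda>(i, l). if l < k then J $$ (i, l) else vec_index u i)"
  shows "isometry n (Suc k) J'"
    and "y \<in> carrier_vec (Suc k) \<Longrightarrow>
      J' *\<^sub>v y = J *\<^sub>v vec k (\<lambda>l. vec_index y l) + vec_index y k \<cdot>\<^sub>v u"
proof -
  have Jc: "J \<in> carrier_mat n k" and J1: "mat_adjoint J * J = 1\<^sub>m k" using J by (auto simp: isometry_def)
  have J'c: "J' \<in> carrier_mat n (Suc k)" by (simp add: J'_def)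
  have e1: "(\<Sum>i<n. cnj (J $$ (i, l)) * J $$ (i, l')) = (if l = l' then 1 else 0)" if "l < k" "l' < k" for l l'
  proof -
    have "(mat_adjoint J * J) $$ (l, l') = (\<Sum>i<n. cnj (J $$ (i, l)) * J $$ (i, l'))"
      using that Jc by (subst index_mult_mat_sum[of _ k n _ k]) (auto simp: mat_adjoint_index)
    then show ?thesis using that J1 by simp
  qed
  have e2: "(\<Sum>i<n. cnj (J $$ (i, l)) * vec_index u i) = 0" if "l < k" for l
  proof -
    have "vec_index (mat_adjoint J *\<^sub>v u) l = (\<Sum>i<n. cnj (J $$ (i, l)) * vec_index u i)"
      using that Jc u by (subst index_mult_vec_sum[of _ k n]) (auto simp: mat_adjoint_index)
    then show ?thesis using that orth by simp
  qed
  have e3: "(\<Sum>i<n. cnj (vec_index u i) * J $$ (i, l)) = 0" if "l < k" for l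
    using arg_cong[OF e2[OF that], of cnj] by (simp add: mult.commute)
  have e4: "(\<Sum>i<n. cnj (vec_index u i) * vec_index u i) = 1"
    using u cip_self[of u] by (simp add: cip_sum[of _ n] mult.commute)
  have "mat_adjoint J' * J' = 1\<^sub>m (Suc k)"
  proof (rule eq_matI)
    fix l l' assume "l < dim_row (1\<^sub>m (Suc k) :: complex mat)" "l' < dim_col (1\<^sub>m (Suc k) :: complex mat)"
    then have l: "l < Suc k" "l' < Suc k" by auto
    have "(mat_adjoint J' * J') $$ (l, l') = (\<Sum>i<n. cnj (J' $$ (i, l)) * J' $$ (i, l'))"
      using l J'c by (subst index_mult_mat_sum[of _ "Suc k" n _ "Suc k"]) (auto simp: mat_adjoint_index)
    also have "\<dots> = 1\<^sub>m (Suc k) $$ (l, l')"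
      using l by (auto simp: J'_def e1 e2 e3 e4 less_Suc_eq)
    finally show "(mat_adjoint J' * J') $$ (l, l') = 1\<^sub>m (Suc k) $$ (l, l')" .
  qed (use J'c in auto)
  then show "isometry n (Suc k) J'" using J'c by (simp add: isometry_def)
  assume y: "y \<in> carrier_vec (Suc k)"
  show "J' *\<^sub>v y = J *\<^sub>v vec k (\<lambda>l. vec_index y l) + vec_index y k \<cdot>\<^sub>v u"
  proof (rule eq_vecI)
    fix i assume "i < dim_vec (J *\<^sub>v vec k (\<lambda>l. vec_index y l) + vec_index y k \<cdot>\<^sub>v u)"
    then have i: "i < n" using Jc u by auto
    show "vec_index (J' *\<^sub>v y) i = vec_index (J *\<^sub>v vec k (\<lambda>l. vec_index y l) + vec_index y k \<cdot>\<^sub>v u) i"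
      using i y u Jc J'c
      by (simp add: index_mult_vec_sum[of J' n "Suc k"] index_mult_vec_sum[of J n k] del: index_mult_mat_vec)
         (simp add: J'_def)
  qed (use Jc u J'c in auto)
qed

text \<open>Existence of an orthonormal basis: take an isometry into \<open>V\<close> with as many columns as possible.
  If \<open>v \<in> V\<close> were outside its range, the normalized component of \<open>v\<close> orthogonal to the range could
  be added as one more column.\<close>

lemma lin_closed_isometry:
  assumes V: "lin_closed n V"
  obtains k J where "isometry n k J" "mat_range J = V"
proof -
  define K where "K = {k. \<exists>J. isometry n k J \<and> mat_range J \<subseteq> V}"
  have fin: "finite K" by (rule finite_subset[of _ "{..n}"]) (auto simp: K_def dest: isometry_le)
  have "isometry n 0 (0\<^sub>m n 0)" by (auto simp: isometry_def intro!: eq_matI)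
  moreover have "mat_range (0\<^sub>m n 0) \<subseteq> V"
  proof -
    have "0\<^sub>m n 0 *\<^sub>v v = (0\<^sub>v n :: complex Matrix.vec)" if "v \<in> carrier_vec 0" for v
      using that by (intro eq_vecI) (auto simp: scalar_prod_def)
    then show ?thesis using V by (auto simp: mat_range_def lin_closed_def)
  qed
  ultimately have "K \<noteq> {}" unfolding K_def by blast
  then have "Max K \<in> K" using fin by simp
  then obtain J where J: "isometry n (Max K) J" "mat_range J \<subseteq> V" by (auto simp: K_def)
  let ?k = "Max K"
  have Jc: "J \<in> carrier_mat n ?k" using J by (auto simp: isometry_def)
  have "V \<subseteq> mat_range J"
  proof
    fix v assume v: "v \<in> V"
    then have vc: "v \<in> carrier_vec n" using V by (auto simp: lin_closed_def)
    define p where "p = J *\<^sub>v (mat_adjoint J *\<^sub>v v)"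
    have pV: "p \<in> V" "p \<in> mat_range J" using J(2) Jc by (auto simp: p_def mat_range_def)
    have pc: "p \<in> carrier_vec n" using Jc by (simp add: p_def)
    define w where "w = v + (-1) \<cdot>\<^sub>v p"
    have wV: "w \<in> V" using V v pV by (auto simp: w_def lin_closed_def)
    have wc: "w \<in> carrier_vec n" using vc pc by (simp add: w_def)
    have aJ: "mat_adjoint J \<in> carrier_mat ?k n" using Jc by simp
    have Jw: "mat_adjoint J *\<^sub>v w = 0\<^sub>v ?k"
    proof -
      have "mat_adjoint J *\<^sub>v w = mat_adjoint J *\<^sub>v v + (-1) \<cdot>\<^sub>v (mat_adjoint J *\<^sub>v p)"
        unfolding w_def using mult_add_distrib_mat_vec[OF aJ vc, of "(-1) \<cdot>\<^sub>v p"] mult_mat_vec[OF aJ pc, of "-1"] pc by simp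
      also have "mat_adjoint J *\<^sub>v p = mat_adjoint J *\<^sub>v v"
        unfolding p_def by (rule isometry_adjoint_apply[OF J(1)]) (use Jc in simp)
      finally show ?thesis using Jc by (intro eq_vecI) auto
    qed
    show "v \<in> mat_range J"
    proof (rule ccontr)
      assume nv: "v \<notin> mat_range J"
      have "w \<noteq> 0\<^sub>v n"
      proof
        assume "w = 0\<^sub>v n"
        then have "vec_index v i = vec_index p i" if "i < n" for i
        proof -
          have "vec_index w i = 0" using \<open>w = 0\<^sub>v n\<close> that by simp
          then show ?thesis using that vc pc by (simp add: w_def)
        qed
        then have "v = p" using vc pc by (intro eq_vecI) auto
        then show False using pV nv by simp
      qed
      then have pos: "0 < cvec_norm w" using cvec_norm_pos[OF wc] by simp
      define u where "u = complex_of_real (1 / cvec_norm w) \<cdot>\<^sub>v w"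
      have u: "u \<in> carrier_vec n" "cvec_norm u = 1" "u \<in> V"
        using wc pos wV V by (auto simp: u_def cvec_norm_smult norm_divide lin_closed_def)
      have Ju: "mat_adjoint J *\<^sub>v u = 0\<^sub>v ?k"
        unfolding u_def using mult_mat_vec[OF aJ wc] Jw by (auto intro!: eq_vecI)
      note app = isometry_append_column[OF J(1) u(1,2) Ju]
      have "mat_range (mat n (Suc ?k) (\<lambda>(i, l). if l < ?k then J $$ (i, l) else vec_index u i)) \<subseteq> V"
      proof -
        have "J *\<^sub>v vec ?k (\<lambda>l. vec_index y l) + vec_index y ?k \<cdot>\<^sub>v u \<in> V" for y
        proof -
          have "J *\<^sub>v vec ?k (\<lambda>l. vec_index y l) \<in> V" using J(2) Jc by (auto simp: mat_range_def)
          then show ?thesis using V u(3) by (auto simp: lin_closed_def)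
        qed
        then show ?thesis by (auto simp: mat_range_def app(2))
      qed
      then have "Suc ?k \<in> K" using app(1) unfolding K_def by blast
      then show False using Max_ge[OF fin] by fastforce
    qed
  qed
  then show ?thesis using that J by blast
qed

text \<open>The columns of an isometry are linearly independent, so its rank is the number of columns.\<close>

lemma csubspace_dim_isometry:
  assumes J: "isometry n k J"
  shows "csubspace_dim n (mat_range J) = k"
proof -
  interpret vec_space "TYPE(complex)" n .
  have Jc: "J \<in> carrier_mat n k" using J by (auto simp: isometry_def)
  have inj: "v = 0\<^sub>v k" if "v \<in> carrier_vec k" "J *\<^sub>v v = 0\<^sub>v n" for v
    using isometry_norm[OF J that(1)] that cvec_norm_eq_0 by auto
  have dist: "distinct (cols J)"
  proof (rule ccontr)
    assume "\<not> distinct (cols J)"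
    then obtain a b where ab: "a < k" "b < k" "a \<noteq> b" "col J a = col J b"
      using Jc by (auto simp: distinct_conv_nth)
    have e: "J $$ (i, a) = J $$ (i, b)" if "i < n" for i
    proof -
      have "vec_index (col J a) i = vec_index (col J b) i" using ab(4) by simp
      then show ?thesis using ab(1,2) that Jc by simp
    qed
    have "J *\<^sub>v unit_vec k a = J *\<^sub>v unit_vec k b"
      using ab Jc e by (intro eq_vecI) (auto simp: scalar_prod_right_unit)
    then have "unit_vec k a = (unit_vec k b :: complex Matrix.vec)"
      by (metis isometry_adjoint_apply[OF J] unit_vec_carrier)
    from arg_cong[OF this, of "\<lambda>c. vec_index c a"] show False using ab by (simp add: unit_vec_def)
  qed
  have indpt: "lin_indpt (set (cols J))"
    using lin_depE[OF Jc _ dist] inj by metis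
  have "mat_range J = span (set (cols J))"
    using col_space_eq[OF Jc] Jc unfolding col_space_def mat_range_def by auto
  then have "csubspace_dim n (mat_range J) = rank J"
    unfolding csubspace_dim_def rank_def by simp
  also have "\<dots> = k" by (rule lin_indpt_full_rank[OF Jc dist indpt])
  finally show ?thesis .
qed

lemma isometry_projection_facts:
  assumes "isometry n k J"
  shows "J * mat_adjoint J \<in> carrier_mat n n"
    and "mat_adjoint (J * mat_adjoint J) = J * mat_adjoint J"
    and "J * mat_adjoint J * (J * mat_adjoint J) = J * mat_adjoint J"
    and "x \<in> carrier_vec n \<Longrightarrow> cvec_norm (J * mat_adjoint J *\<^sub>v x) \<le> cvec_norm x"
proof -
  have Jc: "J \<in> carrier_mat n k" and J1: "mat_adjoint J * J = 1\<^sub>m k" using assms by (auto simp: isometry_def)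
  have aJ: "mat_adjoint J \<in> carrier_mat k n" using Jc by simp
  show JJ: "J * mat_adjoint J \<in> carrier_mat n n" using Jc by simp
  show "mat_adjoint (J * mat_adjoint J) = J * mat_adjoint J" using mat_adjoint_mult[OF Jc aJ] by simp
  have "mat_adjoint J * (J * mat_adjoint J) = mat_adjoint J"
    using assoc_mult_mat[OF aJ Jc aJ] left_mult_one_mat[OF aJ] by (simp add: J1)
  then show "J * mat_adjoint J * (J * mat_adjoint J) = J * mat_adjoint J" using assoc_mult_mat[OF Jc aJ JJ] by simp
  assume x: "x \<in> carrier_vec n"
  show "cvec_norm (J * mat_adjoint J *\<^sub>v x) \<le> cvec_norm x"
    using assoc_mult_mat_vec[OF Jc aJ x] isometry_norm[OF assms, of "mat_adjoint J *\<^sub>v x"] Jc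
      isometry_adjoint_norm[OF assms x] by simp
qed

lemma orth_proj_isometry:
  assumes J: "isometry n k J"
  shows "orth_proj n (mat_range J) = J * mat_adjoint J"
  unfolding orth_proj_def
proof (rule the_equality)
  have Jc: "J \<in> carrier_mat n k" and J1: "mat_adjoint J * J = 1\<^sub>m k" using J by (auto simp: isometry_def)
  have aJ: "mat_adjoint J \<in> carrier_mat k n" using Jc by simp
  note JJ = isometry_projection_facts(1)[OF J] and adj = isometry_projection_facts(2)[OF J]
    and idem = isometry_projection_facts(3)[OF J]
  have rng: "(\<lambda>v. J * mat_adjoint J *\<^sub>v v) ` carrier_vec n = mat_range J"
  proof (rule equalityI; rule subsetI)
    fix x assume "x \<in> (\<lambda>v. J * mat_adjoint J *\<^sub>v v) ` carrier_vec n"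
    then show "x \<in> mat_range J" using Jc aJ by (auto simp: mat_range_def assoc_mult_mat_vec[of _ n k _ n])
  next
    fix x assume "x \<in> mat_range J"
    then obtain y where y: "y \<in> carrier_vec k" "x = J *\<^sub>v y" using Jc by (auto simp: mat_range_def)
    then have "x = J * mat_adjoint J *\<^sub>v x"
      using Jc aJ isometry_adjoint_apply[OF J] by (simp add: assoc_mult_mat_vec[of _ n k _ n])
    moreover have "x \<in> carrier_vec n" using y Jc by simp
    ultimately show "x \<in> (\<lambda>v. J * mat_adjoint J *\<^sub>v v) ` carrier_vec n" by blast
  qed
  show "J * mat_adjoint J \<in> carrier_mat n n \<and> J * mat_adjoint J * (J * mat_adjoint J) = J * mat_adjoint J \<and>
    mat_adjoint (J * mat_adjoint J) = J * mat_adjoint J \<and>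
    (\<lambda>v. J * mat_adjoint J *\<^sub>v v) ` carrier_vec n = mat_range J"
    using idem rng adj Jc by simp
  fix P assume P: "P \<in> carrier_mat n n \<and> P * P = P \<and> mat_adjoint P = P \<and> (\<lambda>v. P *\<^sub>v v) ` carrier_vec n = mat_range J"
  \<comment> \<open>Two self-adjoint idempotents with the same range absorb each other, so taking adjoints identifies them.\<close>
  have absorb: "S * T = T" if S: "S \<in> carrier_mat n n" "S * S = S" and T: "T \<in> carrier_mat n n"
    and r: "(\<lambda>v. S *\<^sub>v v) ` carrier_vec n = (\<lambda>v. T *\<^sub>v v) ` carrier_vec n" for S T :: "complex mat"
  proof (rule eq_matI)
    fix i j assume "i < dim_row T" "j < dim_col T"
    then have ij: "i < n" "j < n" using T by auto
    let ?x = "T *\<^sub>v unit_vec n j"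
    have "?x \<in> (\<lambda>v. S *\<^sub>v v) ` carrier_vec n" unfolding r by auto
    then obtain y where y: "y \<in> carrier_vec n" "?x = S *\<^sub>v y" by auto
    have "(S * T) *\<^sub>v unit_vec n j = S *\<^sub>v ?x" using S T by (simp add: assoc_mult_mat_vec[of _ n n _ n])
    also have "\<dots> = (S * S) *\<^sub>v y" unfolding y(2) using assoc_mult_mat_vec[OF S(1) S(1) y(1)] by simp
    also have "\<dots> = ?x" using S y by simp
    finally have "vec_index ((S * T) *\<^sub>v unit_vec n j) i = vec_index (T *\<^sub>v unit_vec n j) i" by simp
    then show "(S * T) $$ (i, j) = T $$ (i, j)"
      using mult_unit_vec_index[of "S * T" n n i j] mult_unit_vec_index[of T n n i j] S T ij by (simp del: index_mult_mat_vec index_mult_mat)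
  qed (use S T in auto)
  have Pc: "P \<in> carrier_mat n n" and PP: "P * P = P" and Pa: "mat_adjoint P = P" using P by auto
  have r: "(\<lambda>v. J * mat_adjoint J *\<^sub>v v) ` carrier_vec n = (\<lambda>v. P *\<^sub>v v) ` carrier_vec n"
    using P by (simp only: rng)
  have "J * mat_adjoint J * P = P" by (rule absorb[OF JJ idem Pc r])
  then have "P * (J * mat_adjoint J) = P" using mat_adjoint_mult[OF JJ Pc] Pa adj by simp
  moreover have "P * (J * mat_adjoint J) = J * mat_adjoint J" by (rule absorb[OF Pc PP JJ r[symmetric]])
  ultimately show "P = J * mat_adjoint J" by simp
qed

section \<open>Spectra of products and of Hermitian matrices\<close>

lemma char_poly_four_block_upper_right_zero:
  fixes B D :: "complex mat"
  assumes "A \<in> carrier_mat n n" "C \<in> carrier_mat m n" "D \<in> carrier_mat m m"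
  shows "char_poly (four_block_mat A (0\<^sub>m n m) C D) = char_poly A * char_poly D"
proof -
  have "char_poly_matrix (four_block_mat A (0\<^sub>m n m) C D) =
      four_block_mat (char_poly_matrix A) (0\<^sub>m n m) (map_mat (\<lambda>a. [:- a:]) C) (char_poly_matrix D)"
    using assms by (intro eq_matI) (auto simp: char_poly_matrix_def)
  then show ?thesis unfolding char_poly_def
    using assms by (simp add: det_four_block_mat_upper_right_zero[of _ n _ m])
qed

lemma char_poly_zero: "char_poly (0\<^sub>m n n :: complex mat) = [:0, 1:] ^ n"
proof -
  have "char_poly_matrix (0\<^sub>m n n :: complex mat) = [:0, 1:] \<cdot>\<^sub>m 1\<^sub>m n"
    by (intro eq_matI) (auto simp: char_poly_matrix_def)
  then show ?thesis by (simp add: char_poly_def)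
qed

text \<open>The block triangular matrices with block rows \<open>(X Y, 0)\<close>, \<open>(Y, 0)\<close> and \<open>(0, 0)\<close>, \<open>(Y, Y X)\<close>
  are similar through the unipotent matrix with off-diagonal block \<open>X\<close>.\<close>

lemma char_poly_mult_commute:
  fixes X Y :: "complex mat"
  assumes X: "X \<in> carrier_mat n m" and Y: "Y \<in> carrier_mat m n"
  shows "[:0, 1:] ^ m * char_poly (X * Y) = [:0, 1:] ^ n * char_poly (Y * X)"
proof -
  let ?P = "four_block_mat (1\<^sub>m n) X (0\<^sub>m m n) (1\<^sub>m m)"
  let ?Q = "four_block_mat (1\<^sub>m n) (- X) (0\<^sub>m m n) (1\<^sub>m m)"
  let ?L = "four_block_mat (X * Y) (0\<^sub>m n m) Y (0\<^sub>m m m)"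
  let ?R = "four_block_mat (0\<^sub>m n n) (0\<^sub>m n m) Y (Y * X)"
  have zero: "- 0\<^sub>m m m + 1\<^sub>m m = (1\<^sub>m m :: complex mat)" by (intro eq_matI) auto
  have PQ: "?P * ?Q = 1\<^sub>m (n + m)" "?Q * ?P = 1\<^sub>m (n + m)"
    using X by (simp_all add: mult_four_block_mat[of _ n n _ m _ m _ _ n _ m] add_uminus_minus_mat[of _ n m] zero four_block_one_mat)
  have LP: "?L * ?P = ?P * ?R"
    using X Y by (simp add: mult_four_block_mat[of _ n n _ m _ m _ _ n _ m] assoc_mult_mat[of X n m Y n X m])
  have carr: "?P \<in> carrier_mat (n + m) (n + m)" "?Q \<in> carrier_mat (n + m) (n + m)"
     "?L \<in> carrier_mat (n + m) (n + m)" "?R \<in> carrier_mat (n + m) (n + m)" using X Y by auto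
  have "?L = ?L * (?P * ?Q)" unfolding PQ(1) using right_mult_one_mat[OF carr(3)] by simp
  also have "\<dots> = (?L * ?P) * ?Q" using assoc_mult_mat[OF carr(3) carr(1) carr(2)] by simp
  also have "\<dots> = ?P * ?R * ?Q" by (simp add: LP)
  finally have "similar_mat_wit ?L ?R ?P ?Q"
    by (intro similar_mat_witI[OF PQ _ carr(3,4,1,2)])
  then have "char_poly ?L = char_poly ?R" by (intro char_poly_similar) (auto simp: similar_mat_def)
  then show ?thesis
    using X Y by (simp add: char_poly_four_block_upper_right_zero char_poly_zero mult.commute)
qed

lemma eigenvalue_iff:
  assumes "A \<in> carrier_mat n n"
  shows "eigenvalue A z \<longleftrightarrow> (\<exists>x\<in>carrier_vec n. x \<noteq> 0\<^sub>v n \<and> A *\<^sub>v x = z \<cdot>\<^sub>v x)"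
  using assms unfolding eigenvalue_def eigenvector_def by auto

lemma proots_char_poly:
  assumes "A \<in> carrier_mat n n"
  shows "set_mset (proots (char_poly A)) = {z :: complex. eigenvalue A z}"
    and "size (proots (char_poly A)) = n"
    and "char_poly A \<noteq> 0"
proof -
  show nz: "char_poly A \<noteq> 0" using degree_monic_char_poly[OF assms] by auto
  show "set_mset (proots (char_poly A)) = {z. eigenvalue A z}"
    using nz by (auto simp: eigenvalue_root_char_poly[OF assms])
  show "size (proots (char_poly A)) = n"
    using degree_monic_char_poly[OF assms] by (simp add: size_proots_complex)
qed

lemma hermitian_cip_real:
  fixes A :: "complex mat"
  assumes "A \<in> carrier_mat n n" "mat_adjoint A = A" "x \<in> carrier_vec n"
  shows "cip (A *\<^sub>v x) x \<in> \<real>"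
proof -
  have "cip (A *\<^sub>v x) x = cnj (cip (A *\<^sub>v x) x)"
    using cip_adjoint[OF assms(1,3,3)] assms cip_commute[of "A *\<^sub>v x" n x] by simp
  then show ?thesis by (metis Reals_cnj_iff)
qed

lemma hermitian_eigenvalue_real:
  fixes A :: "complex mat"
  assumes A: "A \<in> carrier_mat n n" "mat_adjoint A = A" and z: "eigenvalue A z"
  shows "z \<in> \<real>"
proof -
  obtain x where x: "x \<in> carrier_vec n" "x \<noteq> 0\<^sub>v n" "A *\<^sub>v x = z \<cdot>\<^sub>v x"
    using z eigenvalue_iff[OF A(1)] by auto
  have "z * complex_of_real ((cvec_norm x)\<^sup>2) \<in> \<real>"
    using hermitian_cip_real[OF A x(1)] x by (simp add: cip_smult_left[of _ n] cip_self)
  moreover have "(cvec_norm x)\<^sup>2 \<noteq> 0" using x cvec_norm_eq_0 by auto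
  ultimately have "z * complex_of_real ((cvec_norm x)\<^sup>2) / complex_of_real ((cvec_norm x)\<^sup>2) \<in> \<real>"
    by (intro Reals_divide) auto
  then show ?thesis using \<open>(cvec_norm x)\<^sup>2 \<noteq> 0\<close> by simp
qed

lemma cvec_norm_pythagoras:
  assumes "u \<in> carrier_vec n" "v \<in> carrier_vec n" "cip u v = 0"
  shows "(cvec_norm (u + v))\<^sup>2 = (cvec_norm u)\<^sup>2 + (cvec_norm v)\<^sup>2"
  using assms cip_commute[OF assms(1,2)]
  by (simp add: cvec_norm_power2_cip cip_add_left[of _ n] cip_add_right[of _ n])

text \<open>The spectral theorem in the form needed below, by induction on the dimension: split
  off a unit eigenvector \<open>e\<close>. The orthogonal complement \<open>V\<close> of \<open>e\<close> is invariant under \<open>A\<close>, and the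
  compression \<open>B\<close> of \<open>A\<close> to \<open>V\<close> is Hermitian of smaller size with eigenvalues among those of \<open>A\<close>.
  The two parts are orthogonal, so that the bounds add up by Pythagoras.\<close>

lemma hermitian_resolvent_bound:
  assumes "A \<in> carrier_mat n n" "mat_adjoint A = A"
    and "\<And>z. eigenvalue A z \<Longrightarrow> d \<le> cmod (z - \<mu>)" and "0 \<le> d" and "x \<in> carrier_vec n"
  shows "d * cvec_norm (x :: complex Matrix.vec) \<le> cvec_norm (A *\<^sub>v x - \<mu> \<cdot>\<^sub>v x)"
  using assms
proof (induction n arbitrary: A x rule: less_induct)
  case (less n A x)
  note A = less.prems(1) and her = less.prems(2) and ev = less.prems(3)
  show ?case
  proof (cases "n = 0")
    case True
    then have "x = 0\<^sub>v n" using less.prems by auto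
    then show ?thesis by simp
  next
    case False
    have "size (proots (char_poly A)) \<noteq> 0" using proots_char_poly(2)[OF A] False by simp
    then have "proots (char_poly A) \<noteq> {#}" by auto
    then obtain z where "z \<in># proots (char_poly A)" by (meson multiset_nonemptyE)
    then have "eigenvalue A z" using proots_char_poly(1)[OF A] by blast
    then obtain e0 where e0: "e0 \<in> carrier_vec n" "e0 \<noteq> 0\<^sub>v n" "A *\<^sub>v e0 = z \<cdot>\<^sub>v e0"
      using eigenvalue_iff[OF A] by auto
    note evz = \<open>eigenvalue A z\<close>
    then have zr: "cnj z = z" using hermitian_eigenvalue_real[OF A her] by (simp add: Reals_cnj_iff)
    define e where "e = complex_of_real (1 / cvec_norm e0) \<cdot>\<^sub>v e0"
    have pos: "0 < cvec_norm e0" using cvec_norm_pos e0 by simp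
    have e: "e \<in> carrier_vec n" "cvec_norm e = 1" "A *\<^sub>v e = z \<cdot>\<^sub>v e"
      using e0 pos mult_mat_vec[OF A e0(1)] by (auto simp: e_def cvec_norm_smult norm_divide smult_smult_assoc mult.commute)
    have ee: "cip e e = 1" using e by (simp add: cip_self)
    define V where "V = {v \<in> carrier_vec n. cip v e = 0}"
    have "lin_closed n V"
      using e by (auto simp: lin_closed_def V_def cip_add_left[of _ n] cip_smult_left[of _ n] cip_sum[of "0\<^sub>v n" n])
    then obtain k K where K: "isometry n k K" "mat_range K = V" using lin_closed_isometry by blast
    have Kc: "K \<in> carrier_mat n k" using K isometry_carrier by auto
    have aK: "mat_adjoint K \<in> carrier_mat k n" using Kc by simp
    have KV: "K *\<^sub>v y \<in> V" if "y \<in> carrier_vec k" for y using K(2) Kc that by (auto simp: mat_range_def)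
    have KK: "K *\<^sub>v (mat_adjoint K *\<^sub>v v) = v" if "v \<in> V" for v
    proof -
      have "v \<in> mat_range K" using that K(2) by simp
      then obtain y where "y \<in> carrier_vec k" "v = K *\<^sub>v y" using Kc unfolding mat_range_def by auto
      then show ?thesis using isometry_adjoint_apply[OF K(1)] by simp
    qed
    have kn: "k < n"
    proof (rule ccontr)
      assume "\<not> k < n"
      then have "k = n" using isometry_le[OF K(1)] by simp
      then have "K * mat_adjoint K = 1\<^sub>m n"
        using K(1) mat_mult_left_right_inverse[of "mat_adjoint K" n K] aK Kc by (auto simp: isometry_def)
      then have "K *\<^sub>v (mat_adjoint K *\<^sub>v e) = e"
        using assoc_mult_mat_vec[OF Kc aK e(1)] e(1) by simp
      then have "e \<in> V" using KV[of "mat_adjoint K *\<^sub>v e"] Kc by simp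
      then show False using ee by (simp add: V_def)
    qed
    have AV: "A *\<^sub>v v \<in> V" if "v \<in> V" for v
    proof -
      have v: "v \<in> carrier_vec n" "cip v e = 0" using that by (auto simp: V_def)
      have "cip (A *\<^sub>v v) e = cip v (z \<cdot>\<^sub>v e)" using cip_adjoint[OF A v(1) e(1)] her e by simp
      also have "\<dots> = 0" using v e by (simp add: cip_smult_right[of _ n])
      finally show ?thesis using A by (simp add: V_def)
    qed
    define B where "B = mat_adjoint K * (A * K)"
    have Bc: "B \<in> carrier_mat k k" unfolding B_def by (rule mult_carrier_mat[OF aK mult_carrier_mat[OF A Kc]])
    have Bv: "B *\<^sub>v y = mat_adjoint K *\<^sub>v (A *\<^sub>v (K *\<^sub>v y))" if "y \<in> carrier_vec k" for y
      using that A Kc aK by (simp add: B_def assoc_mult_mat_vec[of _ k n _ k] assoc_mult_mat_vec[of _ n n _ k])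
    have KB: "K *\<^sub>v (B *\<^sub>v y) = A *\<^sub>v (K *\<^sub>v y)" if "y \<in> carrier_vec k" for y
      using Bv[OF that] KK[OF AV[OF KV[OF that]]] by simp
    have hB: "mat_adjoint B = B"
      using mat_adjoint_mult[OF aK mult_carrier_mat[OF A Kc]] mat_adjoint_mult[OF A Kc] her
        assoc_mult_mat[OF aK A Kc] by (simp add: B_def)
    have evB: "eigenvalue A w" if w: "eigenvalue B w" for w
    proof -
      obtain y where y: "y \<in> carrier_vec k" "y \<noteq> 0\<^sub>v k" "B *\<^sub>v y = w \<cdot>\<^sub>v y"
        using w eigenvalue_iff[OF Bc] by auto
      have "A *\<^sub>v (K *\<^sub>v y) = w \<cdot>\<^sub>v (K *\<^sub>v y)" using KB[OF y(1)] y(3) mult_mat_vec[OF Kc y(1)] by simp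
      moreover have "K *\<^sub>v y \<noteq> 0\<^sub>v n"
        using isometry_norm[OF K(1) y(1)] cvec_norm_eq_0[OF y(1)] y(2) by force
      ultimately show ?thesis using eigenvalue_iff[OF A] Kc by (metis mult_mat_vec_closed carrier_matD(1))
    qed
    have xc: "x \<in> carrier_vec n" by fact
    define a where "a = cip x e"
    define v where "v = x - a \<cdot>\<^sub>v e"
    have vV: "v \<in> V" using xc e ee by (simp add: v_def V_def a_def cip_diff_left[of _ n] cip_smult_left[of _ n])
    define y where "y = mat_adjoint K *\<^sub>v v"
    have yc: "y \<in> carrier_vec k" using Kc by (simp add: y_def)
    have Ky: "K *\<^sub>v y = v" using KK[OF vV] by (simp add: y_def)
    have vc: "v \<in> carrier_vec n" using vV by (simp add: V_def)
    have x: "x = a \<cdot>\<^sub>v e + v" using xc e(1) by (auto simp: v_def intro!: eq_vecI)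
    have norm_x: "(cvec_norm x)\<^sup>2 = (cmod a)\<^sup>2 + (cvec_norm y)\<^sup>2"
    proof -
      have "cip v (a \<cdot>\<^sub>v e) = 0" using vV e by (simp add: V_def cip_smult_right[of _ n])
      then have "cip (a \<cdot>\<^sub>v e) v = 0" using cip_commute[OF vc, of "a \<cdot>\<^sub>v e"] e by simp
      then have "(cvec_norm (a \<cdot>\<^sub>v e + v))\<^sup>2 = (cvec_norm (a \<cdot>\<^sub>v e))\<^sup>2 + (cvec_norm v)\<^sup>2"
        using cvec_norm_pythagoras[of "a \<cdot>\<^sub>v e" n v] vc e by simp
      also have "\<dots> = (cmod a)\<^sup>2 + (cvec_norm y)\<^sup>2"
        using isometry_norm[OF K(1) yc] Ky e by (simp add: cvec_norm_smult)
      finally show ?thesis using x by simp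
    qed
    define r where "r = B *\<^sub>v y - \<mu> \<cdot>\<^sub>v y"
    have rc: "r \<in> carrier_vec k" using yc Bc by (simp add: r_def)
    have Kr: "K *\<^sub>v r = A *\<^sub>v v - \<mu> \<cdot>\<^sub>v v"
    proof -
      have "K *\<^sub>v r = K *\<^sub>v (B *\<^sub>v y) - K *\<^sub>v (\<mu> \<cdot>\<^sub>v y)"
        unfolding r_def by (rule mult_minus_distrib_mat_vec[OF Kc]) (use yc Bc in simp_all)
      then show ?thesis using KB[OF yc] Ky mult_mat_vec[OF Kc yc] by simp
    qed
    have Ax: "A *\<^sub>v x - \<mu> \<cdot>\<^sub>v x = (a * (z - \<mu>)) \<cdot>\<^sub>v e + K *\<^sub>v r"
    proof -
      have "A *\<^sub>v x = a \<cdot>\<^sub>v (z \<cdot>\<^sub>v e) + A *\<^sub>v v"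
        unfolding x using mult_add_distrib_mat_vec[OF A, of "a \<cdot>\<^sub>v e" v] mult_mat_vec[OF A e(1), of a] vc e by simp
      then show ?thesis unfolding Kr using vc e(1) A by (subst x) (auto simp: algebra_simps intro!: eq_vecI simp del: index_mult_mat_vec)
    qed
    have "cip ((a * (z - \<mu>)) \<cdot>\<^sub>v e) (K *\<^sub>v r) = 0"
    proof -
      have "cip (K *\<^sub>v r) ((a * (z - \<mu>)) \<cdot>\<^sub>v e) = 0"
        using KV[OF rc] e by (simp add: V_def cip_smult_right[of _ n])
      then show ?thesis using cip_commute[of "K *\<^sub>v r" n "(a * (z - \<mu>)) \<cdot>\<^sub>v e"] Kc e by simp
    qed
    then have "(cvec_norm (A *\<^sub>v x - \<mu> \<cdot>\<^sub>v x))\<^sup>2 = (cvec_norm ((a * (z - \<mu>)) \<cdot>\<^sub>v e))\<^sup>2 + (cvec_norm (K *\<^sub>v r))\<^sup>2"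
      unfolding Ax using cvec_norm_pythagoras[of "(a * (z - \<mu>)) \<cdot>\<^sub>v e" n "K *\<^sub>v r"] Kc e by simp
    also have "\<dots> = (cmod (z - \<mu>) * cmod a)\<^sup>2 + (cvec_norm r)\<^sup>2"
      using isometry_norm[OF K(1) rc] e by (simp add: cvec_norm_smult norm_mult mult.commute)
    also have "\<dots> \<ge> (d * cmod a)\<^sup>2 + (d * cvec_norm y)\<^sup>2"
    proof (intro add_mono power_mono)
      show "d * cmod a \<le> cmod (z - \<mu>) * cmod a" by (intro mult_right_mono ev evz) auto
      show "d * cvec_norm y \<le> cvec_norm r" unfolding r_def
        by (rule less.IH[OF kn Bc hB _ less.prems(4) yc]) (intro ev evB)
    qed (use less.prems(4) in auto)
    also have "(d * cmod a)\<^sup>2 + (d * cvec_norm y)\<^sup>2 = (d * cvec_norm x)\<^sup>2"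
      by (simp add: norm_x power_mult_distrib distrib_left)
    finally show ?thesis by (rule power2_le_imp_le) simp
  qed
qed

section \<open>Principal angles as eigenvalues of a compression\<close>

lemma sorted_list_of_multiset_add_zeros:
  assumes "\<And>x. x \<in># X \<Longrightarrow> (0::real) \<le> x"
  shows "sorted_list_of_multiset (X + replicate_mset k 0) = replicate k 0 @ sorted_list_of_multiset X"
proof -
  have "sorted (replicate k 0 @ sorted_list_of_multiset X)"
    using assms by (simp add: sorted_append sorted_replicate)
  moreover have "mset (replicate k 0 @ sorted_list_of_multiset X) = X + replicate_mset k 0" by simp
  ultimately show ?thesis using sorted_list_of_multiset_mset[of "replicate k 0 @ sorted_list_of_multiset X"]
    by (simp only: sorted_sort_id)
qed

text \<open>Multiplying \<open>X\<close> and \<open>Y\<close> in the other order only changes the multiplicity of the eigenvalue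
  zero. Since the eigenvalues of \<open>Y X\<close> are nonnegative, they stay in front of the \<open>n - m\<close> additional
  zeros in decreasing order, so that cutting off after \<open>m\<close> entries leaves exactly them.\<close>

lemma set_take_singular_values:
  assumes S: "S \<in> carrier_mat n n" and XY: "mat_adjoint S * S = X * Y"
    and X: "X \<in> carrier_mat n m" and Y: "Y \<in> carrier_mat m n" and mn: "m \<le> n"
    and nonneg: "\<And>z. eigenvalue (Y * X) z \<Longrightarrow> 0 \<le> Re z"
  shows "set (take m (singular_values S)) = {sqrt (Re z) |z. eigenvalue (Y * X) z}"
proof -
  let ?f = "\<lambda>z. sqrt (Re z)"
  have XYc: "X * Y \<in> carrier_mat n n" and YXc: "Y * X \<in> carrier_mat m m" using X Y by auto
  note nz = proots_char_poly(3)[OF XYc] proots_char_poly(3)[OF YXc]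
  have lin: "proots ([:0, 1:] ^ k :: complex poly) = replicate_mset k 0" for k
    by (simp add: proots_power proots_linear_factor[of 0, simplified] repeat_mset_replicate_mset)
  have "proots ([:0, 1:] ^ m * char_poly (X * Y)) = proots ([:0, 1:] ^ n * char_poly (Y * X))"
    by (simp only: char_poly_mult_commute[OF X Y])
  then have "replicate_mset m 0 + proots (char_poly (X * Y)) = replicate_mset n 0 + proots (char_poly (Y * X))"
    using nz by (simp add: proots_mult lin)
  also have "replicate_mset n 0 = replicate_mset m 0 + replicate_mset (n - m) (0::complex)"
    using mn by (intro multiset_eqI) auto
  finally have pr: "proots (char_poly (X * Y)) = proots (char_poly (Y * X)) + replicate_mset (n - m) 0"
    by (simp add: union_assoc union_commute)
  define R where "R = image_mset ?f (proots (char_poly (Y * X)))"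
  have setR: "set_mset R = {sqrt (Re z) |z. eigenvalue (Y * X) z}"
    using proots_char_poly(1)[OF YXc] by (auto simp: R_def)
  have size: "length (sorted_list_of_multiset R) = m"
  proof -
    have "length (sorted_list_of_multiset R) = size (mset (sorted_list_of_multiset R))" by (simp only: size_mset)
    also have "\<dots> = m" using proots_char_poly(2)[OF YXc] by (simp add: R_def)
    finally show ?thesis .
  qed
  have "singular_values S = rev (sorted_list_of_multiset (R + replicate_mset (n - m) 0))"
    unfolding singular_values_def XY pr by (simp add: R_def)
  also have "\<dots> = rev (sorted_list_of_multiset R) @ replicate (n - m) 0"
    by (subst sorted_list_of_multiset_add_zeros) (use setR nonneg in auto)
  finally have "take m (singular_values S) = rev (sorted_list_of_multiset R)"
    using size by simp
  then show ?thesis using setR by simp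
qed

definition compression :: "complex mat \<Rightarrow> complex mat \<Rightarrow> complex mat" where
  "compression J Q = mat_adjoint J * (Q * J)"

lemma compression_hermitian:
  assumes J: "J \<in> carrier_mat n k" and Q: "Q \<in> carrier_mat n n" "mat_adjoint Q = Q"
  shows "compression J Q \<in> carrier_mat k k" "mat_adjoint (compression J Q) = compression J Q"
proof -
  have aJ: "mat_adjoint J \<in> carrier_mat k n" using J by simp
  show "compression J Q \<in> carrier_mat k k"
    unfolding compression_def by (rule mult_carrier_mat[OF aJ mult_carrier_mat[OF Q(1) J]])
  show "mat_adjoint (compression J Q) = compression J Q"
    using mat_adjoint_mult[OF aJ mult_carrier_mat[OF Q(1) J]] mat_adjoint_mult[OF Q(1) J] Q(2)
        assoc_mult_mat[OF aJ Q(1) J] by (simp add: compression_def)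
qed

lemma compression_apply:
  assumes J: "J \<in> carrier_mat n k" and Q: "Q \<in> carrier_mat n n" and "y \<in> carrier_vec k"
  shows "compression J Q *\<^sub>v y = mat_adjoint J *\<^sub>v (Q *\<^sub>v (J *\<^sub>v y))"
proof -
  have aJ: "mat_adjoint J \<in> carrier_mat k n" using J by simp
  show ?thesis unfolding compression_def
    using assoc_mult_mat_vec[OF aJ mult_carrier_mat[OF Q J] assms(3)] assoc_mult_mat_vec[OF Q J assms(3)] by simp
qed

text \<open>For a projection \<open>Q\<close>, the quadratic form of the compression at \<open>y\<close> is \<open>\<parallel>Q J y\<parallel>\<^sup>2\<close>, which lies
  between \<open>0\<close> and \<open>\<parallel>y\<parallel>\<^sup>2\<close>.\<close>

lemma compression_eigenvalue:
  assumes J: "isometry n k J" and Q: "Q \<in> carrier_mat n n" "mat_adjoint Q = Q" "Q * Q = Q"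
    and contr: "\<And>x. x \<in> carrier_vec n \<Longrightarrow> cvec_norm (Q *\<^sub>v x) \<le> cvec_norm x"
    and z: "eigenvalue (compression J Q) z"
  shows "z \<in> \<real>" "Re z \<in> {0..1}"
proof -
  have Jc: "J \<in> carrier_mat n k" using J isometry_carrier by auto
  have aJ: "mat_adjoint J \<in> carrier_mat k n" using Jc by simp
  note H = compression_hermitian[OF Jc Q(1,2)]
  show zr: "z \<in> \<real>" by (rule hermitian_eigenvalue_real[OF H z])
  obtain y where y: "y \<in> carrier_vec k" "y \<noteq> 0\<^sub>v k" "compression J Q *\<^sub>v y = z \<cdot>\<^sub>v y"
    using z eigenvalue_iff[OF H(1)] by auto
  let ?x = "J *\<^sub>v y"
  have xc: "?x \<in> carrier_vec n" using Jc by simp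
  have Qx: "Q *\<^sub>v ?x \<in> carrier_vec n" using Q by simp
  have "z * complex_of_real ((cvec_norm y)\<^sup>2) = cip (compression J Q *\<^sub>v y) y"
    using y by (simp add: cip_smult_left[of _ k] cip_self)
  also have "\<dots> = cip (Q *\<^sub>v ?x) ?x"
    unfolding compression_apply[OF Jc Q(1) y(1)] using cip_adjoint[OF aJ Qx y(1)] by simp
  also have "\<dots> = cip ((Q * Q) *\<^sub>v ?x) ?x" using Q by simp
  also have "\<dots> = cip (Q *\<^sub>v (Q *\<^sub>v ?x)) ?x" using assoc_mult_mat_vec[OF Q(1) Q(1) xc] by simp
  also have "\<dots> = cip (Q *\<^sub>v ?x) (Q *\<^sub>v ?x)" using cip_adjoint[OF Q(1) Qx xc] Q(2) by simp
  finally have "z * complex_of_real ((cvec_norm y)\<^sup>2) = complex_of_real ((cvec_norm (Q *\<^sub>v ?x))\<^sup>2)"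
    by (simp add: cip_self)
  then have "complex_of_real (Re z * (cvec_norm y)\<^sup>2) = complex_of_real ((cvec_norm (Q *\<^sub>v ?x))\<^sup>2)"
    using zr by simp
  then have e: "Re z * (cvec_norm y)\<^sup>2 = (cvec_norm (Q *\<^sub>v ?x))\<^sup>2" by (simp only: of_real_eq_iff)
  have pos: "0 < (cvec_norm y)\<^sup>2" using cvec_norm_pos[OF y(1,2)] by simp
  have "cvec_norm (Q *\<^sub>v ?x) \<le> cvec_norm y" using contr[OF xc] isometry_norm[OF J y(1)] by simp
  then have "Re z * (cvec_norm y)\<^sup>2 \<le> 1 * (cvec_norm y)\<^sup>2" unfolding e by (simp add: power_mono)
  moreover have "0 \<le> Re z * (cvec_norm y)\<^sup>2" unfolding e by simp
  ultimately show "Re z \<in> {0..1}" using pos by (simp add: zero_le_mult_iff)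
qed

text \<open>With the projections \<open>P = J J\<^sup>*\<close> and \<open>Q = K K\<^sup>*\<close>, the squared singular values of \<open>Q P\<close> are the
  eigenvalues of \<open>P Q P\<close>. Compressing to the smaller of the two subspaces keeps exactly those that
  count as principal angles and discards the zeros that are due to the ambient dimension. Without this
  step a small eigenvalue of the perturbed matrix could not be told from such a zero.\<close>

lemma principal_angles_isometries:
  assumes J: "isometry n k J" and K: "isometry n l K"
  shows "set (principal_angles n (mat_range J) (mat_range K)) =
     (if k \<le> l then {arccos (sqrt (Re z)) |z. eigenvalue (compression J (K * mat_adjoint K)) z}
      else {arccos (sqrt (Re z)) |z. eigenvalue (compression K (J * mat_adjoint J)) z})"
proof -
  let ?P = "J * mat_adjoint J" and ?Q = "K * mat_adjoint K"
  have Jc: "J \<in> carrier_mat n k" and Kc: "K \<in> carrier_mat n l" using J K isometry_carrier by auto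
  have aJ: "mat_adjoint J \<in> carrier_mat k n" and aK: "mat_adjoint K \<in> carrier_mat l n" using Jc Kc by auto
  note P = isometry_projection_facts[OF J] and Q = isometry_projection_facts[OF K]
  have S: "?Q * ?P \<in> carrier_mat n n" using P(1) Q(1) by simp
  have SS: "mat_adjoint (?Q * ?P) * (?Q * ?P) = ?P * (?Q * ?P)"
  proof -
    have "mat_adjoint (?Q * ?P) = ?P * ?Q" using mat_adjoint_mult[OF Q(1) P(1)] P(2) Q(2) by simp
    moreover have "?P * ?Q * (?Q * ?P) = ?P * (?Q * (?Q * ?P))" by (rule assoc_mult_mat[OF P(1) Q(1) S])
    moreover have "?Q * (?Q * ?P) = ?Q * ?Q * ?P" by (rule assoc_mult_mat[OF Q(1) Q(1) P(1), symmetric])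
    ultimately show ?thesis using Q(3) by simp
  qed
  have pa: "set (principal_angles n (mat_range J) (mat_range K)) = arccos ` set (take (min k l) (singular_values (?Q * ?P)))"
    unfolding principal_angles_def csubspace_dim_isometry[OF J] csubspace_dim_isometry[OF K]
      orth_proj_isometry[OF J] orth_proj_isometry[OF K] by simp
  show ?thesis
  proof (cases "k \<le> l")
    case True
    let ?Y = "mat_adjoint J * (?Q * ?P)"
    have Y: "?Y \<in> carrier_mat k n" using aJ S by simp
    have XY: "mat_adjoint (?Q * ?P) * (?Q * ?P) = J * ?Y"
      unfolding SS by (rule assoc_mult_mat[OF Jc aJ S])
    have PJ: "?P * J = J" using assoc_mult_mat[OF Jc aJ Jc] J right_mult_one_mat[OF Jc] by (simp add: isometry_def)
    have YX: "?Y * J = compression J ?Q"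
      using assoc_mult_mat[OF aJ S Jc] assoc_mult_mat[OF Q(1) P(1) Jc] by (simp add: PJ compression_def)
    have "set (take k (singular_values (?Q * ?P))) = {sqrt (Re z) |z. eigenvalue (compression J ?Q) z}"
      using set_take_singular_values[OF S XY Jc Y isometry_le[OF J]]
        compression_eigenvalue(2)[OF J Q] unfolding YX by auto
    then show ?thesis using True unfolding pa by (auto simp: min_def image_iff)
  next
    case False
    let ?X = "?P * K" and ?Y = "mat_adjoint K * ?P"
    have X: "?X \<in> carrier_mat n l" and Y: "?Y \<in> carrier_mat l n"
      using mult_carrier_mat[OF P(1) Kc] mult_carrier_mat[OF aK P(1)] by auto
    have XY: "mat_adjoint (?Q * ?P) * (?Q * ?P) = ?X * ?Y"
      unfolding SS using assoc_mult_mat[OF P(1) Kc Y] assoc_mult_mat[OF Kc aK P(1)] by simp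
    have YX: "?Y * ?X = compression K ?P"
      using assoc_mult_mat[OF aK P(1) X] assoc_mult_mat[OF P(1) P(1) Kc] P(3) by (simp add: compression_def)
    have "set (take l (singular_values (?Q * ?P))) = {sqrt (Re z) |z. eigenvalue (compression K ?P) z}"
      using set_take_singular_values[OF S XY X Y isometry_le[OF K]]
        compression_eigenvalue(2)[OF K P] unfolding YX by auto
    then show ?thesis using False unfolding pa by (auto simp: min_def image_iff)
  qed
qed

text \<open>An eigenvector of \<open>B\<close> is an approximate eigenvector of \<open>A\<close>.\<close>

lemma eigenvalue_perturbation:
  assumes A: "A \<in> carrier_mat n n" "mat_adjoint A = A" and B: "B \<in> carrier_mat n n"
    and near: "\<And>x. x \<in> carrier_vec n \<Longrightarrow> cvec_norm (B *\<^sub>v x - A *\<^sub>v x) \<le> \<delta> * cvec_norm x"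
    and w: "eigenvalue B w" and "\<delta> < d"
  shows "\<exists>z. eigenvalue A z \<and> cmod (z - w) < d"
proof (rule ccontr)
  assume neg: "\<not> (\<exists>z. eigenvalue A z \<and> cmod (z - w) < d)"
  obtain x where x: "x \<in> carrier_vec n" "x \<noteq> 0\<^sub>v n" "B *\<^sub>v x = w \<cdot>\<^sub>v x"
    using w eigenvalue_iff[OF B] by auto
  have pos: "0 < cvec_norm x" using cvec_norm_pos x by auto
  have Ax: "A *\<^sub>v x \<in> carrier_vec n" "B *\<^sub>v x \<in> carrier_vec n" using A B by auto
  have near_x: "cvec_norm (A *\<^sub>v x - w \<cdot>\<^sub>v x) \<le> \<delta> * cvec_norm x"
    using near[OF x(1)] cvec_norm_minus_commute[OF Ax] x(3) by simp
  have "0 \<le> \<delta> * cvec_norm x" by (rule order_trans[OF cvec_norm_nonneg near_x])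
  then have "0 \<le> d" using pos \<open>\<delta> < d\<close> by (simp add: zero_le_mult_iff)
  have "d * cvec_norm x \<le> cvec_norm (A *\<^sub>v x - w \<cdot>\<^sub>v x)"
    by (rule hermitian_resolvent_bound[OF A _ \<open>0 \<le> d\<close> x(1)]) (use neg in force)
  then have "d * cvec_norm x \<le> \<delta> * cvec_norm x" using near_x by simp
  then show False using pos \<open>\<delta> < d\<close> by simp
qed

text \<open>At \<open>x\<close>, the compressions of \<open>Q\<close> to \<open>J\<close> and to \<open>U J\<close> differ by \<open>J\<^sup>* U\<^sup>* (Q U - U Q) y\<close> with
  \<open>y = J x\<close>, and the commutator satisfies \<open>\<parallel>Q U y - U Q y\<parallel> \<le> 2 \<epsilon> \<parallel>y\<parallel>\<close> when \<open>U\<close> is within \<open>\<epsilon>\<close>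
  of the identity.\<close>

lemma compression_perturbation:
  assumes J: "isometry n k J" and Q: "Q \<in> carrier_mat n n" "mat_adjoint Q = Q" "Q * Q = Q"
    and contr: "\<And>x. x \<in> carrier_vec n \<Longrightarrow> cvec_norm (Q *\<^sub>v x) \<le> cvec_norm x"
    and U: "isometry n n U"
    and near: "\<And>x. x \<in> carrier_vec n \<Longrightarrow> cvec_norm (U *\<^sub>v x - x) \<le> \<epsilon> * cvec_norm x"
    and w: "eigenvalue (compression (U * J) Q) w" and "2 * \<epsilon> < d"
  shows "\<exists>z. eigenvalue (compression J Q) z \<and> \<bar>Re z - Re w\<bar> < d"
proof -
  have Jc: "J \<in> carrier_mat n k" and Uc: "U \<in> carrier_mat n n" using J U isometry_carrier by auto
  have UJ: "U * J \<in> carrier_mat n k" using Jc Uc by simp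
  have aJ: "mat_adjoint J \<in> carrier_mat k n" and aU: "mat_adjoint U \<in> carrier_mat n n" using Jc Uc by auto
  have "cvec_norm (compression (U * J) Q *\<^sub>v x - compression J Q *\<^sub>v x) \<le> (2 * \<epsilon>) * cvec_norm x"
    if x: "x \<in> carrier_vec k" for x
  proof -
    define y where "y = J *\<^sub>v x"
    have y: "y \<in> carrier_vec n" "cvec_norm y = cvec_norm x" using Jc isometry_norm[OF J x] by (auto simp: y_def)
    have Uy: "U *\<^sub>v y \<in> carrier_vec n" and Qy: "Q *\<^sub>v y \<in> carrier_vec n" and QUy: "Q *\<^sub>v (U *\<^sub>v y) \<in> carrier_vec n"
      and UQy: "U *\<^sub>v (Q *\<^sub>v y) \<in> carrier_vec n"
      using Uc Q by auto
    have "compression (U * J) Q *\<^sub>v x = mat_adjoint J *\<^sub>v (mat_adjoint U *\<^sub>v (Q *\<^sub>v (U *\<^sub>v y)))"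
      unfolding compression_apply[OF UJ Q(1) x] using assoc_mult_mat_vec[OF Uc Jc x]
        mat_adjoint_mult[OF Uc Jc] assoc_mult_mat_vec[OF aJ aU QUy] by (simp add: y_def)
    moreover have "compression J Q *\<^sub>v x = mat_adjoint J *\<^sub>v (mat_adjoint U *\<^sub>v (U *\<^sub>v (Q *\<^sub>v y)))"
      unfolding compression_apply[OF Jc Q(1) x] using isometry_adjoint_apply[OF U Qy] by (simp add: y_def)
    ultimately have "compression (U * J) Q *\<^sub>v x - compression J Q *\<^sub>v x =
        mat_adjoint J *\<^sub>v (mat_adjoint U *\<^sub>v (Q *\<^sub>v (U *\<^sub>v y) - U *\<^sub>v (Q *\<^sub>v y)))"
      using mult_minus_distrib_mat_vec[OF aU QUy UQy]
        mult_minus_distrib_mat_vec[OF aJ, of "mat_adjoint U *\<^sub>v (Q *\<^sub>v (U *\<^sub>v y))" "mat_adjoint U *\<^sub>v (U *\<^sub>v (Q *\<^sub>v y))"] Uc by simp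
    then have "cvec_norm (compression (U * J) Q *\<^sub>v x - compression J Q *\<^sub>v x) \<le> cvec_norm (Q *\<^sub>v (U *\<^sub>v y) - U *\<^sub>v (Q *\<^sub>v y))"
      using isometry_adjoint_norm[OF J, of "mat_adjoint U *\<^sub>v (Q *\<^sub>v (U *\<^sub>v y) - U *\<^sub>v (Q *\<^sub>v y))"]
        isometry_adjoint_norm[OF U, of "Q *\<^sub>v (U *\<^sub>v y) - U *\<^sub>v (Q *\<^sub>v y)"] Uc QUy UQy by simp
    also have "Q *\<^sub>v (U *\<^sub>v y) - U *\<^sub>v (Q *\<^sub>v y) = Q *\<^sub>v (U *\<^sub>v y - y) - (U *\<^sub>v (Q *\<^sub>v y) - Q *\<^sub>v y)"
      unfolding mult_minus_distrib_mat_vec[OF Q(1) Uy y(1)]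
      using QUy UQy Qy Uc Q(1) y(1) by (intro eq_vecI) (auto simp del: index_mult_mat_vec)
    also have "cvec_norm \<dots> \<le> cvec_norm (Q *\<^sub>v (U *\<^sub>v y - y)) + cvec_norm (U *\<^sub>v (Q *\<^sub>v y) - Q *\<^sub>v y)"
      by (rule cvec_norm_diff[of _ n]) (use Q Uc in simp_all)
    also have "\<dots> \<le> \<epsilon> * cvec_norm y + \<epsilon> * cvec_norm y"
    proof (rule add_mono)
      show "cvec_norm (Q *\<^sub>v (U *\<^sub>v y - y)) \<le> \<epsilon> * cvec_norm y"
        using contr[of "U *\<^sub>v y - y"] near[OF y(1)] Uy y(1) by auto
      have 1: "cvec_norm (U *\<^sub>v (Q *\<^sub>v y) - Q *\<^sub>v y) \<le> \<epsilon> * cvec_norm (Q *\<^sub>v y)" by (rule near[OF Qy])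
      show "cvec_norm (U *\<^sub>v (Q *\<^sub>v y) - Q *\<^sub>v y) \<le> \<epsilon> * cvec_norm y"
      proof (cases "cvec_norm (Q *\<^sub>v y) = 0")
        case True
        have "0 \<le> \<epsilon> * cvec_norm y" by (rule order_trans[OF cvec_norm_nonneg near[OF y(1)]])
        then show ?thesis using 1 True by simp
      next
        case False
        then have "0 < cvec_norm (Q *\<^sub>v y)" using cvec_norm_nonneg[of "Q *\<^sub>v y"] by linarith
        moreover have "0 \<le> \<epsilon> * cvec_norm (Q *\<^sub>v y)" by (rule order_trans[OF cvec_norm_nonneg 1])
        ultimately have "0 \<le> \<epsilon>" by (simp add: zero_le_mult_iff)
        then show ?thesis using 1 contr[OF y(1)] by (meson mult_left_mono order_trans)
      qed
    qed
    finally show ?thesis using y(2) by simp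
  qed
  from eigenvalue_perturbation[OF compression_hermitian[OF Jc Q(1,2)] compression_hermitian(1)[OF UJ Q(1,2)] this w \<open>2 * \<epsilon> < d\<close>]
  obtain z where "eigenvalue (compression J Q) z" "cmod (z - w) < d" by auto
  moreover have "\<bar>Re z - Re w\<bar> \<le> cmod (z - w)" using abs_Re_le_cmod[of "z - w"] by simp
  ultimately show ?thesis by force
qed

section \<open>Stability of principal angles\<close>

lemma isometry_mult:
  assumes "isometry n m U" "isometry m k J"
  shows "isometry n k (U * J)" "mat_range (U * J) = (\<lambda>v. U *\<^sub>v v) ` mat_range J"
proof -
  have U: "U \<in> carrier_mat n m" "mat_adjoint U * U = 1\<^sub>m m" and J: "J \<in> carrier_mat m k" "mat_adjoint J * J = 1\<^sub>m k"
    using assms by (auto simp: isometry_def)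
  have aU: "mat_adjoint U \<in> carrier_mat m n" and aJ: "mat_adjoint J \<in> carrier_mat k m" using U J by auto
  have "mat_adjoint U * (U * J) = J"
    using assoc_mult_mat[OF aU U(1) J(1)] U(2) left_mult_one_mat[OF J(1)] by simp
  then have "mat_adjoint (U * J) * (U * J) = 1\<^sub>m k"
    using mat_adjoint_mult[OF U(1) J(1)] assoc_mult_mat[OF aJ aU mult_carrier_mat[OF U(1) J(1)]] J(2) by simp
  then show "isometry n k (U * J)" using U J by (simp add: isometry_def)
  show "mat_range (U * J) = (\<lambda>v. U *\<^sub>v v) ` mat_range J"
    using assoc_mult_mat_vec[OF U(1) J(1)] J(1) by (auto simp: mat_range_def image_image)
qed

lemma unitary_group_isometry:
  assumes "U \<in> unitary_group n"
  shows "isometry n n U" "isometry n n (mat_adjoint U)"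
  using assms by (auto simp: unitary_group_def isometry_def)

lemma adjoint_near_identity:
  assumes U: "U \<in> unitary_group n" and x: "x \<in> carrier_vec n"
  shows "cvec_norm (mat_adjoint U *\<^sub>v x - x) \<le> cvec_norm (U *\<^sub>v x - x)"
proof -
  note iso = unitary_group_isometry[OF U]
  have Uc: "U \<in> carrier_mat n n" using iso(1) isometry_carrier by auto
  have aU: "mat_adjoint U \<in> carrier_mat n n" and Ux: "U *\<^sub>v x \<in> carrier_vec n" using Uc by auto
  have "mat_adjoint U *\<^sub>v (x - U *\<^sub>v x) = mat_adjoint U *\<^sub>v x - x"
    using mult_minus_distrib_mat_vec[OF aU x Ux] isometry_adjoint_apply[OF iso(1) x] by simp
  then show ?thesis
    using isometry_adjoint_norm[OF iso(1), of "x - U *\<^sub>v x"] cvec_norm_minus_commute[OF x Ux] x Ux by simp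
qed

text \<open>The eigenvalues of the compressions are moved by at most \<open>2 \<epsilon>\<close>, and \<open>arccos \<circ> sqrt\<close> is uniformly
  continuous on the unit interval, so \<open>\<epsilon>\<close> can be chosen before the dimension \<open>n\<close>. The finiteness of
  \<open>\<theta>\<close> gives a uniform distance from \<open>\<theta>\<close> to the complement of \<open>G\<close>.\<close>

lemma principal_angles_near_identity:
  assumes fin: "finite \<theta>" and G: "open G" "\<theta> \<subseteq> G"
  shows "\<exists>\<epsilon>>0. \<forall>n V W. \<forall>U\<in>unitary_group n. csubspace n V \<longrightarrow> csubspace n W \<longrightarrow>
     set (principal_angles n V W) \<subseteq> \<theta> \<longrightarrow>
     (\<forall>x\<in>carrier_vec n. cvec_norm (U *\<^sub>v x - x) \<le> \<epsilon> * cvec_norm x) \<longrightarrow>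
     set (principal_angles n ((\<lambda>v. U *\<^sub>v v) ` V) W) \<subseteq> G"
proof -
  define g where "g = (\<lambda>x::real. arccos (sqrt x))"
  have "compact \<theta>" using fin by (rule finite_imp_compact)
  then obtain e where e: "e > 0" "(\<Union>a\<in>\<theta>. ball a e) \<subseteq> G"
    using compact_subset_open_imp_ball_epsilon_subset[of \<theta> G] G by auto
  have "continuous_on {0..1} g" unfolding g_def
    by (intro continuous_intros) (auto intro: order_trans[of _ 0])
  then have "uniformly_continuous_on {0..1} g" by (intro compact_uniformly_continuous) auto
  then obtain d where d: "d > 0" "\<And>x y. x \<in> {0..1} \<Longrightarrow> y \<in> {0..1} \<Longrightarrow> \<bar>y - x\<bar> < d \<Longrightarrow> \<bar>g y - g x\<bar> < e"
    using e(1) unfolding uniformly_continuous_on_def dist_real_def by metis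
  have key: "g (Re w) \<in> G" if J: "isometry n k J" and K: "isometry n l K" and U: "U \<in> unitary_group n"
     and near: "\<And>x. x \<in> carrier_vec n \<Longrightarrow> cvec_norm (U *\<^sub>v x - x) \<le> (d / 4) * cvec_norm x"
     and \<theta>: "\<And>z. eigenvalue (compression J (K * mat_adjoint K)) z \<Longrightarrow> g (Re z) \<in> \<theta>"
     and w: "eigenvalue (compression (U * J) (K * mat_adjoint K)) w" for n k J l K U w
  proof -
    note Q = isometry_projection_facts[OF K] and iso = unitary_group_isometry[OF U]
    have "2 * (d / 4) < d" using d(1) by simp
    from compression_perturbation[OF J Q iso(1) near w this]
    obtain z where z: "eigenvalue (compression J (K * mat_adjoint K)) z" "\<bar>Re z - Re w\<bar> < d" by blast
    have "Re z \<in> {0..1}" by (rule compression_eigenvalue(2)[OF J Q z(1)])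
    moreover have "Re w \<in> {0..1}" by (rule compression_eigenvalue(2)[OF isometry_mult(1)[OF iso(1) J] Q w])
    ultimately have "\<bar>g (Re z) - g (Re w)\<bar> < e" using d(2) z(2) by blast
    then have "g (Re w) \<in> ball (g (Re z)) e" by (simp add: dist_real_def)
    then show ?thesis using e(2) \<theta>[OF z(1)] by blast
  qed
  show ?thesis
  proof (intro exI[of _ "d / 4"] conjI allI ballI impI)
    show "d / 4 > 0" using d by simp
    fix n V W U
    assume U: "U \<in> unitary_group n" and V: "csubspace n V" and W: "csubspace n W"
      and \<theta>: "set (principal_angles n V W) \<subseteq> \<theta>"
      and near_ball: "\<forall>x\<in>carrier_vec n. cvec_norm (U *\<^sub>v x - x) \<le> d / 4 * cvec_norm x"
    have near: "cvec_norm (U *\<^sub>v x - x) \<le> d / 4 * cvec_norm x" if "x \<in> carrier_vec n" for x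
      using near_ball that by blast
    obtain k J where J: "isometry n k J" "mat_range J = V" using lin_closed_isometry[OF csubspace_imp_lin_closed[OF V]] by blast
    obtain l K where K: "isometry n l K" "mat_range K = W" using lin_closed_isometry[OF csubspace_imp_lin_closed[OF W]] by blast
    note iso = unitary_group_isometry[OF U]
    note UJ = isometry_mult[OF iso(1) J(1)]
    have range_UJ: "mat_range (U * J) = (\<lambda>v. U *\<^sub>v v) ` V" using UJ(2) J(2) by simp
    note pa = principal_angles_isometries[OF J(1) K(1), unfolded J(2) K(2)]
    note pa' = principal_angles_isometries[OF UJ(1) K(1), unfolded range_UJ K(2)]
    show "set (principal_angles n ((\<lambda>v. U *\<^sub>v v) ` V) W) \<subseteq> G"
    proof (cases "k \<le> l")
      case True
      have "g (Re z) \<in> \<theta>" if "eigenvalue (compression J (K * mat_adjoint K)) z" for z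
        using that \<theta> True unfolding pa g_def by auto
      from key[OF J(1) K(1) U near this] show ?thesis using True unfolding pa' g_def by auto
    next
      case False
      \<comment> \<open>Now \<open>W\<close> is the smaller space. Compressing \<open>U P U\<^sup>*\<close> to \<open>W\<close> is compressing \<open>P\<close> to \<open>U\<^sup>* W\<close>, so the
        previous case applies with \<open>U\<^sup>*\<close>, which is as close to the identity as \<open>U\<close>.\<close>
      have aU: "mat_adjoint U \<in> unitary_group n" using U by (auto simp: unitary_group_def)
      have near': "cvec_norm (mat_adjoint U *\<^sub>v x - x) \<le> d / 4 * cvec_norm x" if "x \<in> carrier_vec n" for x
        using adjoint_near_identity[OF U that] near[OF that] by simp
      have th: "g (Re z) \<in> \<theta>" if "eigenvalue (compression K (J * mat_adjoint J)) z" for z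
        using that \<theta> False unfolding pa g_def by auto
      have "compression K (U * J * mat_adjoint (U * J)) = compression (mat_adjoint U * K) (J * mat_adjoint J)"
      proof -
        have c: "U \<in> carrier_mat n n" "J \<in> carrier_mat n k" "K \<in> carrier_mat n l"
          using iso(1) J(1) K(1) isometry_carrier by auto
        have a: "mat_adjoint U \<in> carrier_mat n n" "mat_adjoint J \<in> carrier_mat k n" "mat_adjoint K \<in> carrier_mat l n"
          using c by auto
        have P: "J * mat_adjoint J \<in> carrier_mat n n" using c by simp
        have "U * J * mat_adjoint (U * J) = U * (J * mat_adjoint J * mat_adjoint U)"
          using mat_adjoint_mult[OF c(1,2)] assoc_mult_mat[OF c(1,2) mult_carrier_mat[OF a(2,1)]]
            assoc_mult_mat[OF c(2) a(2,1)] by simp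
        then have "U * J * mat_adjoint (U * J) * K = U * (J * mat_adjoint J * (mat_adjoint U * K))"
          using assoc_mult_mat[OF c(1) mult_carrier_mat[OF P a(1)] c(3)] assoc_mult_mat[OF P a(1) c(3)] by simp
        moreover have "mat_adjoint (mat_adjoint U * K) = mat_adjoint K * U"
          using mat_adjoint_mult[OF a(1) c(3)] by simp
        ultimately show ?thesis unfolding compression_def
          using assoc_mult_mat[OF a(3) c(1) mult_carrier_mat[OF P mult_carrier_mat[OF a(1) c(3)]]] by simp
      qed
      then show ?thesis using key[OF K(1) J(1) aU near' th] False unfolding pa' g_def by auto
    qed
  qed
qed

section \<open>Exponentials of matrix coefficients as smooth functions\<close>

lemma cvec_norm_bound_ball:
  assumes A: "A \<in> carrier_mat n m" and v: "v \<in> carrier_vec m" "cvec_norm v \<le> 1"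
  shows "cvec_norm (A *\<^sub>v v) \<le> (\<Sum>i<n. \<Sum>l<m. cmod (A $$ (i, l)))"
proof -
  have vl: "cmod (vec_index v l) \<le> 1" if "l < m" for l
  proof -
    have "cmod (vec_index v l) \<le> cvec_norm v"
      unfolding cvec_norm_def using that v(1) by (intro member_le_L2_set) auto
    then show ?thesis using v(2) by simp
  qed
  have "cvec_norm (A *\<^sub>v v) \<le> (\<Sum>i<n. cmod (vec_index (A *\<^sub>v v) i))"
    unfolding cvec_norm_def using A L2_set_le_sum[of "{..<n}" "\<lambda>i. cmod (vec_index (A *\<^sub>v v) i)"]
    by (simp del: index_mult_mat_vec)
  also have "\<dots> \<le> (\<Sum>i<n. \<Sum>l<m. cmod (A $$ (i, l)))"
  proof (intro sum_mono)
    fix i assume "i \<in> {..<n}"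
    then have "vec_index (A *\<^sub>v v) i = (\<Sum>l<m. A $$ (i, l) * vec_index v l)"
      using A v(1) by (intro index_mult_vec_sum) auto
    then have "cmod (vec_index (A *\<^sub>v v) i) \<le> (\<Sum>l<m. cmod (A $$ (i, l) * vec_index v l))"
      by (simp only: norm_sum)
    also have "\<dots> \<le> (\<Sum>l<m. cmod (A $$ (i, l)))"
      using vl by (intro sum_mono) (auto simp: norm_mult intro: mult_left_le)
    finally show "cmod (vec_index (A *\<^sub>v v) i) \<le> (\<Sum>l<m. cmod (A $$ (i, l)))" .
  qed
  finally show ?thesis .
qed

lemma cmod_entry_le_opnorm:
  assumes A: "A \<in> carrier_mat n m" and ij: "i < n" "j < m"
  shows "cmod (A $$ (i, j)) \<le> opnorm A"
proof -
  let ?S = "{v \<in> carrier_vec (dim_col A). cvec_norm v \<le> 1}"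
  have bdd: "bdd_above ((\<lambda>v. cvec_norm (A *\<^sub>v v)) ` ?S)"
    using cvec_norm_bound_ball[OF A] A by (intro bdd_aboveI2) auto
  have u: "cvec_norm (unit_vec m j :: complex Matrix.vec) \<le> 1" using cvec_norm_unit_vec[OF ij(2)] by simp
  have "cmod (A $$ (i, j)) = cmod (vec_index (A *\<^sub>v unit_vec m j) i)"
    using mult_unit_vec_index[OF A ij] by simp
  also have "\<dots> \<le> cvec_norm (A *\<^sub>v unit_vec m j)"
    unfolding cvec_norm_def using ij A by (intro member_le_L2_set) auto
  also have "\<dots> \<le> opnorm A"
    unfolding opnorm_def using u A by (intro cSUP_upper bdd) auto
  finally show ?thesis .
qed

text \<open>Continuity on the unitary group is convergence along this filter, so that the general rules
  for limits of sums, products and compositions apply.\<close>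

definition unitary_nhds :: "nat \<Rightarrow> complex mat \<Rightarrow> complex mat filter" where
  "unitary_nhds n A = (INF d\<in>{0<..}. principal {B \<in> unitary_group n. opnorm (B - A) < d})"

lemma eventually_unitary_nhds:
  "eventually P (unitary_nhds n A) \<longleftrightarrow> (\<exists>d>0. \<forall>B\<in>unitary_group n. opnorm (B - A) < d \<longrightarrow> P B)"
proof -
  have "eventually P (unitary_nhds n A) \<longleftrightarrow>
      (\<exists>d\<in>{0<..}. eventually P (principal {B \<in> unitary_group n. opnorm (B - A) < d}))"
    unfolding unitary_nhds_def
  proof (rule eventually_INF_base)
    fix a b :: real assume "a \<in> {0<..}" "b \<in> {0<..}"
    then show "\<exists>x\<in>{0<..}. principal {B \<in> unitary_group n. opnorm (B - A) < x} \<le>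
        inf (principal {B \<in> unitary_group n. opnorm (B - A) < a}) (principal {B \<in> unitary_group n. opnorm (B - A) < b})"
      by (intro bexI[of _ "min a b"]) auto
  qed auto
  then show ?thesis by (auto simp: eventually_principal)
qed

lemma continuous_on_unitary_tendsto:
  "continuous_on_unitary n f \<longleftrightarrow> (\<forall>A\<in>unitary_group n. (f \<longlongrightarrow> f A) (unitary_nhds n A))"
  unfolding continuous_on_unitary_def tendsto_iff eventually_unitary_nhds dist_real_def by blast

lemma continuous_on_unitary_const: "continuous_on_unitary n (\<lambda>_. c)"
  and continuous_on_unitary_add: "continuous_on_unitary n f \<Longrightarrow> continuous_on_unitary n g \<Longrightarrow>
    continuous_on_unitary n (\<lambda>B. f B + g B)"
  and continuous_on_unitary_mult: "continuous_on_unitary n f \<Longrightarrow> continuous_on_unitary n g \<Longrightarrow>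
    continuous_on_unitary n (\<lambda>B. f B * g B)"
  and continuous_on_unitary_exp: "continuous_on_unitary n f \<Longrightarrow> continuous_on_unitary n (\<lambda>B. exp (f B))"
  unfolding continuous_on_unitary_tendsto by (auto intro!: tendsto_intros)

lemma continuous_on_unitary_cong:
  "(\<And>A. A \<in> unitary_group n \<Longrightarrow> f A = g A) \<Longrightarrow> continuous_on_unitary n f \<longleftrightarrow> continuous_on_unitary n g"
  unfolding continuous_on_unitary_def by auto

lemma unitary_group_carrier: "A \<in> unitary_group n \<Longrightarrow> A \<in> carrier_mat n n"
  by (simp add: unitary_group_def)

definition matrix_coeff :: "complex Matrix.vec \<Rightarrow> complex Matrix.vec \<Rightarrow> complex mat \<Rightarrow> real" where
  "matrix_coeff u w B = Re (cip (B *\<^sub>v u) w)"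

lemma cip_mult_vec_sum:
  assumes "B \<in> carrier_mat n m" "u \<in> carrier_vec m"
  shows "cip (B *\<^sub>v u) w = (\<Sum>i<n. \<Sum>l<m. B $$ (i, l) * vec_index u l * cnj (vec_index w i))"
  using assms by (simp add: cip_sum[of _ n] index_mult_vec_sum[of B n m] sum_distrib_right del: index_mult_mat_vec)

lemma continuous_on_unitary_matrix_coeff:
  assumes u: "u \<in> carrier_vec n"
  shows "continuous_on_unitary n (matrix_coeff u w)"
  unfolding continuous_on_unitary_tendsto
proof
  fix A assume A: "A \<in> unitary_group n"
  have entry: "((\<lambda>B. B $$ (i, l)) \<longlongrightarrow> A $$ (i, l)) (unitary_nhds n A)" if "i < n" "l < n" for i l
    unfolding tendsto_iff
  proof (intro allI impI)
    fix e :: real assume "0 < e"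
    have "dist (B $$ (i, l)) (A $$ (i, l)) < e" if B: "B \<in> unitary_group n" "opnorm (B - A) < e" for B
    proof -
      have "dist (B $$ (i, l)) (A $$ (i, l)) = cmod ((B - A) $$ (i, l))"
        using \<open>i < n\<close> \<open>l < n\<close> unitary_group_carrier[OF A] unitary_group_carrier[OF B(1)] by (simp add: dist_norm)
      also have "\<dots> \<le> opnorm (B - A)"
        using \<open>i < n\<close> \<open>l < n\<close> unitary_group_carrier[OF A] unitary_group_carrier[OF B(1)]
        by (intro cmod_entry_le_opnorm[of _ n n]) auto
      finally show ?thesis using B(2) by simp
    qed
    then show "\<forall>\<^sub>F B in unitary_nhds n A. dist (B $$ (i, l)) (A $$ (i, l)) < e"
      unfolding eventually_unitary_nhds using \<open>0 < e\<close> by blast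
  qed
  let ?s = "\<lambda>B. Re (\<Sum>i<n. \<Sum>l<n. B $$ (i, l) * vec_index u l * cnj (vec_index w i))"
  have eq: "matrix_coeff u w B = ?s B" if "B \<in> unitary_group n" for B
    using cip_mult_vec_sum[OF unitary_group_carrier[OF that] u] by (simp add: matrix_coeff_def)
  have "(?s \<longlongrightarrow> ?s A) (unitary_nhds n A)"
    by (intro tendsto_intros entry) auto
  moreover have "\<forall>\<^sub>F B in unitary_nhds n A. ?s B = matrix_coeff u w B"
    unfolding eventually_unitary_nhds using eq by (intro exI[of _ 1]) auto
  ultimately show "(matrix_coeff u w \<longlongrightarrow> matrix_coeff u w A) (unitary_nhds n A)"
    using eq[OF A] by (simp add: tendsto_cong)
qed

lemma cmod_pow_mat_entry:
  fixes X :: "complex mat"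
  assumes X: "X \<in> carrier_mat n n" and "i < n" "j < n"
  shows "cmod ((X ^\<^sub>m k) $$ (i, j)) \<le> (\<Sum>a<n. \<Sum>b<n. cmod (X $$ (a, b))) ^ k"
  using assms(2,3)
proof (induction k arbitrary: i j)
  case 0
  then show ?case using X by simp
next
  case (Suc k)
  let ?M = "\<Sum>a<n. \<Sum>b<n. cmod (X $$ (a, b))"
  have M: "0 \<le> ?M" by (intro sum_nonneg) auto
  have "(X ^\<^sub>m Suc k) $$ (i, j) = (\<Sum>l<n. (X ^\<^sub>m k) $$ (i, l) * X $$ (l, j))"
    unfolding pow_mat.simps by (rule index_mult_mat_sum) (use X Suc.prems in auto)
  also have "cmod \<dots> \<le> (\<Sum>l<n. ?M ^ k * cmod (X $$ (l, j)))"
    using Suc by (intro order_trans[OF norm_sum] sum_mono) (auto simp: norm_mult intro!: mult_right_mono)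
  also have "\<dots> = ?M ^ k * (\<Sum>l<n. cmod (X $$ (l, j)))" by (simp add: sum_distrib_left)
  also have "\<dots> \<le> ?M ^ k * ?M"
    using Suc.prems M by (intro mult_left_mono sum_mono member_le_sum) auto
  finally show ?case by (simp add: mult.commute)
qed

lemma pow_smult_mat:
  fixes X :: "complex mat"
  assumes X: "X \<in> carrier_mat n n"
  shows "(c \<cdot>\<^sub>m X) ^\<^sub>m k = c ^ k \<cdot>\<^sub>m (X ^\<^sub>m k)"
proof (induction k)
  case 0
  then show ?case using X by (intro eq_matI) auto
next
  case (Suc k)
  have Xk: "X ^\<^sub>m k \<in> carrier_mat n n" using X by simp
  have "(c \<cdot>\<^sub>m X) ^\<^sub>m Suc k = (c ^ k \<cdot>\<^sub>m (X ^\<^sub>m k)) * (c \<cdot>\<^sub>m X)" by (simp add: Suc)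
  also have "\<dots> = c ^ k \<cdot>\<^sub>m (c \<cdot>\<^sub>m (X ^\<^sub>m k * X))"
    using X Xk mult_smult_distrib[OF Xk X] mult_smult_assoc_mat[OF Xk, of "c \<cdot>\<^sub>m X" n "c ^ k"] by simp
  also have "\<dots> = c ^ Suc k \<cdot>\<^sub>m (X ^\<^sub>m Suc k)"
    using X by (intro eq_matI) (auto simp: algebra_simps)
  finally show ?case .
qed

lemma mat_exp_carrier: "X \<in> carrier_mat n n \<Longrightarrow> mat_exp X \<in> carrier_mat n n"
  by (auto simp: mat_exp_def)

text \<open>The entries of \<open>exp (z X)\<close> are power series in \<open>z\<close> that converge everywhere, with constant
  coefficient the entry of the identity and linear coefficient the entry of \<open>X\<close>.\<close>

lemma mat_exp_entry:
  assumes X: "X \<in> carrier_mat n n" and ij: "i < n" "j < n"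
  shows "mat_exp (0 \<cdot>\<^sub>m X) $$ (i, j) = 1\<^sub>m n $$ (i, j)"
    and "((\<lambda>z. mat_exp (z \<cdot>\<^sub>m X) $$ (i, j)) has_field_derivative X $$ (i, j)) (at 0)"
proof -
  define c where "c k = (X ^\<^sub>m k) $$ (i, j) / fact k" for k
  let ?M = "\<Sum>a<n. \<Sum>b<n. cmod (X $$ (a, b))"
  have e: "mat_exp (z \<cdot>\<^sub>m X) $$ (i, j) = suminf (\<lambda>k. c k * z ^ k)" for z
    using X ij by (simp add: mat_exp_def pow_smult_mat[OF X] c_def mult.commute)
  have sm: "summable (\<lambda>k. c k * z ^ k)" for z
  proof (rule summable_comparison_test'[where N = 0])
    show "summable (\<lambda>k. inverse (fact k) * (?M * cmod z) ^ k)" by (rule summable_exp)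
    fix k
    show "norm (c k * z ^ k) \<le> inverse (fact k) * (?M * cmod z) ^ k"
      using cmod_pow_mat_entry[OF X ij, of k]
      by (simp add: c_def norm_mult norm_divide norm_power power_mult_distrib divide_simps mult_right_mono)
  qed
  have "suminf (\<lambda>k. c k * 0 ^ k) = c 0" by (rule powser_zero)
  then show "mat_exp (0 \<cdot>\<^sub>m X) $$ (i, j) = 1\<^sub>m n $$ (i, j)" unfolding e using X by (simp add: c_def)
  have "((\<lambda>z. suminf (\<lambda>k. c k * z ^ k)) has_field_derivative suminf (\<lambda>k. diffs c k * 0 ^ k)) (at 0)"
    by (rule termdiffs_strong_converges_everywhere[OF sm])
  moreover have "suminf (\<lambda>k. diffs c k * 0 ^ k) = X $$ (i, j)"
    using X by (subst powser_zero) (simp add: diffs_def c_def)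
  ultimately show "((\<lambda>z. mat_exp (z \<cdot>\<^sub>m X) $$ (i, j)) has_field_derivative X $$ (i, j)) (at 0)"
    unfolding e by simp
qed

lemma lie_curve_carrier:
  "X \<in> carrier_mat n n \<Longrightarrow> B \<in> carrier_mat n n \<Longrightarrow> lie_curve B X t \<in> carrier_mat n n"
  using mat_exp_carrier[of "complex_of_real t \<cdot>\<^sub>m X" n] by simp

lemma lie_curve_zero:
  assumes "X \<in> carrier_mat n n" "B \<in> carrier_mat n n"
  shows "lie_curve B X 0 = B"
proof -
  have "mat_exp (0 \<cdot>\<^sub>m X) = 1\<^sub>m n"
    using mat_exp_entry(1)[OF assms(1)] mat_exp_carrier[of "0 \<cdot>\<^sub>m X" n] assms(1) by (intro eq_matI) auto
  then show ?thesis using assms by simp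
qed

text \<open>A left-invariant derivative of a matrix coefficient is again a matrix coefficient. The curve is
  differentiated at every matrix \<open>B\<close>, unitary or not, so that derivatives can be iterated without
  knowing that the curve stays in the group.\<close>

lemma matrix_coeff_lie_curve_deriv:
  assumes X: "X \<in> carrier_mat n n" and B: "B \<in> carrier_mat n n" and u: "u \<in> carrier_vec n"
  shows "((\<lambda>t. matrix_coeff u w (lie_curve B X t)) has_field_derivative matrix_coeff (X *\<^sub>v u) w B) (at 0)"
proof -
  define \<Phi> where "\<Phi> z = (\<Sum>i<n. \<Sum>l<n. B $$ (i, l) * (\<Sum>m<n. mat_exp (z \<cdot>\<^sub>m X) $$ (l, m) * vec_index u m) * cnj (vec_index w i))" for z
  define D where "D = (\<Sum>i<n. \<Sum>l<n. B $$ (i, l) * (\<Sum>m<n. X $$ (l, m) * vec_index u m) * cnj (vec_index w i))"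
  have coeff: "cip (B * E *\<^sub>v u) w = (\<Sum>i<n. \<Sum>l<n. B $$ (i, l) * (\<Sum>m<n. E $$ (l, m) * vec_index u m) * cnj (vec_index w i))"
    if E: "E \<in> carrier_mat n n" for E
  proof -
    have "cip (B * E *\<^sub>v u) w = cip (B *\<^sub>v (E *\<^sub>v u)) w" using assoc_mult_mat_vec[OF B E u] by simp
    also have "\<dots> = (\<Sum>i<n. \<Sum>l<n. B $$ (i, l) * (\<Sum>m<n. E $$ (l, m) * vec_index u m) * cnj (vec_index w i))"
      using E u by (subst cip_mult_vec_sum[OF B]) (auto simp: index_mult_vec_sum[OF E u] simp del: index_mult_mat_vec)
    finally show ?thesis .
  qed
  have "(\<Phi> has_field_derivative D) (at (of_real 0))"
    unfolding \<Phi>_def D_def of_real_0 using mat_exp_entry(2)[OF X]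
    by (intro DERIV_sum DERIV_cmult_right DERIV_cmult) auto
  then have "((\<lambda>t. \<Phi> (of_real t)) has_vector_derivative D) (at 0)"
    by (rule has_vector_derivative_real_field)
  then have "((\<lambda>t. Re (\<Phi> (of_real t))) has_vector_derivative Re D) (at 0)"
    by (rule bounded_linear.has_vector_derivative[OF bounded_linear_Re])
  then have "((\<lambda>t. Re (\<Phi> (of_real t))) has_field_derivative Re D) (at 0)"
    by (simp add: has_real_derivative_iff_has_vector_derivative)
  moreover have "matrix_coeff u w (lie_curve B X t) = Re (\<Phi> (of_real t))" for t
    unfolding matrix_coeff_def \<Phi>_def using X by (subst coeff) (auto intro: mat_exp_carrier)
  moreover have "matrix_coeff (X *\<^sub>v u) w B = Re D"
    unfolding matrix_coeff_def D_def coeff[OF X, symmetric] using assoc_mult_mat_vec[OF B X u] by simp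
  ultimately show ?thesis by simp
qed

lemma lie_deriv_unique:
  "((\<lambda>t. f (lie_curve B X t)) has_field_derivative d) (at 0) \<Longrightarrow> lie_deriv X f B = d"
  unfolding lie_deriv_def by (rule DERIV_imp_deriv)

lemma unitary_lie_carrier: "X \<in> unitary_lie n \<Longrightarrow> X \<in> carrier_mat n n"
  by (simp add: unitary_lie_def)

lemma C1_unitaryI:
  assumes "continuous_on_unitary n f"
    and "\<And>X. X \<in> unitary_lie n \<Longrightarrow> continuous_on_unitary n (f' X)"
    and "\<And>X B. X \<in> unitary_lie n \<Longrightarrow> B \<in> carrier_mat n n \<Longrightarrow>
      ((\<lambda>t. f (lie_curve B X t)) has_field_derivative f' X B) (at 0)"
  shows "C1_unitary n f"
  unfolding C1_unitary_def
proof (intro conjI ballI)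
  fix X assume X: "X \<in> unitary_lie n"
  show "(\<lambda>t. f (lie_curve A X t)) field_differentiable (at 0)" if "A \<in> unitary_group n" for A
    using assms(3)[OF X unitary_group_carrier[OF that]] by (auto simp: field_differentiable_def)
  have "continuous_on_unitary n (lie_deriv X f) \<longleftrightarrow> continuous_on_unitary n (f' X)"
    by (intro continuous_on_unitary_cong lie_deriv_unique assms(3) X unitary_group_carrier)
  then show "continuous_on_unitary n (lie_deriv X f)" using assms(2)[OF X] by simp
qed (fact assms(1))

context
  fixes n :: nat and u w :: "complex Matrix.vec" and a :: real
  assumes u: "u \<in> carrier_vec n"
begin

text \<open>The primed functions are closed forms of the left-invariant derivatives of the first one, along \<open>X\<close>
  and then along \<open>Y\<close>.\<close>

definition exp_coeff :: "complex mat \<Rightarrow> real" where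
  "exp_coeff B = exp (a * matrix_coeff u w B)"

definition exp_coeff' :: "complex mat \<Rightarrow> complex mat \<Rightarrow> real" where
  "exp_coeff' X B = a * matrix_coeff (X *\<^sub>v u) w B * exp_coeff B"

definition exp_coeff'' :: "complex mat \<Rightarrow> complex mat \<Rightarrow> complex mat \<Rightarrow> real" where
  "exp_coeff'' X Y B = (a * matrix_coeff (Y *\<^sub>v (X *\<^sub>v u)) w B +
     a\<^sup>2 * matrix_coeff (X *\<^sub>v u) w B * matrix_coeff (Y *\<^sub>v u) w B) * exp_coeff B"

lemma exp_coeff_deriv:
  assumes "X \<in> carrier_mat n n" "B \<in> carrier_mat n n"
  shows "((\<lambda>t. exp_coeff (lie_curve B X t)) has_field_derivative exp_coeff' X B) (at 0)"
  unfolding exp_coeff_def exp_coeff'_def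
  by (rule derivative_eq_intros matrix_coeff_lie_curve_deriv[OF assms u] refl)+
     (use lie_curve_zero[OF assms] in simp)

lemma exp_coeff'_deriv:
  assumes X: "X \<in> carrier_mat n n" and Y: "Y \<in> carrier_mat n n" and B: "B \<in> carrier_mat n n"
  shows "((\<lambda>t. exp_coeff' X (lie_curve B Y t)) has_field_derivative exp_coeff'' X Y B) (at 0)"
proof -
  have Xu: "X *\<^sub>v u \<in> carrier_vec n" using X by simp
  show ?thesis
    unfolding exp_coeff'_def exp_coeff''_def
    by (rule DERIV_cong[OF DERIV_mult[OF DERIV_cmult[OF matrix_coeff_lie_curve_deriv[OF Y B Xu]] exp_coeff_deriv[OF Y B]]])
       (use lie_curve_zero[OF Y B] in \<open>simp add: exp_coeff'_def power2_eq_square algebra_simps\<close>)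
qed

lemma exp_coeff_continuous:
  "continuous_on_unitary n exp_coeff"
  "X \<in> carrier_mat n n \<Longrightarrow> continuous_on_unitary n (exp_coeff' X)"
  "X \<in> carrier_mat n n \<Longrightarrow> Y \<in> carrier_mat n n \<Longrightarrow> continuous_on_unitary n (exp_coeff'' X Y)"
  unfolding exp_coeff_def exp_coeff'_def exp_coeff''_def
  using u by (intro continuous_on_unitary_exp continuous_on_unitary_mult continuous_on_unitary_add
    continuous_on_unitary_const continuous_on_unitary_matrix_coeff; simp)+

lemma C2_exp_coeff: "C2_unitary n exp_coeff"
  unfolding C2_unitary_def
proof (intro conjI ballI)
  show "C1_unitary n exp_coeff"
    by (rule C1_unitaryI[where f' = exp_coeff']) (auto intro!: exp_coeff_continuous exp_coeff_deriv dest: unitary_lie_carrier)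
  fix X assume "X \<in> unitary_lie n"
  then have X: "X \<in> carrier_mat n n" by (rule unitary_lie_carrier)
  have eq: "lie_deriv X exp_coeff B = exp_coeff' X B" if "B \<in> carrier_mat n n" for B
    by (intro lie_deriv_unique exp_coeff_deriv X that)
  show "C1_unitary n (lie_deriv X exp_coeff)"
  proof (rule C1_unitaryI[where f' = "exp_coeff'' X"])
    show "continuous_on_unitary n (lie_deriv X exp_coeff)"
      using continuous_on_unitary_cong[OF eq[OF unitary_group_carrier]] exp_coeff_continuous(2)[OF X] by simp
    fix Y assume "Y \<in> unitary_lie n"
    then have Y: "Y \<in> carrier_mat n n" by (rule unitary_lie_carrier)
    show "continuous_on_unitary n (exp_coeff'' X Y)" by (rule exp_coeff_continuous(3)[OF X Y])
    fix B :: "complex mat" assume B: "B \<in> carrier_mat n n"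
    show "((\<lambda>t. lie_deriv X exp_coeff (lie_curve B Y t)) has_field_derivative exp_coeff'' X Y B) (at 0)"
      using exp_coeff'_deriv[OF X Y B] by (simp add: eq[OF lie_curve_carrier[OF Y B]])
  qed
qed

lemma lie_deriv2_exp_coeff:
  assumes X: "X \<in> carrier_mat n n" and B: "B \<in> carrier_mat n n"
  shows "lie_deriv X (lie_deriv X exp_coeff) B = exp_coeff'' X X B"
proof (rule lie_deriv_unique)
  have eq: "lie_deriv X exp_coeff B = exp_coeff' X B" if "B \<in> carrier_mat n n" for B
    by (intro lie_deriv_unique exp_coeff_deriv X that)
  show "((\<lambda>t. lie_deriv X exp_coeff (lie_curve B X t)) has_field_derivative exp_coeff'' X X B) (at 0)"
    using exp_coeff'_deriv[OF X X B] by (simp add: eq[OF lie_curve_carrier[OF X B]])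
qed

end

section \<open>The Laplacian of an exponential matrix coefficient\<close>

abbreviation idx :: "nat \<Rightarrow> (nat \<times> nat) set" where "idx n \<equiv> {..<n} \<times> {..<n}"

lemma Re_of_real_mult: "Re (complex_of_real r * z) = r * Re z"
  by simp

lemma mat_trace_mult_sum:
  assumes "X \<in> carrier_mat n n" "Y \<in> carrier_mat n n"
  shows "mat_trace (X * Y) = (\<Sum>(i, j)\<in>idx n. X $$ (i, j) * Y $$ (j, i))"
  using assms by (simp add: mat_trace_def index_mult_mat_sum[of X n n Y n] sum.cartesian_product del: index_mult_mat(1))

lemma unitary_lie_entry:
  assumes "X \<in> unitary_lie n" "i < n" "j < n"
  shows "cnj (X $$ (i, j)) = - X $$ (j, i)"
proof -
  have X: "X \<in> carrier_mat n n" "mat_adjoint X = - X" using assms by (auto simp: unitary_lie_def)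
  have "mat_adjoint X $$ (j, i) = - X $$ (j, i)" using X assms(2,3) by simp
  then show ?thesis using X(1) assms(2,3) mat_adjoint_index[of j X i] by simp
qed

lemma lie_inner_sum:
  assumes X: "X \<in> unitary_lie n" and Y: "Y \<in> unitary_lie n"
  shows "lie_inner n X Y = real n * Re (\<Sum>p\<in>idx n. X $$ p * cnj (Y $$ p))"
proof -
  have "mat_trace (X * Y) = (\<Sum>p\<in>idx n. - (X $$ p * cnj (Y $$ p)))"
    unfolding mat_trace_mult_sum[OF unitary_lie_carrier[OF X] unitary_lie_carrier[OF Y]]
    using unitary_lie_entry[OF Y] by (intro sum.cong) auto
  then show ?thesis by (simp add: lie_inner_def sum_negf algebra_simps)
qed

definition lie_orthonormal :: "nat \<Rightarrow> complex mat set \<Rightarrow> bool" where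
  "lie_orthonormal n \<beta> \<longleftrightarrow> finite \<beta> \<and> \<beta> \<subseteq> unitary_lie n \<and>
     (\<forall>X\<in>\<beta>. \<forall>Y\<in>\<beta>. lie_inner n X Y = (if X = Y then 1 else 0))"

text \<open>Bessel's inequality for the real Frobenius inner product: expand the square norm of
  \<open>z - n \<Sum>\<^sub>X \<langle>X, z\<rangle> X\<close>, where the factor \<open>n\<close> compensates that \<open>X\<close> has Frobenius norm \<open>1 / sqrt n\<close>.\<close>

lemma lie_bessel_real:
  assumes \<beta>: "lie_orthonormal n \<beta>" and n: "n \<ge> 1"
  shows "(\<Sum>X\<in>\<beta>. (Re (\<Sum>p\<in>idx n. X $$ p * cnj (z p)))\<^sup>2) \<le> (\<Sum>p\<in>idx n. (cmod (z p))\<^sup>2) / real n"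
proof -
  define a where "a X = Re (\<Sum>p\<in>idx n. X $$ p * cnj (z p))" for X
  define y where "y p = (\<Sum>X\<in>\<beta>. complex_of_real (a X) * X $$ p)" for p
  define S where "S = (\<Sum>X\<in>\<beta>. (a X)\<^sup>2)"
  have fin: "finite \<beta>" and sub: "\<beta> \<subseteq> unitary_lie n" using \<beta> by (auto simp: lie_orthonormal_def)
  have yz: "Re (\<Sum>p\<in>idx n. y p * cnj (z p)) = S"
  proof -
    have "(\<Sum>p\<in>idx n. y p * cnj (z p)) = (\<Sum>p\<in>idx n. \<Sum>X\<in>\<beta>. of_real (a X) * (X $$ p * cnj (z p)))"
      by (simp add: y_def sum_distrib_right mult.assoc)
    also have "\<dots> = (\<Sum>X\<in>\<beta>. of_real (a X) * (\<Sum>p\<in>idx n. X $$ p * cnj (z p)))"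
      by (subst sum.swap) (simp add: sum_distrib_left)
    also have "Re \<dots> = (\<Sum>X\<in>\<beta>. a X * Re (\<Sum>p\<in>idx n. X $$ p * cnj (z p)))"
      by (simp only: Re_sum Re_complex_of_real Re_of_real_mult)
    also have "\<dots> = S" unfolding S_def a_def by (simp only: power2_eq_square)
    finally show ?thesis .
  qed
  have orth: "Re (\<Sum>p\<in>idx n. X $$ p * cnj (Y $$ p)) = (if X = Y then 1 / real n else 0)" if "X \<in> \<beta>" "Y \<in> \<beta>" for X Y
  proof -
    have "real n * Re (\<Sum>p\<in>idx n. X $$ p * cnj (Y $$ p)) = (if X = Y then 1 else 0)"
      using lie_inner_sum[OF subsetD[OF sub that(1)] subsetD[OF sub that(2)]] \<beta> that
      unfolding lie_orthonormal_def by simp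
    moreover have "t = (if X = Y then 1 / real n else 0)" if "real n * t = (if X = Y then 1 else 0)" for t
      using that n by (auto simp: field_simps split: if_splits)
    ultimately show ?thesis by blast
  qed
  have yy: "(\<Sum>p\<in>idx n. (cmod (y p))\<^sup>2) = S / real n"
  proof -
    have "(\<Sum>p\<in>idx n. (cmod (y p))\<^sup>2) = Re (\<Sum>p\<in>idx n. y p * cnj (y p))"
      by (simp add: complex_norm_square[symmetric] del: of_real_power)
    also have "(\<Sum>p\<in>idx n. y p * cnj (y p)) = (\<Sum>p\<in>idx n. \<Sum>X\<in>\<beta>. \<Sum>Y\<in>\<beta>. of_real (a X * a Y) * (X $$ p * cnj (Y $$ p)))"
      by (simp add: y_def sum_product mult_ac)
    also have "\<dots> = (\<Sum>X\<in>\<beta>. \<Sum>Y\<in>\<beta>. of_real (a X * a Y) * (\<Sum>p\<in>idx n. X $$ p * cnj (Y $$ p)))"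
      by (subst sum.swap) (intro sum.cong refl, subst sum.swap, simp only: sum_distrib_left)
    also have "Re \<dots> = (\<Sum>X\<in>\<beta>. \<Sum>Y\<in>\<beta>. a X * a Y * Re (\<Sum>p\<in>idx n. X $$ p * cnj (Y $$ p)))"
      by (simp only: Re_sum Re_of_real_mult)
    also have "\<dots> = (\<Sum>X\<in>\<beta>. \<Sum>Y\<in>\<beta>. if Y = X then a X * a Y / real n else 0)"
      by (intro sum.cong refl) (simp only: orth split: if_split, auto)
    also have "\<dots> = S / real n" using fin by (simp add: S_def power2_eq_square sum_divide_distrib)
    finally show ?thesis .
  qed
  have "0 \<le> (\<Sum>p\<in>idx n. (cmod (z p - of_real (real n) * y p))\<^sup>2)" by (intro sum_nonneg) auto
  also have "\<dots> = (\<Sum>p\<in>idx n. (cmod (z p))\<^sup>2 - 2 * real n * Re (y p * cnj (z p)) + (real n)\<^sup>2 * (cmod (y p))\<^sup>2)"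
    by (intro sum.cong refl) (simp only: cmod_power2, simp add: power2_eq_square algebra_simps)
  also have "\<dots> = (\<Sum>p\<in>idx n. (cmod (z p))\<^sup>2) - 2 * real n * Re (\<Sum>p\<in>idx n. y p * cnj (z p)) +
      (real n)\<^sup>2 * (\<Sum>p\<in>idx n. (cmod (y p))\<^sup>2)"
    by (simp only: sum.distrib sum_subtractf sum_distrib_left Re_sum)
  also have "\<dots> = (\<Sum>p\<in>idx n. (cmod (z p))\<^sup>2) - 2 * real n * S + (real n)\<^sup>2 * (S / real n)"
    by (simp only: yz yy)
  also have "\<dots> = (\<Sum>p\<in>idx n. (cmod (z p))\<^sup>2) - real n * S"
    using n by (simp add: power2_eq_square field_simps)
  finally have "real n * S \<le> (\<Sum>p\<in>idx n. (cmod (z p))\<^sup>2)" by simp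
  then show ?thesis using n by (simp add: S_def a_def field_simps)
qed

text \<open>The imaginary part of the complex inner product with \<open>z\<close> is the real part of that with \<open>\<i> z\<close>.\<close>

lemma lie_bessel:
  assumes \<beta>: "lie_orthonormal n \<beta>" and n: "n \<ge> 1"
  shows "(\<Sum>X\<in>\<beta>. (cmod (\<Sum>p\<in>idx n. X $$ p * cnj (z p)))\<^sup>2) \<le> 2 * (\<Sum>p\<in>idx n. (cmod (z p))\<^sup>2) / real n"
proof -
  have im: "Im (\<Sum>p\<in>idx n. X $$ p * cnj (z p)) = Re (\<Sum>p\<in>idx n. X $$ p * cnj (\<i> * z p))" for X :: "complex mat"
    by (simp add: algebra_simps)
  have "(\<Sum>X\<in>\<beta>. (cmod (\<Sum>p\<in>idx n. X $$ p * cnj (z p)))\<^sup>2) =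
      (\<Sum>X\<in>\<beta>. (Re (\<Sum>p\<in>idx n. X $$ p * cnj (z p)))\<^sup>2) + (\<Sum>X\<in>\<beta>. (Re (\<Sum>p\<in>idx n. X $$ p * cnj (\<i> * z p)))\<^sup>2)"
    unfolding im[symmetric] sum.distrib[symmetric] by (simp only: cmod_power2)
  also have "\<dots> \<le> (\<Sum>p\<in>idx n. (cmod (z p))\<^sup>2) / real n + (\<Sum>p\<in>idx n. (cmod (\<i> * z p))\<^sup>2) / real n"
    by (intro add_mono lie_bessel_real[OF \<beta> n])
  also have "\<dots> = 2 * (\<Sum>p\<in>idx n. (cmod (z p))\<^sup>2) / real n"
    by (simp add: norm_mult)
  finally show ?thesis .
qed

text \<open>Each \<open>X\<close> contributes \<open>1 / n\<close> to the sum of all squared entries, while Bessel's inequality bounds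
  the contribution of each of the \<open>n\<^sup>2\<close> positions by \<open>2 / n\<close>.\<close>

lemma lie_orthonormal_card:
  assumes \<beta>: "lie_orthonormal n \<beta>" and n: "n \<ge> 1"
  shows "card \<beta> \<le> 2 * n * n"
proof -
  have fin: "finite \<beta>" and sub: "\<beta> \<subseteq> unitary_lie n" using \<beta> by (auto simp: lie_orthonormal_def)
  have one: "(\<Sum>p\<in>idx n. (cmod (X $$ p))\<^sup>2) = 1 / real n" if "X \<in> \<beta>" for X
  proof -
    have "1 = lie_inner n X X" using \<beta> that by (simp add: lie_orthonormal_def)
    also have "\<dots> = real n * (\<Sum>p\<in>idx n. (cmod (X $$ p))\<^sup>2)"
      using lie_inner_sum[of X n X] that sub by (auto simp: complex_norm_square[symmetric] simp del: of_real_power)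
    finally show ?thesis using n by (simp add: field_simps)
  qed
  have ent: "(\<Sum>X\<in>\<beta>. (cmod (X $$ q))\<^sup>2) \<le> 2 / real n" if q: "q \<in> idx n" for q
  proof -
    let ?z = "\<lambda>p. if p = q then 1 else 0 :: complex"
    have "(\<Sum>p\<in>idx n. X $$ p * cnj (?z p)) = X $$ q" for X :: "complex mat"
    proof -
      have "(\<Sum>p\<in>idx n. X $$ p * cnj (?z p)) = (\<Sum>p\<in>idx n. if p = q then X $$ p else 0)" by (intro sum.cong) auto
      also have "\<dots> = X $$ q" using q by (subst sum.delta) auto
      finally show ?thesis .
    qed
    moreover have "(\<Sum>p\<in>idx n. (cmod (?z p))\<^sup>2) = 1"
    proof -
      have "(\<Sum>p\<in>idx n. (cmod (?z p))\<^sup>2) = (\<Sum>p\<in>idx n. if p = q then 1 else 0)" by (intro sum.cong) auto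
      also have "\<dots> = 1" using q by (subst sum.delta) auto
      finally show ?thesis .
    qed
    ultimately show ?thesis using lie_bessel[OF \<beta> n, of ?z] by simp
  qed
  have "real (card \<beta>) / real n = (\<Sum>X\<in>\<beta>. \<Sum>p\<in>idx n. (cmod (X $$ p))\<^sup>2)" using one by simp
  also have "\<dots> = (\<Sum>p\<in>idx n. \<Sum>X\<in>\<beta>. (cmod (X $$ p))\<^sup>2)" by (rule sum.swap)
  also have "\<dots> \<le> (\<Sum>p\<in>idx n. 2 / real n)" by (intro sum_mono ent)
  also have "\<dots> = 2 * real n" using n by (simp add: card_cartesian_product)
  finally have "real (card \<beta>) \<le> real (2 * n * n)" using n by (simp add: field_simps)
  then show ?thesis by linarith
qed

text \<open>Orthonormal sets have bounded size. One of maximal size spans, since otherwise the normalized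
  remainder \<open>R\<close> of some \<open>X\<close> after orthogonal projection could be added. Existence matters because the
  Laplacian is defined by choosing some orthonormal basis.\<close>

lemma lie_onb_exists:
  assumes n: "n \<ge> 1"
  shows "\<exists>\<beta>. lie_onb n \<beta>"
proof -
  define K where "K = card ` {\<beta>. lie_orthonormal n \<beta>}"
  have finK: "finite K" by (rule finite_subset[of _ "{..2 * n * n}"]) (auto simp: K_def lie_orthonormal_card[OF _ n])
  have "lie_orthonormal n {}" by (simp add: lie_orthonormal_def)
  then have "K \<noteq> {}" by (auto simp: K_def)
  then have "Max K \<in> K" using finK by simp
  then obtain \<beta> where \<beta>: "lie_orthonormal n \<beta>" "card \<beta> = Max K" by (auto simp: K_def)
  have fin: "finite \<beta>" and sub: "\<beta> \<subseteq> unitary_lie n"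
    and orth: "\<And>X Y. X \<in> \<beta> \<Longrightarrow> Y \<in> \<beta> \<Longrightarrow> lie_inner n X Y = (if X = Y then 1 else 0)"
    using \<beta> by (auto simp: lie_orthonormal_def)
  have sym: "lie_inner n X Y = lie_inner n Y X" if "X \<in> unitary_lie n" "Y \<in> unitary_lie n" for X Y
    unfolding lie_inner_def using mat_trace_mult_commute[of X n n Y] that by (simp add: unitary_lie_carrier)
  have span: "\<exists>c :: complex mat \<Rightarrow> real. \<forall>i<n. \<forall>j<n. X $$ (i, j) = (\<Sum>B\<in>\<beta>. complex_of_real (c B) * B $$ (i, j))"
    if X: "X \<in> unitary_lie n" for X
  proof -
    define c where "c B = lie_inner n X B" for B
    define r where "r p = X $$ p - (\<Sum>B\<in>\<beta>. complex_of_real (c B) * B $$ p)" for p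
    have rskew: "cnj (r (i, j)) = - r (j, i)" if "i < n" "j < n" for i j
    proof -
      have "cnj (r (i, j)) = cnj (X $$ (i, j)) - (\<Sum>B\<in>\<beta>. of_real (c B) * cnj (B $$ (i, j)))" by (simp add: r_def)
      also have "(\<Sum>B\<in>\<beta>. of_real (c B) * cnj (B $$ (i, j))) = (\<Sum>B\<in>\<beta>. of_real (c B) * - B $$ (j, i))"
        using unitary_lie_entry[of _ n i j] that sub by (intro sum.cong) auto
      finally show ?thesis using unitary_lie_entry[OF X that] by (simp add: r_def sum_negf)
    qed
    define s where "s = (\<Sum>p\<in>idx n. (cmod (r p))\<^sup>2)"
    have "s = 0"
    proof (rule ccontr)
      assume "s \<noteq> 0"
      then have s: "s > 0" unfolding s_def by (metis (no_types, lifting) order_le_less sum_nonneg zero_le_power2)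
      define R where "R = mat n n (\<lambda>p. complex_of_real (1 / sqrt (n * s)) * r p)"
      have R: "R \<in> unitary_lie n"
        using rskew by (auto simp: unitary_lie_def R_def mat_adjoint_index intro!: eq_matI)
      have RB: "lie_inner n R B = 0" if "B \<in> \<beta>" for B
      proof -
        have B: "B \<in> unitary_lie n" using that sub by auto
        have "(\<Sum>p\<in>idx n. r p * cnj (B $$ p)) = (\<Sum>p\<in>idx n. X $$ p * cnj (B $$ p)) - (\<Sum>p\<in>idx n. \<Sum>Y\<in>\<beta>. of_real (c Y) * (Y $$ p * cnj (B $$ p)))"
          by (simp add: r_def left_diff_distrib sum_subtractf sum_distrib_right mult.assoc)
        also have "(\<Sum>p\<in>idx n. \<Sum>Y\<in>\<beta>. of_real (c Y) * (Y $$ p * cnj (B $$ p))) = (\<Sum>Y\<in>\<beta>. of_real (c Y) * (\<Sum>p\<in>idx n. Y $$ p * cnj (B $$ p)))"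
          by (subst sum.swap) (simp only: sum_distrib_left)
        finally have "Re (\<Sum>p\<in>idx n. r p * cnj (B $$ p)) = Re (\<Sum>p\<in>idx n. X $$ p * cnj (B $$ p)) -
            (\<Sum>Y\<in>\<beta>. c Y * Re (\<Sum>p\<in>idx n. Y $$ p * cnj (B $$ p)))"
          by (simp only: minus_complex.sel Re_sum[of _ \<beta>] Re_of_real_mult)
        then have "real n * Re (\<Sum>p\<in>idx n. r p * cnj (B $$ p)) =
            real n * Re (\<Sum>p\<in>idx n. X $$ p * cnj (B $$ p)) - (\<Sum>Y\<in>\<beta>. c Y * (real n * Re (\<Sum>p\<in>idx n. Y $$ p * cnj (B $$ p))))"
          by (simp only: right_diff_distrib sum_distrib_left[where A = \<beta>] mult.left_commute)
        also have "\<dots> = lie_inner n X B - (\<Sum>Y\<in>\<beta>. c Y * lie_inner n Y B)"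
          using lie_inner_sum[OF X B] lie_inner_sum[OF _ B] sub by (simp add: subset_iff)
        also have "(\<Sum>Y\<in>\<beta>. c Y * lie_inner n Y B) = (\<Sum>Y\<in>\<beta>. if Y = B then c Y else 0)"
          using that by (intro sum.cong) (auto simp: orth)
        also have "\<dots> = lie_inner n X B" using fin that by (simp add: c_def)
        finally have zero: "real n * Re (\<Sum>p\<in>idx n. r p * cnj (B $$ p)) = 0" by simp
        have "(\<Sum>p\<in>idx n. R $$ p * cnj (B $$ p)) = of_real (1 / sqrt (n * s)) * (\<Sum>p\<in>idx n. r p * cnj (B $$ p))"
          unfolding sum_distrib_left by (intro sum.cong) (auto simp: R_def mult.assoc)
        then have "lie_inner n R B = (1 / sqrt (n * s)) * (real n * Re (\<Sum>p\<in>idx n. r p * cnj (B $$ p)))"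
          unfolding lie_inner_sum[OF R B] by (simp only: Re_of_real_mult mult.left_commute)
        then show ?thesis using zero by simp
      qed
      have RR: "lie_inner n R R = 1"
      proof -
        have "(\<Sum>p\<in>idx n. R $$ p * cnj (R $$ p)) = (\<Sum>p\<in>idx n. of_real ((1 / sqrt (n * s))\<^sup>2 * (cmod (r p))\<^sup>2))"
        proof (intro sum.cong refl)
          fix p assume "p \<in> idx n"
          then have Rp: "R $$ p = complex_of_real (1 / sqrt (n * s)) * r p" by (auto simp: R_def)
          have "cmod (R $$ p) = \<bar>1 / sqrt (n * s)\<bar> * cmod (r p)" unfolding Rp norm_mult norm_of_real ..
          then have "(cmod (R $$ p))\<^sup>2 = (1 / sqrt (n * s))\<^sup>2 * (cmod (r p))\<^sup>2"
            by (simp only: power_mult_distrib power2_abs)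
          then show "R $$ p * cnj (R $$ p) = of_real ((1 / sqrt (n * s))\<^sup>2 * (cmod (r p))\<^sup>2)"
            by (simp only: complex_norm_square[symmetric])
        qed
        then have "lie_inner n R R = real n * ((1 / sqrt (n * s))\<^sup>2 * s)"
          unfolding lie_inner_sum[OF R R] s_def
          by (simp only: Re_sum Re_complex_of_real sum_distrib_left)
        then show ?thesis using s n by (simp add: power_divide)
      qed
      have "R \<notin> \<beta>" using RB RR by force
      have BR: "lie_inner n B R = 0" if "B \<in> \<beta>" for B using sym[OF R, of B] RB[OF that] that sub by auto
      have "lie_orthonormal n (insert R \<beta>)"
        unfolding lie_orthonormal_def
      proof (intro conjI ballI)
        show "finite (insert R \<beta>)" "insert R \<beta> \<subseteq> unitary_lie n" using fin sub R by auto
        fix Y Z assume "Y \<in> insert R \<beta>" "Z \<in> insert R \<beta>"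
        then show "lie_inner n Y Z = (if Y = Z then 1 else 0)"
          using RB BR RR orth \<open>R \<notin> \<beta>\<close> by auto
      qed
      then have "card (insert R \<beta>) \<in> K" by (auto simp: K_def)
      then have "card (insert R \<beta>) \<le> Max K" using finK by simp
      then show False using \<beta>(2) \<open>R \<notin> \<beta>\<close> fin by simp
    qed
    then have "r p = 0" if "p \<in> idx n" for p
      using that unfolding s_def by (subst (asm) sum_nonneg_eq_0_iff) auto
    then have "\<forall>i<n. \<forall>j<n. X $$ (i, j) = (\<Sum>B\<in>\<beta>. complex_of_real (c B) * B $$ (i, j))" by (auto simp: r_def)
    then show ?thesis by blast
  qed
  have "lie_onb n \<beta>"
    unfolding lie_onb_def by (intro conjI ballI fin sub orth span)
  then show ?thesis by blast
qed

definition lie_basis :: "nat \<Rightarrow> complex mat set" where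
  "lie_basis n = (SOME \<beta>. lie_onb n \<beta>)"

lemma lie_basis_orthonormal: "n \<ge> 1 \<Longrightarrow> lie_orthonormal n (lie_basis n)"
  using someI_ex[OF lie_onb_exists] unfolding lie_basis_def lie_onb_def lie_orthonormal_def by blast

text \<open>Each coordinate of \<open>X v\<close> is the inner product of \<open>X\<close> with a matrix of Frobenius norm \<open>\<parallel>v\<parallel>\<close>, to
  which Bessel's inequality applies; the same idea gives the next lemma.\<close>

lemma sum_norm_lie_apply:
  assumes \<beta>: "lie_orthonormal n \<beta>" and n: "n \<ge> 1" and v: "v \<in> carrier_vec n"
  shows "(\<Sum>X\<in>\<beta>. (cvec_norm (X *\<^sub>v v))\<^sup>2) \<le> 2 * (cvec_norm v)\<^sup>2"
proof -
  have sub: "\<beta> \<subseteq> unitary_lie n" using \<beta> by (auto simp: lie_orthonormal_def)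
  have row: "(\<Sum>X\<in>\<beta>. (cmod (vec_index (X *\<^sub>v v) i))\<^sup>2) \<le> 2 * (cvec_norm v)\<^sup>2 / real n" if i: "i < n" for i
  proof -
    let ?z = "\<lambda>(k, l). if k = i then cnj (vec_index v l) else 0"
    have "(\<Sum>X\<in>\<beta>. (cmod (vec_index (X *\<^sub>v v) i))\<^sup>2) = (\<Sum>X\<in>\<beta>. (cmod (\<Sum>p\<in>idx n. X $$ p * cnj (?z p)))\<^sup>2)"
    proof (intro sum.cong refl)
      fix X assume "X \<in> \<beta>"
      then have X: "X \<in> carrier_mat n n" using sub unitary_lie_carrier by auto
      have "(\<Sum>p\<in>idx n. X $$ p * cnj (?z p)) = (\<Sum>k<n. \<Sum>l<n. if k = i then X $$ (k, l) * vec_index v l else 0)"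
        unfolding sum.cartesian_product by (intro sum.cong) auto
      also have "\<dots> = (\<Sum>k<n. if k = i then \<Sum>l<n. X $$ (k, l) * vec_index v l else 0)" by (intro sum.cong) auto
      also have "\<dots> = (\<Sum>l<n. X $$ (i, l) * vec_index v l)" using i by simp
      finally show "(cmod (vec_index (X *\<^sub>v v) i))\<^sup>2 = (cmod (\<Sum>p\<in>idx n. X $$ p * cnj (?z p)))\<^sup>2"
        using index_mult_vec_sum[OF X v i] by simp
    qed
    also have "\<dots> \<le> 2 * (\<Sum>p\<in>idx n. (cmod (?z p))\<^sup>2) / real n" by (rule lie_bessel[OF \<beta> n])
    also have "(\<Sum>p\<in>idx n. (cmod (?z p))\<^sup>2) = (\<Sum>k<n. \<Sum>l<n. if k = i then (cmod (vec_index v l))\<^sup>2 else 0)"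
      unfolding sum.cartesian_product by (intro sum.cong) auto
    also have "\<dots> = (\<Sum>k<n. if k = i then \<Sum>l<n. (cmod (vec_index v l))\<^sup>2 else 0)" by (intro sum.cong) auto
    also have "\<dots> = (cvec_norm v)\<^sup>2" using i v by (simp add: cvec_norm_power2)
    finally show ?thesis .
  qed
  have "(\<Sum>X\<in>\<beta>. (cvec_norm (X *\<^sub>v v))\<^sup>2) = (\<Sum>X\<in>\<beta>. \<Sum>i<n. (cmod (vec_index (X *\<^sub>v v) i))\<^sup>2)"
    using sub by (intro sum.cong refl cvec_norm_power2 mult_mat_vec_closed) (auto dest!: unitary_lie_carrier)
  also have "\<dots> = (\<Sum>i<n. \<Sum>X\<in>\<beta>. (cmod (vec_index (X *\<^sub>v v) i))\<^sup>2)" by (rule sum.swap)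
  also have "\<dots> \<le> (\<Sum>i<n. 2 * (cvec_norm v)\<^sup>2 / real n)" by (intro sum_mono row) auto
  also have "\<dots> = 2 * (cvec_norm v)\<^sup>2" using n by simp
  finally show ?thesis .
qed

lemma sum_lie_form_square:
  assumes \<beta>: "lie_orthonormal n \<beta>" and n: "n \<ge> 1" and v: "v \<in> carrier_vec n" and w: "w \<in> carrier_vec n"
  shows "(\<Sum>X\<in>\<beta>. (cmod (cip (X *\<^sub>v v) w))\<^sup>2) \<le> 2 * (cvec_norm v)\<^sup>2 * (cvec_norm w)\<^sup>2 / real n"
proof -
  have sub: "\<beta> \<subseteq> unitary_lie n" using \<beta> by (auto simp: lie_orthonormal_def)
  let ?z = "\<lambda>(k, l). cnj (vec_index v l) * vec_index w k"
  have "(\<Sum>X\<in>\<beta>. (cmod (cip (X *\<^sub>v v) w))\<^sup>2) = (\<Sum>X\<in>\<beta>. (cmod (\<Sum>p\<in>idx n. X $$ p * cnj (?z p)))\<^sup>2)"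
  proof (intro sum.cong refl)
    fix X assume "X \<in> \<beta>"
    then have X: "X \<in> carrier_mat n n" using sub unitary_lie_carrier by auto
    have "cip (X *\<^sub>v v) w = (\<Sum>p\<in>idx n. X $$ p * cnj (?z p))"
      unfolding cip_mult_vec_sum[OF X v] sum.cartesian_product by (intro sum.cong) auto
    then show "(cmod (cip (X *\<^sub>v v) w))\<^sup>2 = (cmod (\<Sum>p\<in>idx n. X $$ p * cnj (?z p)))\<^sup>2" by simp
  qed
  also have "\<dots> \<le> 2 * (\<Sum>p\<in>idx n. (cmod (?z p))\<^sup>2) / real n" by (rule lie_bessel[OF \<beta> n])
  also have "(\<Sum>p\<in>idx n. (cmod (?z p))\<^sup>2) = (\<Sum>k<n. \<Sum>l<n. (cmod (vec_index v l))\<^sup>2 * (cmod (vec_index w k))\<^sup>2)"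
    unfolding sum.cartesian_product by (intro sum.cong) (auto simp: norm_mult power_mult_distrib)
  also have "\<dots> = (cvec_norm v)\<^sup>2 * (cvec_norm w)\<^sup>2"
    using v w by (simp add: cvec_norm_power2 sum_distrib_left sum_distrib_right)
  finally show ?thesis by (simp add: mult.assoc)
qed

text \<open>The second derivative of \<open>exp (- \<kappa> n h)\<close>, where \<open>h A = Re \<langle>A v, v\<rangle>\<close>, has a term with the
  second derivative of \<open>h\<close> and the factor \<open>\<kappa> n\<close>, and a term with the square of the first derivative
  and the factor \<open>(\<kappa> n)\<^sup>2\<close>. The sum of these squares over the basis is of order \<open>1 / n\<close>, so that both
  contributions grow only linearly in \<open>n\<close>.\<close>

lemma laplacian_exp_coeff_le:
  assumes n: "n \<ge> 1" and v: "v \<in> carrier_vec n" and A: "A \<in> unitary_group n" and \<kappa>: "0 \<le> \<kappa>"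
  defines "r \<equiv> (cvec_norm v)\<^sup>2"
  shows "1 / 2 * laplacian n (exp_coeff v v (- \<kappa> * n)) A \<le> n * (\<kappa> * r + \<kappa>\<^sup>2 * r\<^sup>2) * exp_coeff v v (- \<kappa> * n) A"
proof -
  define \<beta> where "\<beta> = lie_basis n"
  have \<beta>: "lie_orthonormal n \<beta>" unfolding \<beta>_def by (rule lie_basis_orthonormal[OF n])
  have sub: "\<And>X. X \<in> \<beta> \<Longrightarrow> X \<in> unitary_lie n" using \<beta> by (auto simp: lie_orthonormal_def)
  have Ac: "A \<in> carrier_mat n n" by (rule unitary_group_carrier[OF A])
  define w where "w = mat_adjoint A *\<^sub>v v"
  have w: "w \<in> carrier_vec n" using Ac by (simp add: w_def)
  have "isometry n n A" using A by (auto simp: unitary_group_def isometry_def)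
  then have wn: "(cvec_norm w)\<^sup>2 \<le> r"
    unfolding w_def r_def using v by (intro power_mono isometry_adjoint_norm) auto
  have coeff: "matrix_coeff u v A = Re (cip u w)" if "u \<in> carrier_vec n" for u
    unfolding matrix_coeff_def w_def using cip_adjoint[OF Ac that v] by simp
  have first: "(matrix_coeff (X *\<^sub>v v) v A)\<^sup>2 \<le> (cmod (cip (X *\<^sub>v v) w))\<^sup>2" if "X \<in> \<beta>" for X
    using coeff[of "X *\<^sub>v v"] unitary_lie_carrier[OF sub[OF that]] abs_Re_le_cmod[of "cip (X *\<^sub>v v) w"]
    by (simp add: abs_le_square_iff[symmetric])
  have second: "- matrix_coeff (X *\<^sub>v (X *\<^sub>v v)) v A \<le> ((cvec_norm (X *\<^sub>v v))\<^sup>2 + (cvec_norm (X *\<^sub>v w))\<^sup>2) / 2"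
    if "X \<in> \<beta>" for X
  proof -
    have X: "X \<in> carrier_mat n n" and Xa: "mat_adjoint X = - X" using sub[OF that] by (auto simp: unitary_lie_def)
    have Xv: "X *\<^sub>v v \<in> carrier_vec n" and Xw: "X *\<^sub>v w \<in> carrier_vec n" using X by auto
    have aXw: "mat_adjoint X *\<^sub>v w = (-1) \<cdot>\<^sub>v (X *\<^sub>v w)"
      unfolding Xa using X w by (intro eq_vecI) auto
    have "matrix_coeff (X *\<^sub>v (X *\<^sub>v v)) v A = Re (cip (X *\<^sub>v v) (mat_adjoint X *\<^sub>v w))"
      using coeff[of "X *\<^sub>v (X *\<^sub>v v)"] cip_adjoint[OF X Xv w] X by simp
    also have "\<dots> = - Re (cip (X *\<^sub>v v) (X *\<^sub>v w))"
      unfolding aXw using cip_smult_right[OF Xv Xw, of "-1"] by simp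
    finally have "- matrix_coeff (X *\<^sub>v (X *\<^sub>v v)) v A = Re (cip (X *\<^sub>v v) (X *\<^sub>v w))" by simp
    also have "\<dots> \<le> cvec_norm (X *\<^sub>v v) * cvec_norm (X *\<^sub>v w)"
      using complex_Re_le_cmod cip_bound[OF Xv Xw] by (rule order_trans)
    also have "\<dots> \<le> ((cvec_norm (X *\<^sub>v v))\<^sup>2 + (cvec_norm (X *\<^sub>v w))\<^sup>2) / 2"
      using sum_squares_bound[of "cvec_norm (X *\<^sub>v v)" "cvec_norm (X *\<^sub>v w)"] by simp
    finally show ?thesis .
  qed
  let ?f = "exp_coeff v v (- \<kappa> * n) A"
  have lap: "laplacian n (exp_coeff v v (- \<kappa> * n)) A =
      (\<Sum>X\<in>\<beta>. \<kappa> * n * (- matrix_coeff (X *\<^sub>v (X *\<^sub>v v)) v A) + (\<kappa> * n)\<^sup>2 * (matrix_coeff (X *\<^sub>v v) v A)\<^sup>2) * ?f"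
    unfolding laplacian_def lie_basis_def[symmetric] \<beta>_def[symmetric] sum_distrib_right
    using lie_deriv2_exp_coeff[OF v unitary_lie_carrier[OF sub] Ac]
    by (intro sum.cong refl) (simp add: exp_coeff''_def[OF v] power2_eq_square mult_ac)
  have "(\<Sum>X\<in>\<beta>. \<kappa> * n * (- matrix_coeff (X *\<^sub>v (X *\<^sub>v v)) v A) + (\<kappa> * n)\<^sup>2 * (matrix_coeff (X *\<^sub>v v) v A)\<^sup>2)
     \<le> (\<Sum>X\<in>\<beta>. \<kappa> * n * (((cvec_norm (X *\<^sub>v v))\<^sup>2 + (cvec_norm (X *\<^sub>v w))\<^sup>2) / 2) + (\<kappa> * n)\<^sup>2 * (cmod (cip (X *\<^sub>v v) w))\<^sup>2)"
    using \<kappa> by (intro sum_mono add_mono mult_left_mono first second) auto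
  also have "\<dots> = \<kappa> * n * (((\<Sum>X\<in>\<beta>. (cvec_norm (X *\<^sub>v v))\<^sup>2) + (\<Sum>X\<in>\<beta>. (cvec_norm (X *\<^sub>v w))\<^sup>2)) / 2)
       + (\<kappa> * n)\<^sup>2 * (\<Sum>X\<in>\<beta>. (cmod (cip (X *\<^sub>v v) w))\<^sup>2)"
    by (simp only: sum.distrib sum_distrib_left sum_divide_distrib add_divide_distrib distrib_left)
  also have "\<dots> \<le> \<kappa> * n * ((2 * r + 2 * r) / 2) + (\<kappa> * n)\<^sup>2 * (2 * r * r / n)"
  proof (intro add_mono mult_left_mono divide_right_mono)
    show "(\<Sum>X\<in>\<beta>. (cvec_norm (X *\<^sub>v v))\<^sup>2) \<le> 2 * r" unfolding r_def by (rule sum_norm_lie_apply[OF \<beta> n v])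
    show "(\<Sum>X\<in>\<beta>. (cvec_norm (X *\<^sub>v w))\<^sup>2) \<le> 2 * r" using sum_norm_lie_apply[OF \<beta> n w] wn by simp
    have "2 * (cvec_norm v)\<^sup>2 * (cvec_norm w)\<^sup>2 / n \<le> 2 * r * r / n"
      unfolding r_def[symmetric] using wn by (intro divide_right_mono mult_left_mono) (auto simp: r_def)
    then show "(\<Sum>X\<in>\<beta>. (cmod (cip (X *\<^sub>v v) w))\<^sup>2) \<le> 2 * r * r / n"
      using sum_lie_form_square[OF \<beta> n v w] by (rule order_trans[rotated])
  qed (use \<kappa> in auto)
  also have "\<dots> = 2 * (n * (\<kappa> * r + \<kappa>\<^sup>2 * r\<^sup>2))"
    using n by (simp add: power2_eq_square field_simps)
  finally have "(\<Sum>X\<in>\<beta>. \<kappa> * n * (- matrix_coeff (X *\<^sub>v (X *\<^sub>v v)) v A) + (\<kappa> * n)\<^sup>2 * (matrix_coeff (X *\<^sub>v v) v A)\<^sup>2)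
     \<le> 2 * (n * (\<kappa> * r + \<kappa>\<^sup>2 * r\<^sup>2))" .
  then have "laplacian n (exp_coeff v v (- \<kappa> * n)) A \<le> 2 * (n * (\<kappa> * r + \<kappa>\<^sup>2 * r\<^sup>2)) * ?f"
    unfolding lap by (intro mult_right_mono) (auto simp: exp_coeff_def[OF v])
  then show ?thesis by simp
qed

section \<open>Exponential moments of Brownian motion\<close>

text \<open>Gronwall's lemma in integral form: \<open>exp (- c s) (a + c \<integral>\<^sub>0\<^sup>s \<phi>)\<close> is nonincreasing in \<open>s\<close>.\<close>

lemma gronwall_integral:
  fixes \<phi> :: "real \<Rightarrow> real"
  assumes cont: "continuous_on UNIV \<phi>" and c: "0 \<le> c"
    and bound: "\<And>t. 0 \<le> t \<Longrightarrow> \<phi> t \<le> a + c * integral {0..t} \<phi>" and t: "0 \<le> t"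
  shows "\<phi> t \<le> a * exp (c * t)"
proof -
  define h where "h = (\<lambda>s. exp (- c * s) * (a + c * integral {0..s} \<phi>))"
  have der: "((\<lambda>u. integral {0..u} \<phi>) has_vector_derivative \<phi> s) (at s within {0..t})" if "s \<in> {0..t}" for s
    by (rule integral_has_vector_derivative[OF continuous_on_subset[OF cont] that]) auto
  then have "continuous_on {0..t} (\<lambda>u. integral {0..u} \<phi>)"
    by (meson has_vector_derivative_continuous continuous_on_eq_continuous_within)
  then have "continuous_on {0..t} h" unfolding h_def by (intro continuous_intros)
  moreover have "\<exists>y. DERIV h s :> y \<and> y \<le> 0" if s: "0 < s" "s < t" for s
  proof -
    have "((\<lambda>u. integral {0..u} \<phi>) has_vector_derivative \<phi> s) (at s)"
      using der[of s] s at_within_Icc_at[of 0 s t] by simp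
    then have d: "DERIV (\<lambda>u. integral {0..u} \<phi>) s :> \<phi> s"
      by (simp add: has_real_derivative_iff_has_vector_derivative)
    have "DERIV h s :> exp (- c * s) * (- c) * (a + c * integral {0..s} \<phi>) + exp (- c * s) * (c * \<phi> s)"
      unfolding h_def by (rule derivative_eq_intros d refl | simp)+
    moreover have "exp (- c * s) * (- c) * (a + c * integral {0..s} \<phi>) + exp (- c * s) * (c * \<phi> s) =
        exp (- c * s) * c * (\<phi> s - (a + c * integral {0..s} \<phi>))" by (simp add: algebra_simps)
    moreover have "\<dots> \<le> 0" using bound[of s] s c by (intro mult_nonneg_nonpos) auto
    ultimately show ?thesis by (intro exI conjI) (assumption, simp only:)
  qed
  ultimately have "h t \<le> h 0" using DERIV_nonpos_imp_decreasing_open[OF t, of h] by blast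
  then have "exp (- c * t) * (a + c * integral {0..t} \<phi>) \<le> a" by (simp add: h_def)
  then have "exp (c * t) * (exp (- c * t) * (a + c * integral {0..t} \<phi>)) \<le> exp (c * t) * a"
    by (intro mult_left_mono) auto
  then have "a + c * integral {0..t} \<phi> \<le> a * exp (c * t)"
    by (simp add: mult.assoc[symmetric] exp_add[symmetric] mult.commute)
  then show ?thesis using bound[OF t] by linarith
qed

text \<open>Joint measurability, as needed for Fubini's theorem: a process with continuous paths is the
  pointwise limit of processes that are constant on intervals of length \<open>1 / Suc k\<close>, and these depend
  on time only through an integer.\<close>

lemma continuous_process_measurable:
  fixes Y :: "real \<Rightarrow> 'w \<Rightarrow> real"
  assumes meas: "\<And>s. Y s \<in> borel_measurable M"
    and cont: "\<And>\<omega>. \<omega> \<in> space M \<Longrightarrow> continuous_on UNIV (\<lambda>s. Y s \<omega>)"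
  shows "(\<lambda>(s, \<omega>). Y s \<omega>) \<in> borel_measurable (lborel \<Otimes>\<^sub>M M)"
proof -
  define q where "q k s = real_of_int \<lfloor>s * real (Suc k)\<rfloor> / real (Suc k)" for k and s :: real
  have q: "(\<lambda>k. q k s) \<longlonglongrightarrow> s" for s
  proof -
    have "\<bar>q k s - s\<bar> \<le> 1 / real (Suc k)" for k
    proof -
      have "\<bar>real_of_int \<lfloor>s * real (Suc k)\<rfloor> - s * real (Suc k)\<bar> \<le> 1" by linarith
      then have "\<bar>real_of_int \<lfloor>s * real (Suc k)\<rfloor> - s * real (Suc k)\<bar> / real (Suc k) \<le> 1 / real (Suc k)"
        by (intro divide_right_mono) auto
      moreover have "q k s - s = (real_of_int \<lfloor>s * real (Suc k)\<rfloor> - s * real (Suc k)) / real (Suc k)"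
        by (simp add: q_def diff_divide_distrib)
      ultimately show ?thesis by (simp add: abs_divide)
    qed
    then have "(\<lambda>k. q k s - s) \<longlonglongrightarrow> 0"
      by (intro tendsto_rabs_zero_cancel[OF tendsto_sandwich[OF _ _ tendsto_const LIMSEQ_Suc[OF lim_const_over_n[of 1]]]])
         (auto simp del: of_nat_Suc)
    then show ?thesis by (simp add: LIM_zero_iff)
  qed
  show ?thesis
  proof (rule borel_measurable_LIMSEQ_real)
    fix x :: "real \<times> 'w" assume "x \<in> space (lborel \<Otimes>\<^sub>M M)"
    then obtain s :: real and \<omega> where x: "x = (s, \<omega>)" "\<omega> \<in> space M" by (auto simp: space_pair_measure)
    have "isCont (\<lambda>s. Y s \<omega>) s" using cont[OF x(2)] by (simp add: continuous_on_eq_continuous_at)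
    from isCont_tendsto_compose[OF this q]
    show "(\<lambda>k. (\<lambda>(s, \<omega>). Y (q k s) \<omega>) x) \<longlonglongrightarrow> (\<lambda>(s, \<omega>). Y s \<omega>) x" using x by simp
  next
    fix k
    have "(\<lambda>x. (\<lambda>i x. Y (real_of_int i / real (Suc k)) (snd x)) \<lfloor>fst x * real (Suc k)\<rfloor> x) \<in> borel_measurable (lborel \<Otimes>\<^sub>M M)"
    proof (rule measurable_compose_countable[where f = "\<lambda>i x. Y (real_of_int i / real (Suc k)) (snd x)"
          and g = "\<lambda>x. \<lfloor>fst x * real (Suc k)\<rfloor>"])
      show "(\<lambda>x. Y (real_of_int i / real (Suc k)) (snd x)) \<in> borel_measurable (lborel \<Otimes>\<^sub>M M)" for i
        by (rule measurable_compose[OF measurable_snd meas])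
      show "(\<lambda>x. \<lfloor>fst x * real (Suc k)\<rfloor>) \<in> measurable (lborel \<Otimes>\<^sub>M M) (count_space UNIV)"
        by measurable
    qed
    then show "(\<lambda>(s, \<omega>). Y (q k s) \<omega>) \<in> borel_measurable (lborel \<Otimes>\<^sub>M M)"
      by (simp add: q_def case_prod_beta')
  qed
qed

context prob_space
begin

lemma bounded_process_expectation:
  fixes Y :: "real \<Rightarrow> 'a \<Rightarrow> real"
  assumes meas: "\<And>s. Y s \<in> borel_measurable M"
    and cont: "\<And>\<omega>. \<omega> \<in> space M \<Longrightarrow> continuous_on UNIV (\<lambda>s. Y s \<omega>)"
    and bound: "\<And>s \<omega>. \<omega> \<in> space M \<Longrightarrow> \<bar>Y s \<omega>\<bar> \<le> K"
  shows "integrable M (Y s)"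
    and "continuous_on UNIV (\<lambda>s. expectation (Y s))"
    and "integrable M (\<lambda>\<omega>. integral {0..t} (\<lambda>s. Y s \<omega>))"
    and "expectation (\<lambda>\<omega>. integral {0..t} (\<lambda>s. Y s \<omega>)) = integral {0..t} (\<lambda>s. expectation (Y s))"
proof -
  show int: "integrable M (Y s)" for s
    by (rule integrable_const_bound[where B = K]) (use meas bound in auto)
  show contE: "continuous_on UNIV (\<lambda>s. expectation (Y s))"
    unfolding continuous_on_sequentially
  proof (intro ballI allI impI, elim conjE)
    fix x :: "nat \<Rightarrow> real" and s assume x: "x \<longlonglongrightarrow> s"
    show "((\<lambda>s. expectation (Y s)) \<circ> x) \<longlonglongrightarrow> expectation (Y s)"
      unfolding o_def
    proof (rule integral_dominated_convergence[where w = "\<lambda>_. K"])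
      show "AE \<omega> in M. (\<lambda>i. Y (x i) \<omega>) \<longlonglongrightarrow> Y s \<omega>"
      proof (rule AE_I2)
        fix \<omega> assume "\<omega> \<in> space M"
        then have "isCont (\<lambda>s. Y s \<omega>) s" using cont by (simp add: continuous_on_eq_continuous_at)
        then show "(\<lambda>i. Y (x i) \<omega>) \<longlonglongrightarrow> Y s \<omega>" using x by (rule isCont_tendsto_compose)
      qed
    qed (use meas bound in auto)
  qed
  interpret lb: pair_sigma_finite lborel M ..
  let ?Z = "\<lambda>s \<omega>. indicator {0..t} s * Y s \<omega>"
  have prod: "integrable (lborel \<Otimes>\<^sub>M M) (\<lambda>(s, \<omega>). ?Z s \<omega>)"
  proof (rule integrableI_bounded_set[where A = "{0..t} \<times> space M" and B = K])
    show "{0..t} \<times> space M \<in> sets (lborel \<Otimes>\<^sub>M M)" by (intro pair_measureI) auto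
    have "(\<lambda>x. indicator {0..t} (fst x) * (\<lambda>(s, \<omega>). Y s \<omega>) x) \<in> borel_measurable (lborel \<Otimes>\<^sub>M M)"
      using continuous_process_measurable[OF meas cont] by measurable
    then show "(\<lambda>(s, \<omega>). ?Z s \<omega>) \<in> borel_measurable (lborel \<Otimes>\<^sub>M M)" by (simp add: case_prod_beta')
    have "emeasure (lborel \<Otimes>\<^sub>M M) ({0..t} \<times> space M) = emeasure lborel {0..t} * emeasure M (space M)"
      by (rule emeasure_pair_measure_Times) auto
    also have "\<dots> < \<infinity>" using emeasure_space_1 by (simp add: emeasure_lborel_Icc_eq)
    finally show "emeasure (lborel \<Otimes>\<^sub>M M) ({0..t} \<times> space M) < \<infinity>" .
    show "AE x in lborel \<Otimes>\<^sub>M M. x \<in> {0..t} \<times> space M \<longrightarrow> norm (case x of (s, \<omega>) \<Rightarrow> ?Z s \<omega>) \<le> K"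
      using bound by (intro AE_I2) auto
    show "AE x in lborel \<Otimes>\<^sub>M M. x \<notin> {0..t} \<times> space M \<longrightarrow> (case x of (s, \<omega>) \<Rightarrow> ?Z s \<omega>) = 0"
      by (intro AE_I2) (auto simp: space_pair_measure indicator_def split: if_splits)
  qed
  have path: "(\<integral>s. ?Z s \<omega> \<partial>lborel) = integral {0..t} (\<lambda>s. Y s \<omega>)" if "\<omega> \<in> space M" for \<omega>
    using set_borel_integral_eq_integral(2)[OF borel_integrable_atLeastAtMost'[OF continuous_on_subset[OF cont[OF that]]], of 0 t]
    by (simp add: set_lebesgue_integral_def)
  show "integrable M (\<lambda>\<omega>. integral {0..t} (\<lambda>s. Y s \<omega>))"
    using lb.integrable_snd[OF prod] path by (simp cong: Bochner_Integration.integrable_cong)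
  have "expectation (\<lambda>\<omega>. integral {0..t} (\<lambda>s. Y s \<omega>)) = (\<integral>\<omega>. (\<integral>s. ?Z s \<omega> \<partial>lborel) \<partial>M)"
    by (intro Bochner_Integration.integral_cong) (auto simp: path)
  also have "\<dots> = (\<integral>s. (\<integral>\<omega>. ?Z s \<omega> \<partial>M) \<partial>lborel)"
    using lb.Fubini_integral[OF prod] by simp
  also have "\<dots> = (\<integral>s. indicator {0..t} s *\<^sub>R expectation (Y s) \<partial>lborel)" by simp
  also have "\<dots> = integral {0..t} (\<lambda>s. expectation (Y s))"
    using set_borel_integral_eq_integral(2)[OF borel_integrable_atLeastAtMost'[OF continuous_on_subset[OF contE]], of 0 t]
    by (simp add: set_lebesgue_integral_def)
  finally show "expectation (\<lambda>\<omega>. integral {0..t} (\<lambda>s. Y s \<omega>)) = integral {0..t} (\<lambda>s. expectation (Y s))" .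
qed

lemma martingale_expectation_zero:
  assumes mart: "martingale M F X" and sub: "subalgebra M (F 0)"
    and zero: "\<And>\<omega>. \<omega> \<in> space M \<Longrightarrow> X 0 \<omega> = 0" and t: "t \<ge> 0"
  shows "expectation (X t) = 0"
proof -
  interpret finite_measure_subalgebra M "F 0" using sub by unfold_locales
  have "integrable M (X t)" and "AE \<omega> in M. real_cond_exp M (F 0) (X t) \<omega> = X 0 \<omega>"
    using mart t unfolding martingale_def by auto
  then have "expectation (X t) = expectation (real_cond_exp M (F 0) (X t))" using real_cond_exp_int(2) by simp
  also have "\<dots> = expectation (\<lambda>_. 0)"
  proof (rule integral_cong_AE)
    show "AE \<omega> in M. real_cond_exp M (F 0) (X t) \<omega> = 0"
      using \<open>AE \<omega> in M. real_cond_exp M (F 0) (X t) \<omega> = X 0 \<omega>\<close> zero by (auto elim: AE_mp intro!: AE_I2)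
  qed auto
  finally show ?thesis by simp
qed

end

lemma natural_filtration_subalgebra:
  assumes "\<And>s i j. 0 \<le> s \<Longrightarrow> i < n \<Longrightarrow> j < n \<Longrightarrow> (\<lambda>\<omega>. U s \<omega> $$ (i, j)) \<in> borel_measurable M"
  shows "subalgebra M (natural_filtration M n U t)"
proof -
  let ?G = "{{\<omega> \<in> space M. U s \<omega> $$ (i, j) \<in> B} | s i j B. 0 \<le> s \<and> s \<le> t \<and> i < n \<and> j < n \<and> B \<in> sets borel}"
  have "{\<omega> \<in> space M. U s \<omega> $$ (i, j) \<in> B} \<in> sets M" if "0 \<le> s" "i < n" "j < n" "B \<in> sets borel" for s i j B
  proof -
    have "{\<omega> \<in> space M. U s \<omega> $$ (i, j) \<in> B} = (\<lambda>\<omega>. U s \<omega> $$ (i, j)) -` B \<inter> space M" by auto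
    then show ?thesis using measurable_sets[OF assms[OF that(1-3)] that(4)] by simp
  qed
  then have G: "?G \<subseteq> sets M" by blast
  have "?G \<subseteq> Pow (space M)" by auto
  then show ?thesis unfolding subalgebra_def natural_filtration_def
    using G by (simp add: sets.sigma_sets_subset)
qed

context
  fixes n :: nat and v :: "complex Matrix.vec" and \<kappa> :: real
  assumes n: "n \<ge> 1" and v: "v \<in> carrier_vec n" and \<kappa>: "0 \<le> \<kappa>"
begin

lemma matrix_coeff_unitary_bound:
  assumes A: "A \<in> unitary_group n"
  shows "\<bar>matrix_coeff v v A\<bar> \<le> (cvec_norm v)\<^sup>2"
proof -
  have Ac: "A \<in> carrier_mat n n" and iso: "isometry n n A" using A by (auto simp: unitary_group_def isometry_def)
  have "\<bar>matrix_coeff v v A\<bar> \<le> cmod (cip (A *\<^sub>v v) v)" unfolding matrix_coeff_def by (rule abs_Re_le_cmod)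
  also have "\<dots> \<le> cvec_norm (A *\<^sub>v v) * cvec_norm v" by (rule cip_bound[of _ n]) (use Ac v in auto)
  also have "\<dots> = (cvec_norm v)\<^sup>2" using isometry_norm[OF iso v] by (simp add: power2_eq_square)
  finally show ?thesis .
qed

lemma laplacian_exp_coeff:
  assumes A: "A \<in> carrier_mat n n"
  shows "laplacian n (exp_coeff v v a) A = (\<Sum>X\<in>lie_basis n. exp_coeff'' v v a X X A)"
  unfolding laplacian_def lie_basis_def[symmetric]
  using lie_basis_orthonormal[OF n] lie_deriv2_exp_coeff[OF v unitary_lie_carrier A]
  by (intro sum.cong refl) (auto simp: lie_orthonormal_def)

lemma matrix_coeff_measurable:
  assumes "\<And>i j. i < n \<Longrightarrow> j < n \<Longrightarrow> (\<lambda>\<omega>. Z \<omega> $$ (i, j)) \<in> borel_measurable M"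
    and "\<And>\<omega>. \<omega> \<in> space M \<Longrightarrow> Z \<omega> \<in> carrier_mat n n"
  shows "(\<lambda>\<omega>. matrix_coeff v v (Z \<omega>)) \<in> borel_measurable M"
proof -
  have "(\<lambda>\<omega>. Re (\<Sum>i<n. \<Sum>l<n. Z \<omega> $$ (i, l) * vec_index v l * cnj (vec_index v i))) \<in> borel_measurable M"
    using assms(1) by (intro measurable_compose[OF _ borel_measurable_Re] borel_measurable_sum borel_measurable_times
      borel_measurable_const) auto
  moreover have "matrix_coeff v v (Z \<omega>) = Re (\<Sum>i<n. \<Sum>l<n. Z \<omega> $$ (i, l) * vec_index v l * cnj (vec_index v i))"
    if "\<omega> \<in> space M" for \<omega>
    unfolding matrix_coeff_def by (simp only: cip_mult_vec_sum[OF assms(2)[OF that] v])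
  ultimately show ?thesis by (simp cong: measurable_cong)
qed

text \<open>The martingale problem for \<open>f = exp (- \<kappa> n Re \<langle>B v, v\<rangle>)\<close> expresses \<open>E (f U\<^sub>t)\<close> as its value at
  the identity plus the integral of the expected generator, which is at most \<open>c E (f U\<^sub>s)\<close>. Gronwall's
  lemma then gives the growth rate \<open>c\<close>.\<close>

lemma expectation_exp_coeff_le:
  assumes "prob_space M" and bm: "unitary_brownian_motion M n U" and t: "0 \<le> t"
  defines "r \<equiv> (cvec_norm v)\<^sup>2"
  shows "integrable M (\<lambda>\<omega>. exp_coeff v v (- \<kappa> * n) (U t \<omega>))"
    and "prob_space.expectation M (\<lambda>\<omega>. exp_coeff v v (- \<kappa> * n) (U t \<omega>)) \<le>
      exp (- \<kappa> * n * r) * exp (n * (\<kappa> * r + \<kappa>\<^sup>2 * r\<^sup>2) * t)"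
proof -
  interpret prob_space M by fact
  let ?f = "exp_coeff v v (- \<kappa> * n)"
  define c where "c = n * (\<kappa> * r + \<kappa>\<^sup>2 * r\<^sup>2)"
  have c: "0 \<le> c" using \<kappa> by (simp add: c_def r_def)
  have U: "U s \<omega> \<in> unitary_group n" if "0 \<le> s" "\<omega> \<in> space M" for s \<omega>
    using bm that unfolding unitary_brownian_motion_def by blast
  have U0: "U 0 \<omega> = 1\<^sub>m n" if "\<omega> \<in> space M" for \<omega>
    using bm that unfolding unitary_brownian_motion_def by blast
  have meas: "(\<lambda>\<omega>. U s \<omega> $$ (i, j)) \<in> borel_measurable M" if "0 \<le> s" "i < n" "j < n" for s i j
    using bm that unfolding unitary_brownian_motion_def by blast
  have cont: "continuous_on {0..} (\<lambda>s. U s \<omega> $$ (i, j))" if "\<omega> \<in> space M" "i < n" "j < n" for \<omega> i j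
    using bm that unfolding unitary_brownian_motion_def by blast
  have coeff: "matrix_coeff u v (U s \<omega>) = Re (\<Sum>i<n. \<Sum>l<n. U s \<omega> $$ (i, l) * vec_index u l * cnj (vec_index v i))"
    if "0 \<le> s" "\<omega> \<in> space M" "u \<in> carrier_vec n" for s \<omega> u
    unfolding matrix_coeff_def cip_mult_vec_sum[OF unitary_group_carrier[OF U[OF that(1,2)]] that(3)] ..
  have coeff_meas: "(\<lambda>\<omega>. matrix_coeff v v (U s \<omega>)) \<in> borel_measurable M" if "0 \<le> s" for s
    by (rule matrix_coeff_measurable) (use that meas U unitary_group_carrier in auto)
  have coeff_cont: "continuous_on {0..} (\<lambda>s. matrix_coeff u v (U s \<omega>))" if "\<omega> \<in> space M" "u \<in> carrier_vec n" for u \<omega>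
  proof -
    have "continuous_on {0..} (\<lambda>s. Re (\<Sum>i<n. \<Sum>l<n. U s \<omega> $$ (i, l) * vec_index u l * cnj (vec_index v i)))"
      using cont[OF that(1)] by (intro continuous_intros) auto
    then show ?thesis by (rule continuous_on_eq) (simp only: coeff[OF _ that] atLeast_iff)
  qed
  \<comment> \<open>The process is only given for nonnegative times; freezing it at negative times gives paths that
    are continuous on the whole line.\<close>
  define Y where "Y s \<omega> = ?f (U (max 0 s) \<omega>)" for s \<omega>
  have Y_meas: "Y s \<in> borel_measurable M" for s
    unfolding Y_def exp_coeff_def[OF v] using coeff_meas[of "max 0 s"] by measurable
  have f_cont: "continuous_on {0..} (\<lambda>s. ?f (U s \<omega>))" if "\<omega> \<in> space M" for \<omega>
    unfolding exp_coeff_def[OF v] by (intro continuous_intros coeff_cont that v)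
  have Y_cont: "continuous_on UNIV (\<lambda>s. Y s \<omega>)" if "\<omega> \<in> space M" for \<omega>
    unfolding Y_def by (rule continuous_on_compose2[OF f_cont[OF that]]) (auto intro!: continuous_on_max)
  have Y_bound: "\<bar>Y s \<omega>\<bar> \<le> exp (\<kappa> * n * r)" if "\<omega> \<in> space M" for s \<omega>
  proof -
    have "- matrix_coeff v v (U (max 0 s) \<omega>) \<le> r"
      using matrix_coeff_unitary_bound[OF U[of "max 0 s", OF _ that]] by (simp add: r_def)
    then have "\<kappa> * n * (- matrix_coeff v v (U (max 0 s) \<omega>)) \<le> \<kappa> * n * r" using \<kappa> by (intro mult_left_mono) auto
    then show ?thesis by (simp add: Y_def exp_coeff_def[OF v])
  qed
  note E = bounded_process_expectation[OF Y_meas Y_cont Y_bound]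
  define L where "L s \<omega> = 1 / 2 * laplacian n ?f (U s \<omega>)" for s \<omega>
  define X where "X t \<omega> = ?f (U t \<omega>) - ?f (U 0 \<omega>) - integral {0..t} (\<lambda>s. L s \<omega>)" for t \<omega>
  have mart: "martingale M (natural_filtration M n U) X"
    using bm C2_exp_coeff[OF v, of v "- \<kappa> * n"] unfolding unitary_brownian_motion_def X_def L_def by blast
  have L_cont: "continuous_on {0..} (\<lambda>s. L s \<omega>)" if "\<omega> \<in> space M" for \<omega>
  proof -
    have "continuous_on {0..} (\<lambda>s. 1 / 2 * (\<Sum>X\<in>lie_basis n. exp_coeff'' v v (- \<kappa> * n) X X (U s \<omega>)))"
      unfolding exp_coeff''_def[OF v]
    proof (intro continuous_intros f_cont coeff_cont that)
      fix X assume "X \<in> lie_basis n"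
      then have "X \<in> carrier_mat n n" using lie_basis_orthonormal[OF n] unitary_lie_carrier by (auto simp: lie_orthonormal_def)
      then show "X *\<^sub>v (X *\<^sub>v v) \<in> carrier_vec n" "X *\<^sub>v v \<in> carrier_vec n" "X *\<^sub>v v \<in> carrier_vec n" by auto
    qed
    then show ?thesis
      unfolding L_def by (rule continuous_on_eq) (simp add: laplacian_exp_coeff[OF unitary_group_carrier[OF U[OF _ that]]])
  qed
  have main: "expectation (Y s) \<le> exp (- \<kappa> * n * r) + c * integral {0..s} (\<lambda>s. expectation (Y s))" if s: "0 \<le> s" for s
  proof -
    have start: "?f (U 0 \<omega>) = exp (- \<kappa> * n * r)" if "\<omega> \<in> space M" for \<omega>
      unfolding exp_coeff_def[OF v] matrix_coeff_def U0[OF that] using v by (simp add: cip_self r_def)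
    have low: "Y s \<omega> - exp (- \<kappa> * n * r) - c * integral {0..s} (\<lambda>s. Y s \<omega>) \<le> X s \<omega>" if w: "\<omega> \<in> space M" for \<omega>
    proof -
      have "integral {0..s} (\<lambda>s. L s \<omega>) \<le> integral {0..s} (\<lambda>s. c * Y s \<omega>)"
      proof (rule integral_le)
        show "(\<lambda>s. L s \<omega>) integrable_on {0..s}"
          by (rule integrable_continuous_interval) (rule continuous_on_subset[OF L_cont[OF w]], auto)
        show "(\<lambda>s. c * Y s \<omega>) integrable_on {0..s}"
          by (rule integrable_continuous_interval) (intro continuous_intros continuous_on_subset[OF Y_cont[OF w]], auto)
        fix x assume "x \<in> {0..s}"
        then show "L x \<omega> \<le> c * Y x \<omega>"
          using laplacian_exp_coeff_le[OF n v U[OF _ w] \<kappa>, of x] by (simp add: L_def Y_def c_def r_def max_absorb2)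
      qed
      then show ?thesis using start[OF w] s by (simp add: X_def Y_def max_absorb2)
    qed
    have "expectation (\<lambda>\<omega>. Y s \<omega> - exp (- \<kappa> * n * r) - c * integral {0..s} (\<lambda>s. Y s \<omega>)) \<le> expectation (X s)"
    proof (rule integral_mono)
      show "integrable M (X s)" using mart s unfolding martingale_def by blast
      show "integrable M (\<lambda>\<omega>. Y s \<omega> - exp (- \<kappa> * n * r) - c * integral {0..s} (\<lambda>s. Y s \<omega>))"
        using E(1)[of s] E(3)[of s] by simp
    qed (rule low)
    also have "expectation (X s) = 0"
      by (rule martingale_expectation_zero[OF mart natural_filtration_subalgebra _ s]) (auto intro: meas simp: X_def)
    finally show ?thesis using E(1)[of s] E(3)[of s] E(4)[of s] by (simp add: prob_space)
  qed
  have Yt: "Y t = (\<lambda>\<omega>. ?f (U t \<omega>))" using t by (intro ext) (simp add: Y_def max_absorb2)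
  show "integrable M (\<lambda>\<omega>. ?f (U t \<omega>))" using E(1)[of t] Yt by simp
  show "expectation (\<lambda>\<omega>. ?f (U t \<omega>)) \<le> exp (- \<kappa> * n * r) * exp (n * (\<kappa> * r + \<kappa>\<^sup>2 * r\<^sup>2) * t)"
    using gronwall_integral[OF E(2) c main t] unfolding Yt c_def .
qed

text \<open>Markov's inequality for the exponential moment. As \<open>\<parallel>U v - v\<parallel>\<^sup>2 = 2 (\<parallel>v\<parallel>\<^sup>2 - Re \<langle>U v, v\<rangle>)\<close> for
  unitary \<open>U\<close>, the event says that \<open>U\<close> moves \<open>v\<close> by at least \<open>sqrt (2 \<eta>)\<close>.\<close>

lemma brownian_motion_deviation:
  assumes "prob_space M" and bm: "unitary_brownian_motion M n U" and t: "0 \<le> t"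
  defines "r \<equiv> (cvec_norm v)\<^sup>2"
  shows "{\<omega> \<in> space M. matrix_coeff v v (U t \<omega>) \<le> r - \<eta>} \<in> sets M"
    and "measure M {\<omega> \<in> space M. matrix_coeff v v (U t \<omega>) \<le> r - \<eta>} \<le>
      exp (- real n * (\<kappa> * \<eta> - (\<kappa> * r + \<kappa>\<^sup>2 * r\<^sup>2) * t))"
proof -
  interpret prob_space M by fact
  let ?f = "exp_coeff v v (- \<kappa> * n)"
  note E = expectation_exp_coeff_le[OF assms(1) bm t]
  have [measurable]: "(\<lambda>\<omega>. matrix_coeff v v (U t \<omega>)) \<in> borel_measurable M"
  proof (rule matrix_coeff_measurable)
    show "(\<lambda>\<omega>. U t \<omega> $$ (i, j)) \<in> borel_measurable M" if "i < n" "j < n" for i j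
      using bm t that unfolding unitary_brownian_motion_def by blast
    show "U t \<omega> \<in> carrier_mat n n" if "\<omega> \<in> space M" for \<omega>
      using bm t that unfolding unitary_brownian_motion_def unitary_group_def by blast
  qed
  show "{\<omega> \<in> space M. matrix_coeff v v (U t \<omega>) \<le> r - \<eta>} \<in> sets M" by measurable
  let ?c = "exp (- \<kappa> * n * (r - \<eta>))"
  have "measure M {\<omega> \<in> space M. matrix_coeff v v (U t \<omega>) \<le> r - \<eta>} \<le> measure M {\<omega> \<in> space M. ?c \<le> ?f (U t \<omega>)}"
  proof (rule finite_measure_mono)
    show "{\<omega> \<in> space M. ?c \<le> ?f (U t \<omega>)} \<in> sets M" unfolding exp_coeff_def[OF v] by measurable
    show "{\<omega> \<in> space M. matrix_coeff v v (U t \<omega>) \<le> r - \<eta>} \<subseteq> {\<omega> \<in> space M. ?c \<le> ?f (U t \<omega>)}"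
      unfolding exp_coeff_def[OF v] using \<kappa> by (auto intro!: mult_left_mono)
  qed
  also have "\<dots> \<le> expectation (\<lambda>\<omega>. ?f (U t \<omega>)) / ?c"
    by (rule integral_Markov_inequality_measure[where A = "{}"]) (use E(1) in \<open>auto simp: exp_coeff_def[OF v]\<close>)
  also have "\<dots> \<le> exp (- \<kappa> * n * r) * exp (n * (\<kappa> * r + \<kappa>\<^sup>2 * r\<^sup>2) * t) / ?c"
    using E(2) by (intro divide_right_mono) (auto simp: r_def)
  also have "\<dots> = exp (- real n * (\<kappa> * \<eta> - (\<kappa> * r + \<kappa>\<^sup>2 * r\<^sup>2) * t))"
    by (simp add: exp_add[symmetric] exp_diff[symmetric] algebra_simps)
  finally show "measure M {\<omega> \<in> space M. matrix_coeff v v (U t \<omega>) \<le> r - \<eta>} \<le>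
      exp (- real n * (\<kappa> * \<eta> - (\<kappa> * r + \<kappa>\<^sup>2 * r\<^sup>2) * t))" .
qed

end

section \<open>Nets of exponential size\<close>

lemma sum_half_powers_le: "(\<Sum>k\<in>{- int K..int K}. (1 / 2 :: real) ^ nat \<bar>k\<bar>) \<le> 3"
proof -
  have "(\<Sum>k\<in>{- int K..int K}. (1 / 2 :: real) ^ nat \<bar>k\<bar>) = 3 - 2 * (1 / 2) ^ K"
  proof (induction K)
    case (Suc K)
    have "{- int (Suc K)..int (Suc K)} = insert (int (Suc K)) (insert (- int (Suc K)) {- int K..int K})" by auto
    moreover have "nat (1 + int K) = Suc K" "nat (int K + 1) = Suc K" by auto
    ultimately show ?case using Suc by simp
  qed simp
  then show ?thesis by simp
qed

text \<open>Give an integer vector \<open>z\<close> the weight \<open>2\<close> to the power \<open>- \<bar>z\<bar>\<^sub>1\<close>. The weights are products over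
  the coordinates, so the total weight is at most \<open>3\<close> to the power of the dimension, whereas each
  element of the ball has weight at least \<open>2\<close> to the power \<open>- K\<close>.\<close>

lemma card_int_l1_ball:
  fixes I :: "'i set" and K :: nat
  assumes I: "finite I"
  defines "Z \<equiv> {z \<in> PiE I (\<lambda>_. {- int K..int K}). (\<Sum>i\<in>I. \<bar>z i\<bar>) \<le> int K}"
  shows "finite Z" "real (card Z) \<le> 2 ^ K * 3 ^ card I"
proof -
  let ?P = "PiE I (\<lambda>_. {- int K..int K})"
  have finP: "finite ?P" using I by (intro finite_PiE) auto
  show finZ: "finite Z" unfolding Z_def using finP by auto
  have "real (card Z) * (1 / 2) ^ K = (\<Sum>z\<in>Z. (1 / 2 :: real) ^ K)" by simp
  also have "\<dots> \<le> (\<Sum>z\<in>Z. \<Prod>i\<in>I. (1 / 2) ^ nat \<bar>z i\<bar>)"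
  proof (rule sum_mono)
    fix z assume "z \<in> Z"
    then have "(\<Sum>i\<in>I. \<bar>z i\<bar>) \<le> int K" by (simp add: Z_def)
    moreover have "int (\<Sum>i\<in>I. nat \<bar>z i\<bar>) = (\<Sum>i\<in>I. \<bar>z i\<bar>)" by simp
    ultimately have "(\<Sum>i\<in>I. nat \<bar>z i\<bar>) \<le> K" by linarith
    then have "(1 / 2 :: real) ^ K \<le> (1 / 2) ^ (\<Sum>i\<in>I. nat \<bar>z i\<bar>)" by (intro power_decreasing) auto
    then show "(1 / 2 :: real) ^ K \<le> (\<Prod>i\<in>I. (1 / 2) ^ nat \<bar>z i\<bar>)" by (simp add: power_sum)
  qed
  also have "\<dots> \<le> (\<Sum>z\<in>?P. \<Prod>i\<in>I. (1 / 2) ^ nat \<bar>z i\<bar>)"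
    by (rule sum_mono2[OF finP]) (auto simp: Z_def intro!: prod_nonneg)
  also have "\<dots> = (\<Prod>i\<in>I. \<Sum>k\<in>{- int K..int K}. (1 / 2) ^ nat \<bar>k\<bar>)"
    using I by (subst prod_sum_PiE) auto
  also have "\<dots> \<le> (\<Prod>i\<in>I. 3)"
    by (intro prod_mono conjI sum_half_powers_le sum_nonneg) auto
  finally have "real (card Z) * (1 / 2) ^ K \<le> 3 ^ card I" by simp
  then show "real (card Z) \<le> 2 ^ K * 3 ^ card I" by (simp add: power_divide field_simps)
qed

text \<open>The norm bound \<open>2\<close> keeps the deviation estimate uniform over the net.\<close>

definition small_net :: "nat \<Rightarrow> real \<Rightarrow> nat \<Rightarrow> complex Matrix.vec set \<Rightarrow> bool" where
  "small_net m L n S \<longleftrightarrow> S \<subseteq> carrier_vec n \<and> finite S \<and> real (card S) \<le> L ^ n \<and> (\<forall>v\<in>S. cvec_norm v \<le> 2) \<and>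
     (\<forall>x\<in>carrier_vec n. cvec_norm x = 1 \<longrightarrow> (\<exists>v\<in>S. cvec_norm (x - v) \<le> 1 / real m))"

text \<open>Round \<open>m sqrt n x\<close> to a vector of Gaussian integers. Its squared norm, hence its \<open>l\<^sup>1\<close> norm, is
  of order \<open>n\<close>, so the number of candidates is exponential in \<open>n\<close>.\<close>

lemma small_net_exists:
  assumes m: "m \<ge> (1::nat)"
  shows "\<exists>L\<ge>1. \<forall>n\<ge>1. \<exists>S. small_net m L n S"
proof (intro exI[of _ "2 ^ (2 * m\<^sup>2 + 1) * 9"] conjI allI impI)
  let ?R = "2 * m\<^sup>2 + 1"
  show "(1::real) \<le> 2 ^ ?R * 9" using one_le_power[of "2::real" ?R] by linarith
  fix n :: nat assume n: "n \<ge> 1"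
  \<comment> \<open>The second component tells the real from the imaginary part.\<close>
  define I where "I = {..<n} \<times> (UNIV :: bool set)"
  have I: "finite I" "card I = 2 * n" by (auto simp: I_def card_cartesian_product)
  define K where "K = ?R * n"
  define Z where "Z = {z \<in> PiE I (\<lambda>_. {- int K..int K}). (\<Sum>i\<in>I. \<bar>z i\<bar>) \<le> int K}"
  note Z = card_int_l1_ball[OF I(1), of K, folded Z_def]
  define s where "s = real m * sqrt (real n)"
  have s: "s > 0" using m n by (simp add: s_def)
  have s2: "s\<^sup>2 = (real m)\<^sup>2 * real n" by (simp add: s_def power_mult_distrib)
  define pt where "pt z = vec n (\<lambda>j. Complex (real_of_int (z (j, False)) / s) (real_of_int (z (j, True)) / s))" for z
  define S where "S = {v \<in> pt ` Z. cvec_norm v \<le> 2}"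
  have S: "S \<subseteq> carrier_vec n" "finite S" using Z(1) by (auto simp: S_def pt_def)
  have "real (card S) \<le> real (card Z)"
    using card_mono[of "pt ` Z" S] card_image_le[OF Z(1), of pt] Z(1) by (auto simp: S_def)
  also have "\<dots> \<le> 2 ^ K * 3 ^ (2 * n)" using Z(2) unfolding I(2) .
  also have "\<dots> = (2 ^ ?R) ^ n * (3\<^sup>2) ^ n" unfolding K_def by (simp only: power_mult)
  also have "\<dots> = (2 ^ ?R * 9) ^ n" by (subst power_mult_distrib) simp
  finally have card: "real (card S) \<le> (2 ^ ?R * 9) ^ n" .
  have net: "\<exists>v\<in>S. cvec_norm (x - v) \<le> 1 / real m" if x: "x \<in> carrier_vec n" "cvec_norm x = 1" for x
  proof -
    define y where "y i = s * (if snd i then Im (vec_index x (fst i)) else Re (vec_index x (fst i)))" for i :: "nat \<times> bool"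
    define z where "z = restrict (\<lambda>i. round (y i)) I"
    have err: "\<bar>real_of_int (z i) - y i\<bar> \<le> 1 / 2" if "i \<in> I" for i
      using that of_int_round_abs_le[of "y i"] by (simp add: z_def)
    have split: "(\<Sum>i\<in>I. f i) = (\<Sum>j<n. f (j, False) + f (j, True))" for f :: "nat \<times> bool \<Rightarrow> real"
    proof -
      have "(\<Sum>i\<in>I. f i) = (\<Sum>j<n. \<Sum>b\<in>UNIV. f (j, b))" by (simp only: I_def sum.cartesian_product case_prod_eta)
      then show ?thesis by (simp add: UNIV_bool add.commute)
    qed
    have ysum: "(\<Sum>i\<in>I. (y i)\<^sup>2) = s\<^sup>2"
    proof -
      have "(\<Sum>i\<in>I. (y i)\<^sup>2) = s\<^sup>2 * (cvec_norm x)\<^sup>2"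
        unfolding split by (simp add: y_def cvec_norm_power2[OF x(1)] cmod_power2 power_mult_distrib sum_distrib_left distrib_left)
      then show ?thesis using x(2) by simp
    qed
    have "(\<Sum>i\<in>I. \<bar>real_of_int (z i)\<bar>) \<le> (\<Sum>i\<in>I. 2 * (y i)\<^sup>2 + 1 / 2)"
    proof (rule sum_mono)
      fix i assume i: "i \<in> I"
      have "\<bar>real_of_int (z i)\<bar> \<le> (real_of_int (z i))\<^sup>2"
      proof (cases "z i = 0")
        case False
        then have "1 \<le> \<bar>real_of_int (z i)\<bar>" by linarith
        then have "\<bar>real_of_int (z i)\<bar> * 1 \<le> \<bar>real_of_int (z i)\<bar> * \<bar>real_of_int (z i)\<bar>" by (intro mult_left_mono) auto
        then show ?thesis by (simp add: power2_eq_square abs_mult_self_eq)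
      qed simp
      also have "\<dots> \<le> 2 * (y i)\<^sup>2 + 2 * (real_of_int (z i) - y i)\<^sup>2"
        using sum_squares_bound[of "y i" "real_of_int (z i) - y i"] zero_le_power2[of "2 * y i - real_of_int (z i)"]
        by (simp add: power2_eq_square algebra_simps)
      also have "(real_of_int (z i) - y i)\<^sup>2 \<le> (1 / 2)\<^sup>2"
        using err[OF i] by (metis abs_ge_zero power2_abs power_mono)
      finally show "\<bar>real_of_int (z i)\<bar> \<le> 2 * (y i)\<^sup>2 + 1 / 2" by (simp add: power2_eq_square)
    qed
    also have "\<dots> = real K"
      using I by (simp add: sum.distrib sum_distrib_left[symmetric] ysum s2 K_def algebra_simps)
    finally have "real_of_int (\<Sum>i\<in>I. \<bar>z i\<bar>) \<le> real_of_int (int K)" by simp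
    then have l1: "(\<Sum>i\<in>I. \<bar>z i\<bar>) \<le> int K" by (simp only: of_int_le_iff)
    have "\<bar>z i\<bar> \<le> int K" if "i \<in> I" for i
      using member_le_sum[of i I "\<lambda>i. \<bar>z i\<bar>"] that I(1) l1 by auto
    then have zZ: "z \<in> Z" using l1 unfolding Z_def z_def by (auto simp: abs_le_iff minus_le_iff)
    have ptc: "pt z \<in> carrier_vec n" by (simp add: pt_def)
    have "(cvec_norm (x - pt z))\<^sup>2 = (\<Sum>j<n. (cmod (vec_index x j - vec_index (pt z) j))\<^sup>2)"
      using x(1) ptc by (subst cvec_norm_power2[of _ n]) (auto intro!: sum.cong)
    also have "\<dots> = (\<Sum>i\<in>I. ((real_of_int (z i) - y i) / s)\<^sup>2)"
      unfolding split using s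
      by (intro sum.cong refl) (simp add: pt_def y_def cmod_power2 power2_commute[of "Re _"] power2_commute[of "Im _"] diff_divide_distrib)
    also have "\<dots> \<le> (\<Sum>i\<in>I. (1 / 2 / s)\<^sup>2)"
    proof (rule sum_mono)
      fix i assume i: "i \<in> I"
      have "\<bar>real_of_int (z i) - y i\<bar> / s \<le> 1 / 2 / s" using err[OF i] s by (intro divide_right_mono) auto
      then have "\<bar>(real_of_int (z i) - y i) / s\<bar> \<le> 1 / 2 / s" using s by (simp add: abs_divide)
      then show "((real_of_int (z i) - y i) / s)\<^sup>2 \<le> (1 / 2 / s)\<^sup>2" by (metis abs_ge_zero power2_abs power_mono)
    qed
    also have "\<dots> = (real n / 2) / s\<^sup>2" using I by (simp add: power_divide)
    also have "\<dots> = 1 / (2 * (real m)\<^sup>2)" using n by (simp add: s2)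
    also have "\<dots> \<le> (1 / real m)\<^sup>2" using m by (simp add: power_divide divide_simps)
    finally have close: "cvec_norm (x - pt z) \<le> 1 / real m" by (rule power2_le_imp_le) simp
    have "pt z = x - (x - pt z)" using x(1) ptc by (intro eq_vecI) auto
    then have "cvec_norm (pt z) \<le> cvec_norm x + cvec_norm (x - pt z)"
      using cvec_norm_diff[of x n "x - pt z"] x(1) ptc by simp
    also have "\<dots> \<le> 2"
    proof -
      have "1 / real m \<le> 1" using m by simp
      then show ?thesis using close x(2) by linarith
    qed
    finally have "pt z \<in> S" using zZ by (simp add: S_def)
    then show ?thesis using close by blast
  qed
  show "\<exists>S. small_net m (2 ^ ?R * 9) n S"
    using S card net by (intro exI[of _ S]) (auto simp: small_net_def S_def)
qed

section \<open>Brownian motion near the identity\<close>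

text \<open>For unitary \<open>U\<close>, \<open>\<parallel>U v - v\<parallel>\<^sup>2 = 2 (\<parallel>v\<parallel>\<^sup>2 - Re \<langle>U v, v\<rangle>)\<close>, so the hypothesis on the net means
  \<open>\<parallel>U v - v\<parallel> < \<epsilon> / 2\<close>. Replacing a unit vector by a net point costs at most \<open>2 / m \<le> \<epsilon> / 2\<close>, since
  \<open>U\<close> is an isometry.\<close>

lemma unitary_near_identity_from_net:
  assumes U: "U \<in> unitary_group n" and \<epsilon>: "0 < \<epsilon>" and m: "4 / \<epsilon> \<le> real m"
    and S: "S \<subseteq> carrier_vec n" "\<And>x. x \<in> carrier_vec n \<Longrightarrow> cvec_norm x = 1 \<Longrightarrow> \<exists>v\<in>S. cvec_norm (x - v) \<le> 1 / real m"
    and good: "\<And>v. v \<in> S \<Longrightarrow> (cvec_norm v)\<^sup>2 - \<epsilon>\<^sup>2 / 8 < matrix_coeff v v U"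
    and x: "x \<in> carrier_vec n"
  shows "cvec_norm (U *\<^sub>v x - x) \<le> \<epsilon> * cvec_norm x"
proof -
  have iso: "isometry n n U" and Uc: "U \<in> carrier_mat n n" using U by (auto simp: unitary_group_def isometry_def)
  have m0: "0 < real m" using m \<epsilon> by (meson divide_pos_pos less_le_trans zero_less_numeral)
  then have m1: "1 / real m \<le> \<epsilon> / 4" using m \<epsilon> by (simp add: field_simps)
  have net: "cvec_norm (U *\<^sub>v v - v) \<le> \<epsilon> / 2" if "v \<in> S" for v
  proof -
    have v: "v \<in> carrier_vec n" using S that by auto
    have Uv: "U *\<^sub>v v \<in> carrier_vec n" using Uc by simp
    have "(cvec_norm (U *\<^sub>v v - v))\<^sup>2 = (cvec_norm (U *\<^sub>v v))\<^sup>2 + (cvec_norm v)\<^sup>2 - 2 * Re (cip (U *\<^sub>v v) v)"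
      using v Uv cip_commute[OF Uv v]
      by (simp add: cvec_norm_power2_cip cip_diff_left[of _ n] cip_diff_right[of _ n] del: index_mult_mat_vec)
    also have "\<dots> = 2 * ((cvec_norm v)\<^sup>2 - matrix_coeff v v U)"
      using isometry_norm[OF iso v] by (simp add: matrix_coeff_def)
    also have "\<dots> \<le> (\<epsilon> / 2)\<^sup>2" using good[OF that] by (simp add: power2_eq_square)
    finally show ?thesis by (rule power2_le_imp_le) (use \<epsilon> in simp)
  qed
  have unit: "cvec_norm (U *\<^sub>v y - y) \<le> \<epsilon>" if y: "y \<in> carrier_vec n" "cvec_norm y = 1" for y
  proof -
    obtain v where v: "v \<in> S" "cvec_norm (y - v) \<le> 1 / real m" using S(2)[OF y] by blast
    have vc: "v \<in> carrier_vec n" using S v by auto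
    have d: "y - v \<in> carrier_vec n" using y vc by simp
    have "U *\<^sub>v y - y = (U *\<^sub>v (y - v) + (U *\<^sub>v v - v)) - (y - v)"
      unfolding mult_minus_distrib_mat_vec[OF Uc y(1) vc]
      using y(1) vc Uc by (intro eq_vecI) (auto simp del: index_mult_mat_vec)
    also have "cvec_norm \<dots> \<le> cvec_norm (U *\<^sub>v (y - v)) + cvec_norm (U *\<^sub>v v - v) + cvec_norm (y - v)"
      using cvec_norm_diff[of "U *\<^sub>v (y - v) + (U *\<^sub>v v - v)" n "y - v"]
        cvec_norm_add[of "U *\<^sub>v (y - v)" n "U *\<^sub>v v - v"] Uc vc d by simp
    also have "\<dots> \<le> \<epsilon> / 4 + \<epsilon> / 2 + \<epsilon> / 4"
      using isometry_norm[OF iso d] net[OF v(1)] v(2) m1 by simp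
    finally show ?thesis by simp
  qed
  show ?thesis
  proof (cases "x = 0\<^sub>v n")
    case True
    have "cvec_norm (U *\<^sub>v x - x) \<le> cvec_norm (U *\<^sub>v x) + cvec_norm x"
      by (rule cvec_norm_diff[of _ n]) (use Uc x in auto)
    also have "\<dots> = 0" using isometry_norm[OF iso x] True by simp
    finally show ?thesis using True by simp
  next
    case False
    then have pos: "0 < cvec_norm x" by (rule cvec_norm_pos[OF x])
    define c where "c = complex_of_real (1 / cvec_norm x)"
    define y where "y = c \<cdot>\<^sub>v x"
    have y: "y \<in> carrier_vec n" "cvec_norm y = 1"
      using x pos by (auto simp: y_def c_def cvec_norm_smult norm_divide)
    have "U *\<^sub>v y - y = c \<cdot>\<^sub>v (U *\<^sub>v x - x)"
      unfolding y_def mult_mat_vec[OF Uc x] using x Uc by (intro eq_vecI) (auto simp: algebra_simps simp del: index_mult_mat_vec)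
    then have "cvec_norm (U *\<^sub>v x - x) / cvec_norm x = cvec_norm (U *\<^sub>v y - y)"
      using pos by (simp add: cvec_norm_smult c_def norm_divide)
    also have "\<dots> \<le> \<epsilon>" by (rule unit[OF y])
    finally show ?thesis using pos by (simp add: field_simps)
  qed
qed

text \<open>The net has at most \<open>L\<^sup>N\<close> points, and each is moved too far with probability at most
  \<open>exp (- N (\<kappa> \<eta> - c t))\<close>. Choosing \<open>\<kappa>\<close> first, so that \<open>\<kappa> \<eta> = ln L + 2\<close>, and then the times so small
  that \<open>c t \<le> 1\<close>, the union bound is at most \<open>exp (- N)\<close>. This is summable, and the Borel-Cantelli
  lemma applies.\<close>

lemma brownian_motion_near_identity:
  assumes prob: "prob_space M" and bm: "\<And>N. N \<ge> 1 \<Longrightarrow> unitary_brownian_motion M N (U N)" and \<epsilon>: "0 < \<epsilon>"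
  shows "\<exists>T>0. \<forall>t\<in>{0..T}. AE \<omega> in M. \<forall>\<^sub>F N in sequentially.
     \<forall>x\<in>carrier_vec N. cvec_norm (U N t \<omega> *\<^sub>v x - x) \<le> \<epsilon> * cvec_norm x"
proof -
  interpret prob_space M by fact
  define m where "m = nat \<lceil>4 / \<epsilon>\<rceil>"
  have m: "4 / \<epsilon> \<le> real m" unfolding m_def by (rule real_nat_ceiling_ge)
  moreover have "0 < 4 / \<epsilon>" using \<epsilon> by simp
  ultimately have "m \<ge> 1" by (cases m) auto
  from small_net_exists[OF this] obtain L :: real where L: "L \<ge> 1" and nets: "\<forall>n\<ge>1. \<exists>S. small_net m L n S" by (elim exE conjE)
  define S where "S n = (SOME S. small_net m L n S)" for n
  have "small_net m L n (S n)" if "n \<ge> 1" for n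
    unfolding S_def by (rule someI_ex[OF nets[rule_format, OF that]])
  then have S: "\<And>n. n \<ge> 1 \<Longrightarrow> S n \<subseteq> carrier_vec n" "\<And>n. n \<ge> 1 \<Longrightarrow> finite (S n)"
      "\<And>n. n \<ge> 1 \<Longrightarrow> real (card (S n)) \<le> L ^ n" "\<And>n v. n \<ge> 1 \<Longrightarrow> v \<in> S n \<Longrightarrow> cvec_norm v \<le> 2"
      "\<And>n x. n \<ge> 1 \<Longrightarrow> x \<in> carrier_vec n \<Longrightarrow> cvec_norm x = 1 \<Longrightarrow> \<exists>v\<in>S n. cvec_norm (x - v) \<le> 1 / real m"
    unfolding small_net_def by simp_all
  define \<eta> where "\<eta> = \<epsilon>\<^sup>2 / 8"
  have \<eta>: "\<eta> > 0" using \<epsilon> by (simp add: \<eta>_def)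
  define \<kappa> where "\<kappa> = (ln L + 2) / \<eta>"
  have \<kappa>: "\<kappa> > 0" using L \<eta> by (simp add: \<kappa>_def add_nonneg_pos)
  \<comment> \<open>This is \<open>\<kappa> r + \<kappa>\<^sup>2 r\<^sup>2\<close> at the largest value \<open>r = 4\<close> of a squared norm on the net.\<close>
  define c where "c = 4 * \<kappa> + 16 * \<kappa>\<^sup>2"
  have c: "c > 0" using \<kappa> by (simp add: c_def add_pos_pos)
  have "\<forall>t\<in>{0..1 / c}. AE \<omega> in M. \<forall>\<^sub>F N in sequentially.
     \<forall>x\<in>carrier_vec N. cvec_norm (U N t \<omega> *\<^sub>v x - x) \<le> \<epsilon> * cvec_norm x"
  proof
    fix t assume "t \<in> {0..1 / c}"
    then have t: "0 \<le> t" "c * t \<le> 1" using c by (auto simp: field_simps)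
    define B where "B n v = {\<omega> \<in> space M. matrix_coeff v v (U n t \<omega>) \<le> (cvec_norm v)\<^sup>2 - \<eta>}" for n v
    define bad where "bad n = (if n = 0 then {} else \<Union>v\<in>S n. B n v)" for n
    have B: "B n v \<in> sets M" "measure M (B n v) \<le> exp (- real n * (ln L + 1))" if "n \<ge> 1" "v \<in> S n" for n v
    proof -
      have v: "v \<in> carrier_vec n" using S(1) that by auto
      let ?r = "(cvec_norm v)\<^sup>2"
      note dev = brownian_motion_deviation[OF that(1) v less_imp_le[OF \<kappa>] prob bm[OF that(1)] t(1), of \<eta>]
      show "B n v \<in> sets M" unfolding B_def by (rule dev(1))
      have r: "0 \<le> ?r" "?r \<le> 4" using power_mono[OF S(4)[OF that] cvec_norm_nonneg, of 2] by auto
      have "?r\<^sup>2 \<le> 4\<^sup>2" using r by (intro power_mono) auto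
      then have "\<kappa> * ?r + \<kappa>\<^sup>2 * ?r\<^sup>2 \<le> \<kappa> * 4 + \<kappa>\<^sup>2 * 16" using r \<kappa> by (intro add_mono mult_left_mono) auto
      then have "(\<kappa> * ?r + \<kappa>\<^sup>2 * ?r\<^sup>2) * t \<le> c * t" unfolding c_def using t(1) by (intro mult_right_mono) auto
      then have "ln L + 1 \<le> \<kappa> * \<eta> - (\<kappa> * ?r + \<kappa>\<^sup>2 * ?r\<^sup>2) * t" using t(2) \<eta> by (simp add: \<kappa>_def)
      then have "real n * (ln L + 1) \<le> real n * (\<kappa> * \<eta> - (\<kappa> * ?r + \<kappa>\<^sup>2 * ?r\<^sup>2) * t)" by (intro mult_left_mono) auto
      then have "exp (- real n * (\<kappa> * \<eta> - (\<kappa> * ?r + \<kappa>\<^sup>2 * ?r\<^sup>2) * t)) \<le> exp (- real n * (ln L + 1))" by simp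
      then show "measure M (B n v) \<le> exp (- real n * (ln L + 1))" unfolding B_def using dev(2) by (rule order_trans[rotated])
    qed
    have bad: "bad n \<in> sets M" "measure M (bad n) \<le> exp (- 1) ^ n" for n
    proof -
      show "bad n \<in> sets M" using B(1) S(2) by (auto simp: bad_def intro!: sets.finite_UN)
      show "measure M (bad n) \<le> exp (- 1) ^ n"
      proof (cases "n = 0")
        case False
        then have n: "n \<ge> 1" by simp
        have "measure M (bad n) \<le> (\<Sum>v\<in>S n. measure M (B n v))"
          unfolding bad_def using False B(1)[OF n] by (auto intro!: finite_measure_subadditive_finite S(2) n)
        also have "\<dots> \<le> (\<Sum>v\<in>S n. exp (- real n * (ln L + 1)))" by (intro sum_mono B(2) n)
        also have "\<dots> \<le> L ^ n * exp (- real n * (ln L + 1))"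
          using S(3)[OF n] by (simp add: mult_right_mono)
        also have "\<dots> = exp (- 1) ^ n"
        proof -
          have "L ^ n = exp (n * ln L)" using L by (simp add: exp_of_nat_mult)
          then show ?thesis by (simp add: exp_of_nat_mult[symmetric] exp_add[symmetric] algebra_simps)
        qed
        finally show ?thesis .
      qed (simp add: bad_def)
    qed
    have "summable (\<lambda>n. measure M (bad n))"
    proof (rule summable_comparison_test'[where N = 0])
      show "summable (\<lambda>n. exp (- 1 :: real) ^ n)" by (rule summable_geometric) simp
    qed (use bad(2) in simp)
    then have "AE \<omega> in M. \<forall>\<^sub>F n in sequentially. \<omega> \<in> space M - bad n"
      by (intro borel_cantelli_AE1 bad(1)) (auto simp: emeasure_eq_measure)
    then show "AE \<omega> in M. \<forall>\<^sub>F N in sequentially. \<forall>x\<in>carrier_vec N. cvec_norm (U N t \<omega> *\<^sub>v x - x) \<le> \<epsilon> * cvec_norm x"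
    proof (rule AE_mp, intro AE_I2 impI)
      fix \<omega> assume w: "\<omega> \<in> space M" and ev: "\<forall>\<^sub>F n in sequentially. \<omega> \<in> space M - bad n"
      from ev eventually_ge_at_top[of 1]
      show "\<forall>\<^sub>F N in sequentially. \<forall>x\<in>carrier_vec N. cvec_norm (U N t \<omega> *\<^sub>v x - x) \<le> \<epsilon> * cvec_norm x"
      proof eventually_elim
        case (elim N)
        have "U N t \<omega> \<in> unitary_group N"
          using bm[OF elim(2)] t(1) w unfolding unitary_brownian_motion_def by blast
        moreover have "(cvec_norm v)\<^sup>2 - \<epsilon>\<^sup>2 / 8 < matrix_coeff v v (U N t \<omega>)" if "v \<in> S N" for v
          using elim that by (auto simp: bad_def B_def \<eta>_def not_le)
        ultimately show ?case
          using unitary_near_identity_from_net[OF _ \<epsilon> m S(1)[OF elim(2)] S(5)[OF elim(2)]] by blast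
      qed
    qed
  qed
  then show ?thesis using c by (intro exI[of _ "1 / c"]) auto
qed

section \<open>Principal angles along the Brownian motion\<close>

theorem theorem5p7:
  fixes M :: "'w measure"
    and U :: "nat \<Rightarrow> real \<Rightarrow> 'w \<Rightarrow> complex mat"
    and V W :: "nat \<Rightarrow> complex Matrix.vec set"
    and A :: "'h::chilbert_space op set" and \<tau> :: "'h op \<Rightarrow> complex" and p q :: "'h op"
    and \<theta> :: "real set"
  assumes "prob_space M"
    and "\<And>N. N \<ge> 1 \<Longrightarrow> unitary_brownian_motion M N (U N)"
    and "\<And>N. N \<ge> 1 \<Longrightarrow> csubspace N (V N)"
    and "\<And>N. N \<ge> 1 \<Longrightarrow> csubspace N (W N)"
    and "converge_jointly_strongly (\<lambda>N. orth_proj N (V N)) (\<lambda>N. orth_proj N (W N)) A \<tau> p q"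
    and "finite \<theta>"
    and "\<And>N. N \<ge> 1 \<Longrightarrow> set (principal_angles N (V N) (W N)) \<subseteq> \<theta>"
  shows "\<forall>G. open G \<and> \<theta> \<subseteq> G \<longrightarrow>
    (\<exists>T>0. \<forall>t\<in>{0..T}. AE \<omega> in M. \<forall>\<^sub>F N in sequentially.
       set (principal_angles N ((\<lambda>v. U N t \<omega> *\<^sub>v v) ` V N) (W N)) \<subseteq> G)"
proof (intro allI impI, elim conjE)
  fix G :: "real set" assume G: "open G" "\<theta> \<subseteq> G"
  obtain \<epsilon> where \<epsilon>: "\<epsilon> > 0" and stable: "\<forall>n V W. \<forall>U\<in>unitary_group n. csubspace n V \<longrightarrow>
     csubspace n W \<longrightarrow> set (principal_angles n V W) \<subseteq> \<theta> \<longrightarrow>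
     (\<forall>x\<in>carrier_vec n. cvec_norm (U *\<^sub>v x - x) \<le> \<epsilon> * cvec_norm x) \<longrightarrow>
     set (principal_angles n ((\<lambda>v. U *\<^sub>v v) ` V) W) \<subseteq> G"
    using principal_angles_near_identity[OF assms(6) G] by (elim exE conjE)
  obtain T where T: "T > 0" and near: "\<And>t. t \<in> {0..T} \<Longrightarrow> AE \<omega> in M. \<forall>\<^sub>F N in sequentially.
     \<forall>x\<in>carrier_vec N. cvec_norm (U N t \<omega> *\<^sub>v x - x) \<le> \<epsilon> * cvec_norm x"
    using brownian_motion_near_identity[OF assms(1,2) \<epsilon>] by fast
  have "AE \<omega> in M. \<forall>\<^sub>F N in sequentially. set (principal_angles N ((\<lambda>v. U N t \<omega> *\<^sub>v v) ` V N) (W N)) \<subseteq> G"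
    if t: "t \<in> {0..T}" for t
    using near[OF t]
  proof (rule AE_mp, intro AE_I2 impI)
    fix \<omega> assume w: "\<omega> \<in> space M"
      and ev: "\<forall>\<^sub>F N in sequentially. \<forall>x\<in>carrier_vec N. cvec_norm (U N t \<omega> *\<^sub>v x - x) \<le> \<epsilon> * cvec_norm x"
    from ev eventually_ge_at_top[of 1]
    show "\<forall>\<^sub>F N in sequentially. set (principal_angles N ((\<lambda>v. U N t \<omega> *\<^sub>v v) ` V N) (W N)) \<subseteq> G"
    proof eventually_elim
      case (elim N)
      have "U N t \<omega> \<in> unitary_group N"
        using assms(2)[OF elim(2)] t w unfolding unitary_brownian_motion_def by auto
      from stable[rule_format, OF this assms(3,4,7)[OF elim(2)]] show ?case using elim(1) by blast
    qed
  qed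
  then show "\<exists>T>0. \<forall>t\<in>{0..T}. AE \<omega> in M. \<forall>\<^sub>F N in sequentially.
       set (principal_angles N ((\<lambda>v. U N t \<omega> *\<^sub>v v) ` V N) (W N)) \<subseteq> G"
    using T by blast
qed

end
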